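(* A set $C\subseteq\dot{\mathcal{B}}'$ is compact if and only if for some $m\in\mathbb{N}_0$ the set $L_{2m}*C=\{L_{2m}*S:S\in C\}$ is (contained in $\mathcal{C}_0$ and) compact in $\mathcal{C}_0$.
   Context: All spaces consist of complex-valued functions or distributions on $\mathbb{R}^n$. $\mathcal{C}_0$ is the Banach space (sup norm) of continuous functions vanishing at infinity. $\mathcal{D}_{L^1}$ is the space of $C^\infty$-functions all of whose derivatives lie in $L^1$, with the topology defined by the norms $\varphi\mapsto\sup_{|\alpha|\le m}\|\partial^\alpha\varphi\|_1$, $m\in\mathbb{N}_0$. $\mathcal{B}'=\mathcal{D}'_{L^\infty}$ is the strong dual of $\mathcal{D}_{L^1}$, and $\dot{\mathcal{B}}'$ is the closure in $\mathcal{B}'$ of the space $\mathcal{E}'$ of compactly supported distributions, with the induced topology (it is not the dual of a space $\dot{\mathcal{B}}$). With the Fourier transform $\mathcal{F}\varphi(y)=\int_{\mathbb{R}^n}e^{-iyx}\varphi(x)\,dx$, the Bessel kernel is $L_s=\mathcal{F}^{-1}((1+|x|^2)^{-s/2})$; thus $L_0=\delta$, and $L_{2m}$ is the temperate fundamental solution of $(1-\Delta_n)^m$, where $\Delta_n$ is the Laplacian on $\mathbb{R}^n$. *)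

theory Defs
  imports "HOL-Analysis.Analysis"
begin

section \<open>Smooth functions\<close>

definition partial_deriv :: "'n::finite \<Rightarrow> (real^'n \<Rightarrow> complex) \<Rightarrow> real^'n \<Rightarrow> complex" where
  "partial_deriv i f = (\<lambda>x. frechet_derivative f (at x) (axis i 1))"

text \<open>
  Higher derivatives are indexed by words in the coordinates. For a smooth function partial
  derivatives commute, so the derivatives along words of length \<open>k\<close> are exactly the
  \<open>\<partial>\<^sup>\<alpha>\<close> for multi-indices \<open>\<alpha>\<close> with \<open>\<bar>\<alpha>\<bar> = k\<close>.
\<close>

definition iter_deriv :: "'n::finite list \<Rightarrow> (real^'n \<Rightarrow> complex) \<Rightarrow> real^'n \<Rightarrow> complex" where
  "iter_deriv w f = foldr partial_deriv w f"

definition smooth :: "(real^'n::finite \<Rightarrow> complex) \<Rightarrow> bool" where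
  "smooth f \<longleftrightarrow> (\<forall>w. iter_deriv w f differentiable_on UNIV)"

definition test_functions :: "(real^'n::finite \<Rightarrow> complex) set" where
  "test_functions = {\<phi>. smooth \<phi> \<and> compact (closure {x. \<phi> x \<noteq> 0})}"


section \<open>Topologies defined by seminorms\<close>

text \<open>
  Vectors are complex-valued functions on an arbitrary set, which covers both spaces of test
  functions and spaces of functionals.
\<close>

definition seminorm_topology ::
  "('a \<Rightarrow> complex) set \<Rightarrow> (('a \<Rightarrow> complex) \<Rightarrow> real) set \<Rightarrow> ('a \<Rightarrow> complex) topology" where
  "seminorm_topology V P = topology (\<lambda>U. U \<subseteq> V \<and>
     (\<forall>x\<in>U. \<exists>F\<subseteq>P. finite F \<and>
       (\<exists>\<epsilon>>0. {y\<in>V. \<forall>p\<in>F. p (\<lambda>a. y a - x a) < \<epsilon>} \<subseteq> U)))"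

lemma openin_seminorm_topology:
  "openin (seminorm_topology V P) U \<longleftrightarrow> U \<subseteq> V \<and>
     (\<forall>x\<in>U. \<exists>F\<subseteq>P. finite F \<and>
       (\<exists>\<epsilon>>0. {y\<in>V. \<forall>p\<in>F. p (\<lambda>a. y a - x a) < \<epsilon>} \<subseteq> U))"
proof -
  define nb where "nb x F \<epsilon> = {y\<in>V. \<forall>p\<in>F. p (\<lambda>a. y a - x a) < \<epsilon>}"
    for x and F :: "(('a \<Rightarrow> complex) \<Rightarrow> real) set" and \<epsilon> :: real
  have "istopology (\<lambda>U. U \<subseteq> V \<and> (\<forall>x\<in>U. \<exists>F\<subseteq>P. finite F \<and> (\<exists>\<epsilon>>0. nb x F \<epsilon> \<subseteq> U)))"
    unfolding istopology_def
  proof (intro conjI allI impI ballI)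
    fix S T
    assume "S \<subseteq> V \<and> (\<forall>x\<in>S. \<exists>F\<subseteq>P. finite F \<and> (\<exists>\<epsilon>>0. nb x F \<epsilon> \<subseteq> S))"
    then show "S \<inter> T \<subseteq> V" by (simp add: le_infI1)
  next
    fix S T x
    assume S: "S \<subseteq> V \<and> (\<forall>x\<in>S. \<exists>F\<subseteq>P. finite F \<and> (\<exists>\<epsilon>>0. nb x F \<epsilon> \<subseteq> S))"
      and T: "T \<subseteq> V \<and> (\<forall>x\<in>T. \<exists>F\<subseteq>P. finite F \<and> (\<exists>\<epsilon>>0. nb x F \<epsilon> \<subseteq> T))"
      and x: "x \<in> S \<inter> T"
    from S x have "\<exists>F\<subseteq>P. finite F \<and> (\<exists>\<epsilon>>0. nb x F \<epsilon> \<subseteq> S)" by simp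
    then obtain F \<epsilon> where F: "F \<subseteq> P" "finite F" "\<epsilon> > 0" "nb x F \<epsilon> \<subseteq> S" by (elim exE conjE)
    from T x have "\<exists>F\<subseteq>P. finite F \<and> (\<exists>\<epsilon>>0. nb x F \<epsilon> \<subseteq> T)" by simp
    then obtain G \<delta> where G: "G \<subseteq> P" "finite G" "\<delta> > 0" "nb x G \<delta> \<subseteq> T" by (elim exE conjE)
    have "nb x (F \<union> G) (min \<epsilon> \<delta>) \<subseteq> nb x F \<epsilon>" "nb x (F \<union> G) (min \<epsilon> \<delta>) \<subseteq> nb x G \<delta>"
      by (simp_all add: nb_def subset_eq)
    then have "nb x (F \<union> G) (min \<epsilon> \<delta>) \<subseteq> S \<inter> T" using F(4) G(4) by (metis Int_greatest order_trans)
    moreover have "F \<union> G \<subseteq> P" "finite (F \<union> G)" "min \<epsilon> \<delta> > 0" using F G by simp_all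
    ultimately show "\<exists>F\<subseteq>P. finite F \<and> (\<exists>\<epsilon>>0. nb x F \<epsilon> \<subseteq> S \<inter> T)" by metis
  next
    fix \<K>
    assume "\<forall>K\<in>\<K>. K \<subseteq> V \<and> (\<forall>x\<in>K. \<exists>F\<subseteq>P. finite F \<and> (\<exists>\<epsilon>>0. nb x F \<epsilon> \<subseteq> K))"
    then show "\<Union>\<K> \<subseteq> V" by (simp add: Sup_le_iff)
  next
    fix \<K> x
    assume K: "\<forall>K\<in>\<K>. K \<subseteq> V \<and> (\<forall>x\<in>K. \<exists>F\<subseteq>P. finite F \<and> (\<exists>\<epsilon>>0. nb x F \<epsilon> \<subseteq> K))"
      and "x \<in> \<Union>\<K>"
    then obtain K where x: "K \<in> \<K>" "x \<in> K" by (elim UnionE)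
    with K have "\<exists>F\<subseteq>P. finite F \<and> (\<exists>\<epsilon>>0. nb x F \<epsilon> \<subseteq> K)" by simp
    then obtain F \<epsilon> where "F \<subseteq> P" "finite F" "\<epsilon> > 0" "nb x F \<epsilon> \<subseteq> K" by (elim exE conjE)
    moreover have "K \<subseteq> \<Union>\<K>" using x by (simp add: Union_upper)
    ultimately show "\<exists>F\<subseteq>P. finite F \<and> (\<exists>\<epsilon>>0. nb x F \<epsilon> \<subseteq> \<Union>\<K>)" by (metis order_trans)
  qed
  then show ?thesis
    unfolding seminorm_topology_def nb_def by (simp add: topology_inverse')
qed

lemma topspace_seminorm_topology [simp]: "topspace (seminorm_topology V P) = V"
proof
  show "topspace (seminorm_topology V P) \<subseteq> V"
    by (rule conjunct1[OF openin_seminorm_topology[THEN iffD1, OF openin_topspace]])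
  have "openin (seminorm_topology V P) V"
    unfolding openin_seminorm_topology
    by (intro conjI ballI order_refl exI[of _ "{}"] exI[of _ 1]) simp_all
  then show "V \<subseteq> topspace (seminorm_topology V P)" by (rule openin_subset)
qed


section \<open>The space \<open>\<D>\<^bsub>L\<^sup>1\<^esub>\<close> and its strong dual\<close>

definition DL1 :: "(real^'n::finite \<Rightarrow> complex) set" where
  "DL1 = {\<phi>. smooth \<phi> \<and> (\<forall>w. integrable lborel (iter_deriv w \<phi>))}"

definition DL1_norm :: "nat \<Rightarrow> (real^'n::finite \<Rightarrow> complex) \<Rightarrow> real" where
  "DL1_norm m \<phi> = (SUP w\<in>{w. length w \<le> m}. LINT x|lborel. cmod (iter_deriv w \<phi> x))"

definition DL1_topology :: "(real^'n::finite \<Rightarrow> complex) topology" where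
  "DL1_topology = seminorm_topology DL1 (range DL1_norm)"

definition DL1_bounded :: "(real^'n::finite \<Rightarrow> complex) set \<Rightarrow> bool" where
  "DL1_bounded B \<longleftrightarrow> B \<subseteq> DL1 \<and> (\<forall>m. \<exists>c. \<forall>\<phi>\<in>B. DL1_norm m \<phi> \<le> c)"

text \<open>
  Functionals on \<^const>\<open>DL1\<close> are normalised to vanish off \<^const>\<open>DL1\<close>, so that equality of HOL
  functions is equality of functionals.
\<close>

definition DL1_dual :: "((real^'n::finite \<Rightarrow> complex) \<Rightarrow> complex) set" where
  "DL1_dual = {S. (\<forall>\<phi>. \<phi> \<notin> DL1 \<longrightarrow> S \<phi> = 0) \<and>
     (\<forall>\<phi>\<in>DL1. \<forall>\<psi>\<in>DL1. \<forall>a b. S (\<lambda>x. a * \<phi> x + b * \<psi> x) = a * S \<phi> + b * S \<psi>) \<and>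
     continuous_map DL1_topology euclidean S}"

text \<open>
  The strong topology is that of uniform convergence on bounded sets. The empty set is excluded
  because the supremum of an empty set of reals is unspecified.
\<close>

definition strong_dual_topology :: "((real^'n::finite \<Rightarrow> complex) \<Rightarrow> complex) topology" where
  "strong_dual_topology =
     seminorm_topology DL1_dual {\<lambda>S. SUP \<phi>\<in>B. cmod (S \<phi>) |B. DL1_bounded B \<and> B \<noteq> {}}"


section \<open>Compactly supported distributions and the space \<open>\<B>'\<close> with a dot\<close>

definition vanishes_on ::
  "((real^'n::finite \<Rightarrow> complex) \<Rightarrow> complex) \<Rightarrow> (real^'n) set \<Rightarrow> bool" where
  "vanishes_on S U \<longleftrightarrow>
     (\<forall>\<phi>\<in>test_functions. closure {x. \<phi> x \<noteq> 0} \<subseteq> U \<longrightarrow> S \<phi> = 0)"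

definition dist_support :: "((real^'n::finite \<Rightarrow> complex) \<Rightarrow> complex) \<Rightarrow> (real^'n) set" where
  "dist_support S = - \<Union>{U. open U \<and> vanishes_on S U}"

text \<open>
  Test functions are dense in \<^const>\<open>DL1\<close>, so a functional in \<^const>\<open>DL1_dual\<close> is determined by
  the distribution it restricts to. Every compactly supported distribution arises in this way.
\<close>

definition compactly_supported :: "((real^'n::finite \<Rightarrow> complex) \<Rightarrow> complex) set" where
  "compactly_supported = {S\<in>DL1_dual. compact (dist_support S)}"

definition B_dot_dual :: "((real^'n::finite \<Rightarrow> complex) \<Rightarrow> complex) set" where
  "B_dot_dual = strong_dual_topology closure_of compactly_supported"

definition B_dot_dual_topology :: "((real^'n::finite \<Rightarrow> complex) \<Rightarrow> complex) topology" where
  "B_dot_dual_topology = subtopology strong_dual_topology B_dot_dual"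


section \<open>Continuous functions vanishing at infinity\<close>

definition C0 :: "((real^'n::finite) \<Rightarrow>\<^sub>C complex) set" where
  "C0 = {f. (apply_bcontfun f \<longlongrightarrow> 0) at_infinity}"

definition dist_of_fun ::
  "(real^'n::finite \<Rightarrow> complex) \<Rightarrow> (real^'n \<Rightarrow> complex) \<Rightarrow> complex" where
  "dist_of_fun f = (\<lambda>\<phi>. if \<phi> \<in> DL1 then LINT x|lborel. f x * \<phi> x else 0)"


section \<open>Bessel kernels and convolution\<close>

text \<open>
  The normalisation is the one inverse to \<open>\<F>\<phi>(y) = \<integral> e\<^sup>-\<^sup>i\<^sup>y\<^sup>x \<phi>(x) dx\<close>.
\<close>

definition inverse_fourier :: "(real^'n::finite \<Rightarrow> complex) \<Rightarrow> real^'n \<Rightarrow> complex" where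
  "inverse_fourier \<phi> = (\<lambda>x. complex_of_real (1 / (2 * pi) ^ CARD('n)) *
     (LINT y|lborel. exp (\<i> * complex_of_real (x \<bullet> y)) * \<phi> y))"

text \<open>
  The inverse Fourier transform of a temperate distribution \<open>T\<close> is \<open>\<phi> \<mapsto> T (inverse_fourier \<phi>)\<close>.
  For \<open>\<phi>\<close> in \<^const>\<open>DL1\<close>, which contains the Schwartz space densely, \<open>inverse_fourier \<phi>\<close> is
  continuous and decreases faster than any power, so for a function \<open>T\<close> of polynomial growth the
  same integral also gives the continuous extension to \<^const>\<open>DL1\<close>.
\<close>

definition dist_inverse_fourier ::
  "(real^'n::finite \<Rightarrow> complex) \<Rightarrow> (real^'n \<Rightarrow> complex) \<Rightarrow> complex" where
  "dist_inverse_fourier g =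
     (\<lambda>\<phi>. if \<phi> \<in> DL1 then LINT \<xi>|lborel. g \<xi> * inverse_fourier \<phi> \<xi> else 0)"

definition bessel_kernel :: "real \<Rightarrow> (real^'n::finite \<Rightarrow> complex) \<Rightarrow> complex" where
  "bessel_kernel s =
     dist_inverse_fourier (\<lambda>x. complex_of_real ((1 + (norm x)\<^sup>2) powr (- s / 2)))"

text \<open>
  \<open>(T * S)(\<phi>) = S\<^sub>x (T\<^sub>y (\<phi>(x + y)))\<close>. For \<open>T = bessel_kernel s\<close> with \<open>s \<ge> 0\<close>
  the inner function is again in \<^const>\<open>DL1\<close>.
\<close>

definition dist_conv ::
  "((real^'n::finite \<Rightarrow> complex) \<Rightarrow> complex) \<Rightarrow> ((real^'n \<Rightarrow> complex) \<Rightarrow> complex) \<Rightarrow>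
   (real^'n \<Rightarrow> complex) \<Rightarrow> complex" where
  "dist_conv T S = (\<lambda>\<phi>. if \<phi> \<in> DL1 then S (\<lambda>x. T (\<lambda>y. \<phi> (x + y))) else 0)"

end

theory Submission
  imports Defs "HOL-Probability.Probability"
begin

text \<open>
  Write \<open>R = (1 - \<Delta>)\<^sup>-\<^sup>1\<close>. Subordination to the heat semigroup,
  \<open>R \<phi>(x) = \<integral> e\<^sup>-\<^sup>t \<gamma>(z) \<phi>(x + \<surd>(2t) z) dz dt\<close> with the standard Gaussian \<open>\<gamma>\<close>, shows that \<open>R\<close> is an
  average of translations which contracts \<open>L\<^sup>1\<close> and gains one derivative there (integrate by parts
  in \<open>z\<close>), and Fourier inversion gives \<open>(L\<^sub>2\<^sub>m * S)(\<phi>) = S(R\<^sup>m \<phi>)\<close>. If \<open>L\<^sub>2\<^sub>m * C\<close> is compact in the space of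
  continuous functions vanishing at infinity, then \<open>C\<close> is its image under the continuous map
  \<open>f \<mapsto> (1 - \<Delta>)\<^sup>m f\<close>. Conversely a compact \<open>C\<close> is equicontinuous, say of order \<open>k\<close>. For
  \<open>m = k + 1\<close> and a mollifier \<open>M\<^sub>r\<close>, the functionals \<open>\<phi> \<mapsto> S(M\<^sub>r R\<^sup>m \<phi>)\<close> converge to \<open>\<phi> \<mapsto> S(R\<^sup>m \<phi>)\<close> in the
  dual norm of \<open>L\<^sup>1\<close>, uniformly for \<open>S \<in> C\<close>, while for fixed \<open>r\<close> the functions \<open>M\<^sub>r R\<^sup>m \<phi>\<close> with \<open>\<parallel>\<phi>\<parallel>\<^sub>1 \<le> 1\<close>
  form a bounded set. Hence \<open>S \<mapsto> L\<^sub>2\<^sub>m * S\<close> is continuous on \<open>C\<close> for that dual norm, and its values are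
  limits of functions vanishing at infinity because this holds for compactly supported \<open>S\<close>.
\<close>

section \<open>Derivatives along words and the L1 norm\<close>

text \<open>The strong topology controls a functional only on sets bounded in every seminorm of
  \<open>DL1\<close>, whereas the dual norm of L^1 asks for control on the functions R^m \<phi> with
  \<open>L1_norm\<close> of \<phi> at most 1, of which only the derivatives up to order m are known
  to be bounded. This gap is the obstacle: mollification closes it, and equicontinuity makes the
  error uniform over C. The exponent k + 1 splits accordingly: k factors R pay for the order of the
  functionals, one pays for the rate r of the mollification error. A factor R is credited with a
  single derivative because, in dimension at least two, the L^1 norm of \<phi> does not control the
  second derivatives of R \<phi>. Difference quotients along a segment, R, its first derivatives and
  mollification are all averages of translates \<open>avg W Y\<close>. L^1 bounds, smoothness,
  Fourier multipliers, the exchange with a functional and the behaviour at infinity are therefore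
  proved for averages in general. Fourier inversion serves to identify operators by their
  multipliers and to show that functions in \<open>DL1\<close> are bounded.\<close>

lemma iter_deriv_Nil [simp]: "iter_deriv [] f = f"
  by (simp add: iter_deriv_def)

lemma iter_deriv_Cons: "iter_deriv (i # w) f = partial_deriv i (iter_deriv w f)"
  by (simp add: iter_deriv_def)

lemma iter_deriv_append: "iter_deriv (u @ w) f = iter_deriv u (iter_deriv w f)"
  by (simp add: iter_deriv_def)

lemma linear_axis_sum:
  fixes g :: "real^'n::finite \<Rightarrow> complex"
  assumes "linear g"
  shows "g h = (\<Sum>i\<in>UNIV. (h $ i) *\<^sub>R g (axis i 1))"
proof -
  have "h = (\<Sum>i\<in>UNIV. (h $ i) *\<^sub>R axis i 1)"
    using basis_expansion[of h] by (simp add: scalar_mult_eq_scaleR)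
  then have "g h = g (\<Sum>i\<in>UNIV. (h $ i) *\<^sub>R axis i 1)" by simp
  also have "\<dots> = (\<Sum>i\<in>UNIV. (h $ i) *\<^sub>R g (axis i 1))"
    by (simp add: linear_sum[OF assms] linear_cmul[OF assms])
  finally show ?thesis .
qed

lemma smooth_has_derivative:
  assumes "smooth f"
  shows "(iter_deriv w f has_derivative (\<lambda>h. \<Sum>i\<in>UNIV. (h $ i) *\<^sub>R iter_deriv (i # w) f x)) (at x)"
proof -
  have "iter_deriv w f differentiable (at x)"
    using assms by (auto simp: smooth_def differentiable_on_def)
  then have D: "(iter_deriv w f has_derivative frechet_derivative (iter_deriv w f) (at x)) (at x)"
    by (simp add: frechet_derivative_works)
  have "frechet_derivative (iter_deriv w f) (at x) =
      (\<lambda>h. \<Sum>i\<in>UNIV. (h $ i) *\<^sub>R iter_deriv (i # w) f x)"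
    unfolding iter_deriv_Cons partial_deriv_def
    by (intro ext linear_axis_sum has_derivative_linear[OF D])
  with D show ?thesis by simp
qed

lemma partial_deriv_unique:
  assumes "(f has_derivative (\<lambda>h. \<Sum>i\<in>UNIV. (h $ i) *\<^sub>R c i)) (at x)"
  shows "partial_deriv j f x = c j"
proof -
  have "frechet_derivative f (at x) = (\<lambda>h. \<Sum>i\<in>UNIV. (h $ i) *\<^sub>R c i)"
    using frechet_derivative_at[OF assms] by simp
  then have "partial_deriv j f x = (\<Sum>i\<in>UNIV. (axis j 1 $ i) *\<^sub>R c i)"
    by (simp add: partial_deriv_def)
  also have "\<dots> = (\<Sum>i\<in>UNIV. if i = j then c i else 0)"
    by (intro sum.cong) (auto simp: axis_def)
  also have "\<dots> = c j" by simp
  finally show ?thesis .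
qed

text \<open>A guess \<open>F\<close> for all iterated derivatives at once is enough: if each
  \<open>F (i # w)\<close> is the i-th partial derivative of \<open>F w\<close>, uniqueness of
  derivatives yields smoothness and the formula together. Shifts, linear combinations and averages
  are treated by exhibiting such a family.\<close>

lemma smooth_family:
  assumes "\<And>w x. (F w has_derivative (\<lambda>h. \<Sum>i\<in>UNIV. (h $ i) *\<^sub>R F (i # w) x)) (at x)"
  shows "smooth (F [])" and "iter_deriv w (F []) = F w"
proof -
  have *: "iter_deriv w (F []) = F w" for w
  proof (induction w)
    case (Cons i w)
    then show ?case
      using partial_deriv_unique[OF assms] by (auto simp: iter_deriv_Cons)
  qed simp
  show "iter_deriv w (F []) = F w" by (rule *)
  show "smooth (F [])"
    unfolding smooth_def * differentiable_on_def
    using assms by (auto simp: differentiable_def intro: differentiable_at_withinI)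
qed

lemma smooth_iter_deriv: "smooth f \<Longrightarrow> smooth (iter_deriv w f)"
  unfolding smooth_def by (metis iter_deriv_append)

lemma smooth_shift:
  assumes "smooth f"
  shows "smooth (\<lambda>x. f (x + a))"
    and "iter_deriv w (\<lambda>x. f (x + a)) = (\<lambda>x. iter_deriv w f (x + a))"
proof -
  define F where "F w = (\<lambda>x. iter_deriv w f (x + a))" for w
  have "(F w has_derivative (\<lambda>h. \<Sum>i\<in>UNIV. (h $ i) *\<^sub>R F (i # w) x)) (at x)" for w x
  proof -
    have "((\<lambda>x. x + a) has_derivative (\<lambda>h. h)) (at x)"
      by (auto intro!: derivative_eq_intros)
    from has_derivative_compose[OF this smooth_has_derivative[OF assms]]
    show ?thesis by (simp add: F_def o_def)
  qed
  from smooth_family[of F, OF this] show "smooth (\<lambda>x. f (x + a))"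
    "iter_deriv w (\<lambda>x. f (x + a)) = (\<lambda>x. iter_deriv w f (x + a))"
    by (simp_all add: F_def)
qed

lemma smooth_lincomb:
  assumes "smooth f" "smooth g"
  shows "smooth (\<lambda>x. a * f x + b * g x)"
    and "iter_deriv w (\<lambda>x. a * f x + b * g x) = (\<lambda>x. a * iter_deriv w f x + b * iter_deriv w g x)"
proof -
  define F where "F w = (\<lambda>x. a * iter_deriv w f x + b * iter_deriv w g x)" for w
  have "(F w has_derivative (\<lambda>h. \<Sum>i\<in>UNIV. (h $ i) *\<^sub>R F (i # w) x)) (at x)" for w x
    unfolding F_def
    apply (rule has_derivative_eq_rhs)
     apply (rule has_derivative_add has_derivative_mult_right smooth_has_derivative assms)+
    apply (simp add: sum_distrib_left sum.distrib[symmetric] scaleR_add_right algebra_simps)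
    done
  from smooth_family[of F, OF this] show "smooth (\<lambda>x. a * f x + b * g x)"
    "iter_deriv w (\<lambda>x. a * f x + b * g x) = (\<lambda>x. a * iter_deriv w f x + b * iter_deriv w g x)"
    by (simp_all add: F_def)
qed

lemma smooth_continuous:
  assumes "smooth f" shows "continuous_on UNIV (iter_deriv w f)"
  using assms unfolding smooth_def by (auto intro: differentiable_imp_continuous_on)

lemma smooth_measurable:
  assumes "smooth f" shows "iter_deriv w f \<in> borel_measurable borel"
  using smooth_continuous[OF assms] by (rule borel_measurable_continuous_onI)

definition L1_norm :: "(real^'n::finite \<Rightarrow> complex) \<Rightarrow> real" where
  "L1_norm f = (LINT x|lborel. cmod (f x))"

lemma L1_norm_nonneg [simp]: "L1_norm f \<ge> 0"
  by (simp add: L1_norm_def)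

lemma lborel_translation:
  fixes f :: "'a::euclidean_space \<Rightarrow> 'b::{banach, second_countable_topology}"
  shows "(LINT x|lborel. f (x + a)) = (LINT x|lborel. f x)"
    and "integrable lborel f \<Longrightarrow> integrable lborel (\<lambda>x. f (x + a))"
proof -
  have int: "integrable lborel (\<lambda>x. g (x + b))"
    if g: "integrable lborel g" for g :: "'a \<Rightarrow> 'b" and b
  proof -
    have "integrable (distr lborel borel (\<lambda>x. b + x)) g" using g by (simp add: lborel_distr_plus)
    then have "integrable lborel (\<lambda>x. g (b + x))"
      by (rule integrable_distr[rotated]) simp
    then show ?thesis by (simp add: add.commute)
  qed
  then show "integrable lborel f \<Longrightarrow> integrable lborel (\<lambda>x. f (x + a))" .
  show "(LINT x|lborel. f (x + a)) = (LINT x|lborel. f x)"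
  proof (cases "integrable lborel f")
    case True
    then have [measurable]: "f \<in> borel_measurable borel" by auto
    have "(LINT x|lborel. f x) = (LINT x|distr lborel borel (\<lambda>x. a + x). f x)"
      by (simp add: lborel_distr_plus)
    also have "\<dots> = (LINT x|lborel. f (a + x))" by (rule integral_distr) auto
    finally show ?thesis by (simp add: add.commute)
  next
    \<comment> \<open>A non-integrable function has Bochner integral 0, so it suffices that its
      translate is not integrable either.\<close>
    case False
    have "\<not> integrable lborel (\<lambda>x. f (x + a))"
    proof
      assume "integrable lborel (\<lambda>x. f (x + a))"
      from int[OF this, of "-a"] False show False by simp
    qed
    with False show ?thesis by (simp add: not_integrable_integral_eq)
  qed
qed

lemma L1_norm_shift [simp]: "L1_norm (\<lambda>x. f (x + a)) = L1_norm f"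
  unfolding L1_norm_def by (rule lborel_translation(1))

lemma L1_norm_add_le:
  assumes "integrable lborel f" "integrable lborel g"
  shows "L1_norm (\<lambda>x. f x + g x) \<le> L1_norm f + L1_norm g"
proof -
  have "L1_norm (\<lambda>x. f x + g x) \<le> (LINT x|lborel. cmod (f x) + cmod (g x))"
    unfolding L1_norm_def
    by (rule integral_mono) (use assms in \<open>auto intro: norm_triangle_ineq\<close>)
  also have "\<dots> = L1_norm f + L1_norm g"
    unfolding L1_norm_def by (rule Bochner_Integration.integral_add) (use assms in auto)
  finally show ?thesis .
qed

lemma L1_norm_scale: "L1_norm (\<lambda>x. a * f x) = cmod a * L1_norm f"
  by (simp add: L1_norm_def norm_mult)

section \<open>The space DL1\<close>

lemma DL1_smooth: "\<phi> \<in> DL1 \<Longrightarrow> smooth \<phi>"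
  and DL1_integrable: "\<phi> \<in> DL1 \<Longrightarrow> integrable lborel (iter_deriv w \<phi>)"
  by (auto simp: DL1_def)

lemma DL1_integrable0: "\<phi> \<in> DL1 \<Longrightarrow> integrable lborel \<phi>"
  using DL1_integrable[of \<phi> "[]"] by simp

lemma DL1_iter_deriv: "\<phi> \<in> DL1 \<Longrightarrow> iter_deriv w \<phi> \<in> DL1"
  by (auto simp: DL1_def smooth_iter_deriv iter_deriv_append[symmetric])

lemma DL1_shift: "\<phi> \<in> DL1 \<Longrightarrow> (\<lambda>x. \<phi> (x + a)) \<in> DL1"
  by (auto simp: DL1_def smooth_shift intro: lborel_translation)

lemma DL1_lincomb: "\<phi> \<in> DL1 \<Longrightarrow> \<psi> \<in> DL1 \<Longrightarrow> (\<lambda>x. a * \<phi> x + b * \<psi> x) \<in> DL1"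
  by (auto simp: DL1_def smooth_lincomb)

lemma DL1_add: "\<phi> \<in> DL1 \<Longrightarrow> \<psi> \<in> DL1 \<Longrightarrow> (\<lambda>x. \<phi> x + \<psi> x) \<in> DL1"
  and DL1_diff: "\<phi> \<in> DL1 \<Longrightarrow> \<psi> \<in> DL1 \<Longrightarrow> (\<lambda>x. \<phi> x - \<psi> x) \<in> DL1"
  and DL1_scale: "\<phi> \<in> DL1 \<Longrightarrow> (\<lambda>x. a * \<phi> x) \<in> DL1"
  using DL1_lincomb[of \<phi> \<psi> 1 1] DL1_lincomb[of \<phi> \<psi> 1 "-1"] DL1_lincomb[of \<phi> \<phi> a 0]
  by simp_all

lemma iter_deriv_scale: "smooth f \<Longrightarrow> iter_deriv w (\<lambda>x. a * f x) = (\<lambda>x. a * iter_deriv w f x)"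
  using smooth_lincomb(2)[of f f w a 0] by simp

lemma iter_deriv_diff: "smooth f \<Longrightarrow> smooth g \<Longrightarrow>
    iter_deriv w (\<lambda>x. f x - g x) = (\<lambda>x. iter_deriv w f x - iter_deriv w g x)"
  using smooth_lincomb(2)[of f g w 1 "-1"] by simp

lemma iter_deriv_add: "smooth f \<Longrightarrow> smooth g \<Longrightarrow>
    iter_deriv w (\<lambda>x. f x + g x) = (\<lambda>x. iter_deriv w f x + iter_deriv w g x)"
  using smooth_lincomb(2)[of f g w 1 1] by simp

lemma smooth_zero: "smooth (\<lambda>x. 0)" and iter_deriv_zero: "iter_deriv w (\<lambda>x. 0) = (\<lambda>x. 0)"
  using smooth_family[of "\<lambda>w x. 0"] by simp_all

lemma DL1_zero: "(\<lambda>x. 0) \<in> DL1"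
  by (simp add: DL1_def smooth_zero iter_deriv_zero)

lemma DL1_sum:
  assumes "finite I" "\<And>i. i \<in> I \<Longrightarrow> f i \<in> DL1"
  shows "(\<lambda>x. \<Sum>i\<in>I. f i x) \<in> DL1"
    and "iter_deriv w (\<lambda>x. \<Sum>i\<in>I. f i x) = (\<lambda>x. \<Sum>i\<in>I. iter_deriv w (f i) x)"
proof -
  have "(\<lambda>x. \<Sum>i\<in>I. f i x) \<in> DL1 \<and>
    iter_deriv w (\<lambda>x. \<Sum>i\<in>I. f i x) = (\<lambda>x. \<Sum>i\<in>I. iter_deriv w (f i) x)"
    using assms
  proof (induction I rule: finite_induct)
    case (insert j I)
    then show ?case
      by (simp add: DL1_add iter_deriv_add DL1_smooth)
  qed (simp add: DL1_zero iter_deriv_zero)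
  then show "(\<lambda>x. \<Sum>i\<in>I. f i x) \<in> DL1"
    "iter_deriv w (\<lambda>x. \<Sum>i\<in>I. f i x) = (\<lambda>x. \<Sum>i\<in>I. iter_deriv w (f i) x)" by auto
qed

lemma finite_words: "finite {w :: 'n::finite list. length w \<le> m}"
  using finite_lists_length_le[of "UNIV :: 'n set" m] by simp

lemma L1_norm_le_DL1_norm: "length w \<le> m \<Longrightarrow> L1_norm (iter_deriv w \<phi>) \<le> DL1_norm m \<phi>"
  unfolding DL1_norm_def L1_norm_def
  by (rule cSUP_upper) (simp_all add: bdd_above_finite finite_words finite_imageI)

lemma DL1_norm_least:
  assumes "\<And>w. length w \<le> m \<Longrightarrow> L1_norm (iter_deriv w \<phi>) \<le> c"
  shows "DL1_norm m \<phi> \<le> c"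
  unfolding DL1_norm_def
  by (rule cSUP_least) (use assms in \<open>auto simp: L1_norm_def intro!: exI[of _ "[]"]\<close>)

lemma DL1_norm_nonneg [simp]: "DL1_norm m \<phi> \<ge> 0"
  using L1_norm_le_DL1_norm[of "[]" m \<phi>] L1_norm_nonneg[of \<phi>] by (simp del: L1_norm_nonneg)

lemma DL1_norm_mono: "m \<le> k \<Longrightarrow> DL1_norm m \<phi> \<le> DL1_norm k \<phi>"
  by (rule DL1_norm_least) (rule L1_norm_le_DL1_norm, simp)

lemma DL1_norm_0: "DL1_norm 0 \<phi> = L1_norm \<phi>"
  using DL1_norm_least[of 0 \<phi> "L1_norm \<phi>"] L1_norm_le_DL1_norm[of "[]" 0 \<phi>] by force

lemma DL1_norm_scale:
  assumes "smooth \<phi>" shows "DL1_norm m (\<lambda>x. a * \<phi> x) \<le> cmod a * DL1_norm m \<phi>"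
  by (rule DL1_norm_least)
     (simp add: iter_deriv_scale[OF assms] L1_norm_scale mult_left_mono L1_norm_le_DL1_norm)

section \<open>Continuous functionals\<close>

lemma DL1_dual_add: "S \<in> DL1_dual \<Longrightarrow> \<phi> \<in> DL1 \<Longrightarrow> \<psi> \<in> DL1 \<Longrightarrow> S (\<lambda>x. \<phi> x + \<psi> x) = S \<phi> + S \<psi>"
  and DL1_dual_diff: "S \<in> DL1_dual \<Longrightarrow> \<phi> \<in> DL1 \<Longrightarrow> \<psi> \<in> DL1 \<Longrightarrow> S (\<lambda>x. \<phi> x - \<psi> x) = S \<phi> - S \<psi>"
  and DL1_dual_scale: "S \<in> DL1_dual \<Longrightarrow> \<phi> \<in> DL1 \<Longrightarrow> S (\<lambda>x. a * \<phi> x) = a * S \<phi>"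
proof -
  assume S: "S \<in> DL1_dual"
  then have L: "\<phi> \<in> DL1 \<Longrightarrow> \<psi> \<in> DL1 \<Longrightarrow> S (\<lambda>x. a * \<phi> x + b * \<psi> x) = a * S \<phi> + b * S \<psi>" for \<phi> \<psi> a b
    unfolding DL1_dual_def by blast
  show "\<phi> \<in> DL1 \<Longrightarrow> \<psi> \<in> DL1 \<Longrightarrow> S (\<lambda>x. \<phi> x + \<psi> x) = S \<phi> + S \<psi>"
    using L[of \<phi> \<psi> 1 1] by simp
  show "\<phi> \<in> DL1 \<Longrightarrow> \<psi> \<in> DL1 \<Longrightarrow> S (\<lambda>x. \<phi> x - \<psi> x) = S \<phi> - S \<psi>"
    using L[of \<phi> \<psi> 1 "-1"] by simp
  show "\<phi> \<in> DL1 \<Longrightarrow> S (\<lambda>x. a * \<phi> x) = a * S \<phi>"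
    using L[of \<phi> \<phi> a 0] by simp
qed

lemma DL1_dual_zero: "S \<in> DL1_dual \<Longrightarrow> S (\<lambda>x. 0) = 0"
  using DL1_dual_scale[of S "\<lambda>x. 0" 0] by (simp add: DL1_zero)

lemma DL1_dual_sum:
  assumes "S \<in> DL1_dual" "finite I" "\<And>i. i \<in> I \<Longrightarrow> f i \<in> DL1"
  shows "S (\<lambda>x. \<Sum>i\<in>I. f i x) = (\<Sum>i\<in>I. S (f i))"
  using assms(2,3)
proof (induction I rule: finite_induct)
  case (insert j I)
  then show ?case by (simp add: DL1_dual_add[OF assms(1)] DL1_sum)
qed (simp add: DL1_dual_zero assms(1))

lemma DL1_dualI:
  assumes lin: "\<And>\<phi> \<psi> a b. \<phi> \<in> DL1 \<Longrightarrow> \<psi> \<in> DL1 \<Longrightarrow> S (\<lambda>x. a * \<phi> x + b * \<psi> x) = a * S \<phi> + b * S \<psi>"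
    and zero: "\<And>\<phi>. \<phi> \<notin> DL1 \<Longrightarrow> S \<phi> = 0"
    and bound: "\<And>\<phi>. \<phi> \<in> DL1 \<Longrightarrow> cmod (S \<phi>) \<le> c * DL1_norm m \<phi>"
  shows "S \<in> DL1_dual"
proof -
  \<comment> \<open>The given \<open>c\<close> may be zero or negative, while the radius of the
    neighbourhood below is obtained by dividing by the constant.\<close>
  have c0: "c * DL1_norm m \<phi> \<le> max c 1 * DL1_norm m \<phi>" for \<phi> :: "real^'a \<Rightarrow> complex"
    by (rule mult_right_mono) auto
  have "openin DL1_topology {x \<in> DL1. S x \<in> U}" if U: "open U" for U
    unfolding DL1_topology_def openin_seminorm_topology
  proof (intro conjI ballI)
    fix \<phi> assume "\<phi> \<in> {x \<in> DL1. S x \<in> U}"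
    then have \<phi>: "\<phi> \<in> DL1" "S \<phi> \<in> U" by auto
    then obtain e where e: "e > 0" "ball (S \<phi>) e \<subseteq> U"
      using U by (meson open_contains_ball)
    have "{y \<in> DL1. \<forall>p\<in>{DL1_norm m}. p (\<lambda>a. y a - \<phi> a) < e / max c 1} \<subseteq> {x \<in> DL1. S x \<in> U}"
    proof clarsimp
      fix y assume y: "y \<in> DL1" "DL1_norm m (\<lambda>a. y a - \<phi> a) < e / max c 1"
      have "S y - S \<phi> = S (\<lambda>a. y a - \<phi> a)"
        using lin[OF y(1) \<phi>(1), of 1 "-1"] by simp
      then have "cmod (S y - S \<phi>) \<le> max c 1 * DL1_norm m (\<lambda>a. y a - \<phi> a)"
        using bound[OF DL1_diff[OF y(1) \<phi>(1)]] c0[of "\<lambda>a. y a - \<phi> a"] by simp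
      also have "\<dots> < e" using y(2) by (simp add: field_simps)
      finally show "S y \<in> U" using e by (auto simp: dist_norm norm_minus_commute)
    qed
    then show "\<exists>F\<subseteq>range DL1_norm. finite F \<and> (\<exists>\<epsilon>>0. {y \<in> DL1. \<forall>p\<in>F. p (\<lambda>a. y a - \<phi> a) < \<epsilon>} \<subseteq> {x \<in> DL1. S x \<in> U})"
      using e(1) by (intro exI[of _ "{DL1_norm m}"] conjI exI[of _ "e / max c 1"]) auto
  qed auto
  then have "continuous_map DL1_topology euclidean S"
    by (auto simp: continuous_map_def DL1_topology_def)
  with lin zero show ?thesis unfolding DL1_dual_def by blast
qed

text \<open>The seminorms increase with their index, so the finitely many that describe a
  neighbourhood of 0 are dominated by the one of largest index; homogeneity turns the neighbourhood
  into an inequality.\<close>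

lemma DL1_dual_bound:
  assumes "S \<in> DL1_dual"
  obtains c m where "c > 0" "\<And>\<phi>. \<phi> \<in> DL1 \<Longrightarrow> cmod (S \<phi>) \<le> c * DL1_norm m \<phi>"
proof -
  have "continuous_map DL1_topology euclidean S" using assms by (simp add: DL1_dual_def)
  then have "openin DL1_topology {x \<in> topspace DL1_topology. S x \<in> ball 0 1}"
    by (rule openin_continuous_map_preimage) simp
  then have "openin DL1_topology {x \<in> DL1. S x \<in> ball 0 1}"
    by (simp add: DL1_topology_def)
  moreover have "(\<lambda>x. 0) \<in> {x \<in> DL1. S x \<in> ball 0 1}"
    by (simp add: DL1_dual_zero[OF assms] DL1_zero)
  ultimately have "\<exists>F\<subseteq>range DL1_norm. finite F \<and> (\<exists>e>0.
      {y \<in> DL1. \<forall>p\<in>F. p (\<lambda>a. y a - 0) < e} \<subseteq> {x \<in> DL1. S x \<in> ball 0 1})"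
    unfolding DL1_topology_def openin_seminorm_topology by (elim conjE) (erule (1) bspec)
  then obtain F e where F: "F \<subseteq> range DL1_norm" "finite F" "e > 0"
    "{y \<in> DL1. \<forall>p\<in>F. p (\<lambda>a. y a - 0) < e} \<subseteq> {x \<in> DL1. S x \<in> ball 0 1}"
    by (elim exE conjE)
  obtain M where M: "finite M" "F = DL1_norm ` M"
    using finite_subset_image[OF F(2,1)] by auto
  \<comment> \<open>The set \<open>M\<close> may be empty, hence the inserted
    \<open>0\<close>.\<close>
  define m where "m = Max (insert 0 M)"
  have m: "k \<le> m" if "k \<in> M" for k unfolding m_def using M that by (intro Max_ge) auto
  have small: "cmod (S \<phi>) < 1" if "\<phi> \<in> DL1" "DL1_norm m \<phi> < e" for \<phi>
  proof -
    have "\<forall>p\<in>F. p \<phi> < e" using that M m by (auto intro: le_less_trans[OF DL1_norm_mono])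
    then show ?thesis using F(4) that(1) by (auto simp: subset_iff)
  qed
  have "cmod (S \<phi>) \<le> 2/e * DL1_norm m \<phi>" if \<phi>: "\<phi> \<in> DL1" for \<phi>
  proof (rule field_le_epsilon)
    fix d :: real assume d: "d > 0"
    \<comment> \<open>The slack \<open>d * e / 2\<close> keeps \<open>N\<close> positive when the
      norm of \<phi> vanishes; multiplied by \<open>2 / e\<close> it contributes exactly
      \<open>d\<close>.\<close>
    define N where "N = DL1_norm m \<phi> + d * e / 2"
    have N: "N > 0" using d \<open>e > 0\<close> by (simp add: N_def add_nonneg_pos)
    define a where "a = complex_of_real (e / (2 * N))"
    have "DL1_norm m (\<lambda>x. a * \<phi> x) \<le> cmod a * DL1_norm m \<phi>"
      by (rule DL1_norm_scale[OF DL1_smooth[OF \<phi>]])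
    also have "\<dots> \<le> cmod a * N" using d \<open>e > 0\<close> by (intro mult_left_mono) (auto simp: N_def)
    also have "\<dots> = e / 2" using N \<open>e > 0\<close> by (simp add: a_def norm_divide norm_mult)
    also have "\<dots> < e" using \<open>e > 0\<close> by simp
    finally have "cmod (S (\<lambda>x. a * \<phi> x)) < 1" by (intro small DL1_scale \<phi>)
    then have "cmod a * cmod (S \<phi>) < 1" by (simp add: DL1_dual_scale[OF assms \<phi>] norm_mult)
    then have "cmod (S \<phi>) < 2 * N / e"
      using N \<open>e > 0\<close> by (simp add: a_def norm_divide norm_mult field_simps)
    also have "\<dots> = 2/e * DL1_norm m \<phi> + d" using \<open>e > 0\<close> by (simp add: N_def field_simps)
    finally show "cmod (S \<phi>) \<le> 2/e * DL1_norm m \<phi> + d" by simp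
  qed
  then show ?thesis using that[of "2/e" m] \<open>e > 0\<close> by simp
qed

lemma DL1_dual_minus:
  assumes "S \<in> DL1_dual" "T \<in> DL1_dual" shows "(\<lambda>\<phi>. S \<phi> - T \<phi>) \<in> DL1_dual"
proof -
  obtain c m where S: "c > 0" "\<And>\<phi>. \<phi> \<in> DL1 \<Longrightarrow> cmod (S \<phi>) \<le> c * DL1_norm m \<phi>"
    using DL1_dual_bound[OF assms(1)] by metis
  obtain d k where T: "d > 0" "\<And>\<phi>. \<phi> \<in> DL1 \<Longrightarrow> cmod (T \<phi>) \<le> d * DL1_norm k \<phi>"
    using DL1_dual_bound[OF assms(2)] by metis
  have lin: "\<phi> \<in> DL1 \<Longrightarrow> \<psi> \<in> DL1 \<Longrightarrow> S (\<lambda>x. a * \<phi> x + b * \<psi> x) = a * S \<phi> + b * S \<psi>"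
    "\<phi> \<in> DL1 \<Longrightarrow> \<psi> \<in> DL1 \<Longrightarrow> T (\<lambda>x. a * \<phi> x + b * \<psi> x) = a * T \<phi> + b * T \<psi>"
    "\<phi> \<notin> DL1 \<Longrightarrow> S \<phi> = 0" "\<phi> \<notin> DL1 \<Longrightarrow> T \<phi> = 0" for \<phi> \<psi> a b
    using assms unfolding DL1_dual_def by blast+
  show ?thesis
  proof (rule DL1_dualI[where c = "c + d" and m = "max m k"])
    fix \<phi> :: "real^'a \<Rightarrow> complex" assume \<phi>: "\<phi> \<in> DL1"
    have "cmod (S \<phi> - T \<phi>) \<le> c * DL1_norm m \<phi> + d * DL1_norm k \<phi>"
      using S(2)[OF \<phi>] T(2)[OF \<phi>] norm_triangle_ineq4[of "S \<phi>" "T \<phi>"] by linarith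
    also have "\<dots> \<le> c * DL1_norm (max m k) \<phi> + d * DL1_norm (max m k) \<phi>"
      using S(1) T(1) by (intro add_mono mult_left_mono DL1_norm_mono) auto
    finally show "cmod (S \<phi> - T \<phi>) \<le> (c + d) * DL1_norm (max m k) \<phi>" by (simp add: algebra_simps)
  qed (simp_all add: lin algebra_simps)
qed

section \<open>The strong topology\<close>

definition sup_on :: "(real^'n::finite \<Rightarrow> complex) set \<Rightarrow> ((real^'n \<Rightarrow> complex) \<Rightarrow> complex) \<Rightarrow> real" where
  "sup_on B S = (SUP \<phi>\<in>B. cmod (S \<phi>))"

lemma strong_seminorms: "strong_dual_topology = seminorm_topology DL1_dual {sup_on B |B. DL1_bounded B \<and> B \<noteq> {}}"
  by (simp add: strong_dual_topology_def sup_on_def[abs_def])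

lemma topspace_strong [simp]: "topspace strong_dual_topology = DL1_dual"
  by (simp add: strong_seminorms)

lemma sup_on_bdd:
  assumes "DL1_bounded B" "S \<in> DL1_dual"
  shows "bdd_above ((\<lambda>\<phi>. cmod (S \<phi>)) ` B)"
proof -
  obtain c m where S: "c > 0" "\<And>\<phi>. \<phi> \<in> DL1 \<Longrightarrow> cmod (S \<phi>) \<le> c * DL1_norm m \<phi>"
    using DL1_dual_bound[OF assms(2)] by metis
  obtain d where d: "\<And>\<phi>. \<phi> \<in> B \<Longrightarrow> DL1_norm m \<phi> \<le> d"
    using assms(1) unfolding DL1_bounded_def by metis
  have "cmod (S \<phi>) \<le> c * d" if "\<phi> \<in> B" for \<phi>
  proof -
    have "\<phi> \<in> DL1" using assms(1) that by (auto simp: DL1_bounded_def)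
    then have "cmod (S \<phi>) \<le> c * DL1_norm m \<phi>" by (rule S)
    also have "\<dots> \<le> c * d" using S(1) d[OF that] by simp
    finally show ?thesis .
  qed
  then show ?thesis by (auto simp: bdd_above_def)
qed

lemma sup_on_upper:
  "DL1_bounded B \<Longrightarrow> S \<in> DL1_dual \<Longrightarrow> \<phi> \<in> B \<Longrightarrow> cmod (S \<phi>) \<le> sup_on B S"
  unfolding sup_on_def by (rule cSUP_upper[OF _ sup_on_bdd])

lemma sup_on_least: "B \<noteq> {} \<Longrightarrow> (\<And>\<phi>. \<phi> \<in> B \<Longrightarrow> cmod (S \<phi>) \<le> c) \<Longrightarrow> sup_on B S \<le> c"
  unfolding sup_on_def by (rule cSUP_least)

lemma sup_on_triangle:
  assumes B: "DL1_bounded B" "B \<noteq> {}" and "S \<in> DL1_dual" "T \<in> DL1_dual" "U \<in> DL1_dual"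
  shows "sup_on B (\<lambda>\<phi>. S \<phi> - U \<phi>) \<le> sup_on B (\<lambda>\<phi>. S \<phi> - T \<phi>) + sup_on B (\<lambda>\<phi>. T \<phi> - U \<phi>)"
proof (rule sup_on_least[OF B(2)])
  fix \<phi> assume "\<phi> \<in> B"
  then have "cmod (S \<phi> - T \<phi>) \<le> sup_on B (\<lambda>\<phi>. S \<phi> - T \<phi>)" "cmod (T \<phi> - U \<phi>) \<le> sup_on B (\<lambda>\<phi>. T \<phi> - U \<phi>)"
    using assms by (auto intro!: sup_on_upper[where S = "\<lambda>\<phi>. S \<phi> - T \<phi>"] sup_on_upper[where S = "\<lambda>\<phi>. T \<phi> - U \<phi>"] DL1_dual_minus)
  then show "cmod (S \<phi> - U \<phi>) \<le> sup_on B (\<lambda>\<phi>. S \<phi> - T \<phi>) + sup_on B (\<lambda>\<phi>. T \<phi> - U \<phi>)"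
    using norm_triangle_ineq[of "S \<phi> - T \<phi>" "T \<phi> - U \<phi>"] by simp
qed

lemma openin_strong_ball:
  assumes B: "DL1_bounded B" "B \<noteq> {}" and T: "T \<in> DL1_dual"
  shows "openin strong_dual_topology {S \<in> DL1_dual. sup_on B (\<lambda>\<phi>. S \<phi> - T \<phi>) < e}"
  unfolding strong_seminorms openin_seminorm_topology
proof (intro conjI ballI)
  fix S assume "S \<in> {S \<in> DL1_dual. sup_on B (\<lambda>\<phi>. S \<phi> - T \<phi>) < e}"
  then have S: "S \<in> DL1_dual" "sup_on B (\<lambda>\<phi>. S \<phi> - T \<phi>) < e" by auto
  define d where "d = e - sup_on B (\<lambda>\<phi>. S \<phi> - T \<phi>)"
  have "{y \<in> DL1_dual. \<forall>p\<in>{sup_on B}. p (\<lambda>a. y a - S a) < d} \<subseteq> {S \<in> DL1_dual. sup_on B (\<lambda>\<phi>. S \<phi> - T \<phi>) < e}"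
    using sup_on_triangle[OF B _ S(1) T] by (fastforce simp: d_def)
  moreover have "d > 0" using S(2) by (simp add: d_def)
  ultimately show "\<exists>F\<subseteq>{sup_on B |B. DL1_bounded B \<and> B \<noteq> {}}. finite F \<and>
      (\<exists>\<epsilon>>0. {y \<in> DL1_dual. \<forall>p\<in>F. p (\<lambda>a. y a - S a) < \<epsilon>} \<subseteq> {S \<in> DL1_dual. sup_on B (\<lambda>\<phi>. S \<phi> - T \<phi>) < e})"
    using B by (intro exI[of _ "{sup_on B}"] conjI exI[of _ d]) auto
qed auto

lemma sup_on_zero: "B \<noteq> {} \<Longrightarrow> sup_on B (\<lambda>\<phi>. 0) = 0"
  by (simp add: sup_on_def)

text \<open>A point of the closure is approximated uniformly on one bounded set at a time, with an
  approximant that depends on this set. One set, \<open>smoothed_ball\<close>, will be enough for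
  each accuracy.\<close>

lemma strong_closure_approx:
  assumes S: "S \<in> strong_dual_topology closure_of A" and B: "DL1_bounded B" "B \<noteq> {}" and "e > 0"
  obtains T where "T \<in> A" "T \<in> DL1_dual" "sup_on B (\<lambda>\<phi>. T \<phi> - S \<phi>) < e"
proof -
  have SD: "S \<in> DL1_dual" using S by (simp add: in_closure_of)
  let ?U = "{T \<in> DL1_dual. sup_on B (\<lambda>\<phi>. T \<phi> - S \<phi>) < e}"
  have "S \<in> ?U" using SD B \<open>e > 0\<close> by (simp add: sup_on_zero)
  moreover have "\<forall>U. S \<in> U \<and> openin strong_dual_topology U \<longrightarrow> (\<exists>T. T \<in> A \<and> T \<in> U)"
    using S unfolding in_closure_of by (elim conjE)
  ultimately have "\<exists>T. T \<in> A \<and> T \<in> ?U" using openin_strong_ball[OF B SD, of e] by (simp only: simp_thms)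
  then show ?thesis using that by auto
qed

text \<open>The open sets on which the seminorm of \<open>B\<close> is below \<open>j\<close>
  exhaust the dual, so finitely many of them cover \<open>C\<close>. The empty \<open>B\<close> is
  treated apart because its supremum is unspecified.\<close>

lemma compactin_strong_bounded:
  assumes C: "compactin strong_dual_topology C" and B: "DL1_bounded B"
  obtains c where "\<And>S \<phi>. S \<in> C \<Longrightarrow> \<phi> \<in> B \<Longrightarrow> cmod (S \<phi>) \<le> c"
proof (cases "B = {}")
  case False
  have CD: "C \<subseteq> DL1_dual" using compactin_subset_topspace[OF C] by simp
  have Z: "(\<lambda>\<phi>. 0) \<in> DL1_dual"
    by (rule DL1_dualI[where c = 0 and m = 0]) auto
  let ?U = "\<lambda>j::nat. {S \<in> DL1_dual. sup_on B (\<lambda>\<phi>. S \<phi> - 0) < real j}"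
  have "\<forall>U\<in>range ?U. openin strong_dual_topology U"
    using openin_strong_ball[OF B False Z] by auto
  moreover have "C \<subseteq> \<Union>(range ?U)"
  proof
    fix S assume "S \<in> C"
    then show "S \<in> \<Union>(range ?U)"
      using CD reals_Archimedean2[of "sup_on B (\<lambda>\<phi>. S \<phi> - 0)"] by auto
  qed
  ultimately obtain \<F> where F: "finite \<F>" "\<F> \<subseteq> range ?U" "C \<subseteq> \<Union>\<F>"
    using C unfolding compactin_def by meson
  obtain J where J: "finite J" "\<F> = ?U ` J" using finite_subset_image[OF F(1,2)] by auto
  show ?thesis
  proof (rule that)
    fix S \<phi> assume "S \<in> C" "\<phi> \<in> B"
    then obtain j where j: "j \<in> J" "sup_on B S < real j" using F(3) J(2) by auto
    have "cmod (S \<phi>) \<le> sup_on B S" using CD \<open>S \<in> C\<close> \<open>\<phi> \<in> B\<close> B by (intro sup_on_upper) auto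
    also have "\<dots> \<le> real (Max J)" using j J by (meson Max_ge less_imp_le of_nat_le_iff order_trans)
    finally show "cmod (S \<phi>) \<le> real (Max J)" .
  qed
qed (use that in auto)

text \<open>No completeness is needed here: if equicontinuity fails, the witnesses of its failure form
  a bounded set on which \<open>C\<close> is not uniformly bounded.\<close>

lemma equicontinuous_of_bounded:
  assumes "C \<subseteq> DL1_dual"
    and bdd: "\<And>B. DL1_bounded B \<Longrightarrow> \<exists>c. \<forall>S\<in>C. \<forall>\<phi>\<in>B. cmod (S \<phi>) \<le> c"
  obtains c k where "c > 0" "\<And>S \<phi>. S \<in> C \<Longrightarrow> \<phi> \<in> DL1 \<Longrightarrow> cmod (S \<phi>) \<le> c * DL1_norm k \<phi>"
proof (rule ccontr)
  assume neg: "\<not> thesis"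
  have "\<exists>S \<phi>. S \<in> C \<and> \<phi> \<in> DL1 \<and> cmod (S \<phi>) > real (Suc k) * DL1_norm k \<phi>" for k
  proof (rule ccontr)
    assume "\<not> ?thesis"
    then have "cmod (S \<phi>) \<le> real (Suc k) * DL1_norm k \<phi>" if "S \<in> C" "\<phi> \<in> DL1" for S \<phi>
      using that by force
    with that[of "real (Suc k)" k] neg show False by auto
  qed
  then obtain S \<phi> where S: "\<And>k. S k \<in> C" "\<And>k. \<phi> k \<in> DL1"
    "\<And>k. cmod (S k (\<phi> k)) > real (Suc k) * DL1_norm k (\<phi> k)" by metis
  have pos: "cmod (S k (\<phi> k)) > 0" for k
    using S(3)[of k] by (smt (verit, best) DL1_norm_nonneg mult_nonneg_nonneg of_nat_0_le_iff)
  \<comment> \<open>The scaling makes the value of \<open>S k\<close> equal to \<open>Suc k\<close>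
    in modulus, while the failed estimate for \<open>\<phi> k\<close> keeps the norm of index
    \<open>k\<close> at most 1.\<close>
  define \<psi> where "\<psi> k = (\<lambda>x. complex_of_real (real (Suc k) / cmod (S k (\<phi> k))) * \<phi> k x)" for k
  have \<psi>: "\<psi> k \<in> DL1" for k unfolding \<psi>_def by (rule DL1_scale[OF S(2)])
  have S\<psi>: "cmod (S k (\<psi> k)) = real (Suc k)" for k
  proof -
    have "S k \<in> DL1_dual" using S(1) assms(1) by auto
    then show ?thesis
      using pos[of k] unfolding \<psi>_def by (simp only: DL1_dual_scale[OF _ S(2)] norm_mult) (simp add: norm_divide del: of_nat_Suc)
  qed
  have N: "DL1_norm k (\<psi> k) \<le> 1" for k
  proof -
    have "DL1_norm k (\<psi> k) \<le> real (Suc k) / cmod (S k (\<phi> k)) * DL1_norm k (\<phi> k)"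
      using DL1_norm_scale[OF DL1_smooth[OF S(2)], of k "complex_of_real (real (Suc k) / cmod (S k (\<phi> k)))" k]
      unfolding \<psi>_def by (simp add: norm_divide del: of_nat_Suc)
    also have "\<dots> \<le> 1" using S(3)[of k] pos[of k] by (simp add: field_simps del: of_nat_Suc)
    finally show ?thesis .
  qed
  have "DL1_bounded (range \<psi>)"
    unfolding DL1_bounded_def
  proof (intro conjI allI)
    fix m
    \<comment> \<open>For fixed \<open>m\<close> only the terms with \<open>k < m\<close> can have
      norm above 1, and there are finitely many of these.\<close>
    have "DL1_norm m (\<psi> k) \<le> 1 + (\<Sum>j<m. DL1_norm m (\<psi> j))" for k
    proof (cases "k < m")
      case True
      then have "DL1_norm m (\<psi> k) \<le> (\<Sum>j<m. DL1_norm m (\<psi> j))" by (intro member_le_sum) auto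
      then show ?thesis by simp
    next
      case False
      then have "DL1_norm m (\<psi> k) \<le> 1" using order_trans[OF DL1_norm_mono N, of m k] by simp
      then show ?thesis by (simp add: add_increasing2 sum_nonneg)
    qed
    then show "\<exists>c. \<forall>\<phi>\<in>range \<psi>. DL1_norm m \<phi> \<le> c" by auto
  qed (use \<psi> in auto)
  from bdd[OF this] obtain c where c: "\<And>k. cmod (S k (\<psi> k)) \<le> c" using S(1) by blast
  obtain k where "real k > c" using reals_Archimedean2 by blast
  with c[of k] S\<psi>[of k] show False by simp
qed

section \<open>Averages of translates\<close>

text \<open>The parameter space is left open: it is the line for segments, \<open>real^'n\<close>
  for mollifiers and Gaussian integrals, and time times space for the resolvent.\<close>

definition avg :: "('a::euclidean_space \<Rightarrow> complex) \<Rightarrow> ('a \<Rightarrow> real^'n::finite) \<Rightarrow> (real^'n \<Rightarrow> complex) \<Rightarrow> real^'n \<Rightarrow> complex" where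
  "avg W Y f = (\<lambda>x. LINT \<omega>|lborel. W \<omega> * f (x + Y \<omega>))"

lemma lborel_pair_Fubini_integrable:
  fixes F :: "'a::euclidean_space \<Rightarrow> 'b::euclidean_space \<Rightarrow> 'c::{banach, second_countable_topology}"
  assumes "case_prod F \<in> borel_measurable (lborel \<Otimes>\<^sub>M lborel)"
    and "integrable lborel (\<lambda>x. LINT y|lborel. norm (F x y))"
    and "\<And>x. integrable lborel (F x)"
  shows "integrable (lborel \<Otimes>\<^sub>M lborel) (case_prod F)"
  by (rule lborel_pair.Fubini_integrable) (use assms in auto)

text \<open>Minkowski's integral inequality for L^1: the modulus moves inside and the two integrals
  are exchanged.\<close>

lemma L1_norm_integral_le:
  fixes F :: "'a::euclidean_space \<Rightarrow> real^'n::finite \<Rightarrow> complex"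
  assumes F: "integrable (lborel \<Otimes>\<^sub>M lborel) (case_prod F)"
  shows "L1_norm (\<lambda>x. LINT \<omega>|lborel. F \<omega> x) \<le> (LINT \<omega>|lborel. L1_norm (F \<omega>))"
proof -
  from F have N: "integrable (lborel \<Otimes>\<^sub>M lborel) (case_prod (\<lambda>\<omega> x. cmod (F \<omega> x)))"
    using integrable_norm[OF F] by (simp add: case_prod_unfold)
  have "L1_norm (\<lambda>x. LINT \<omega>|lborel. F \<omega> x) \<le> (LINT x|lborel. LINT \<omega>|lborel. cmod (F \<omega> x))"
    unfolding L1_norm_def
    by (rule integral_mono_AE') (auto intro!: lborel_pair.integrable_snd[OF N] integral_nonneg_AE)
  also have "\<dots> = (LINT \<omega>|lborel. L1_norm (F \<omega>))"
    unfolding L1_norm_def by (rule lborel_pair.Fubini_integral[OF N])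
  finally show ?thesis .
qed

text \<open>The weight may be complex and of any mass, since Gaussian moments and the function being
  mollified occur as weights besides probability densities.\<close>

locale averaging =
  fixes W :: "'a::euclidean_space \<Rightarrow> complex" and Y :: "'a \<Rightarrow> real^'n::finite"
  assumes W: "integrable lborel W" and Y [measurable]: "Y \<in> borel_measurable borel"
begin

lemma W_measurable [measurable]: "W \<in> borel_measurable borel"
  using W by auto

definition mass :: real where "mass = (LINT \<omega>|lborel. cmod (W \<omega>))"

lemma mass_nonneg [simp]: "mass \<ge> 0"
  by (simp add: mass_def)

lemma pair_integrable:
  assumes f: "integrable lborel f"
  shows "integrable (lborel \<Otimes>\<^sub>M lborel) (\<lambda>(\<omega>, x). W \<omega> * f (x + Y \<omega>))"
proof (rule lborel_pair_Fubini_integrable)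
  have [measurable]: "f \<in> borel_measurable borel" using f by auto
  show "(\<lambda>(\<omega>, x). W \<omega> * f (x + Y \<omega>)) \<in> borel_measurable (lborel \<Otimes>\<^sub>M lborel)" by measurable
  have "(LINT x|lborel. norm (W \<omega> * f (x + Y \<omega>))) = cmod (W \<omega>) * L1_norm f" for \<omega>
    by (simp add: L1_norm_def norm_mult lborel_translation(1)[where f = "\<lambda>x. cmod (f x)"])
  then show "integrable lborel (\<lambda>\<omega>. LINT x|lborel. norm (W \<omega> * f (x + Y \<omega>)))" using W by simp
  show "integrable lborel (\<lambda>x. W \<omega> * f (x + Y \<omega>))" for \<omega>
    using lborel_translation(2)[OF f] by simp
qed

lemma avg_integrable: "integrable lborel f \<Longrightarrow> integrable lborel (avg W Y f)"
  unfolding avg_def by (rule lborel_pair.integrable_snd[OF pair_integrable])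

lemma avg_integral:
  assumes "integrable lborel f"
  shows "(LINT x|lborel. avg W Y f x) = (LINT \<omega>|lborel. W \<omega>) * (LINT x|lborel. f x)"
proof -
  have "(LINT x|lborel. avg W Y f x) = (LINT \<omega>|lborel. LINT x|lborel. W \<omega> * f (x + Y \<omega>))"
    unfolding avg_def by (rule lborel_pair.Fubini_integral[OF pair_integrable[OF assms]])
  also have "\<dots> = (LINT \<omega>|lborel. W \<omega> * (LINT x|lborel. f x))"
    by (simp add: lborel_translation)
  finally show ?thesis by simp
qed

lemma L1_norm_avg:
  assumes "integrable lborel f" shows "L1_norm (avg W Y f) \<le> mass * L1_norm f"
proof -
  have "L1_norm (avg W Y f) \<le> (LINT \<omega>|lborel. L1_norm (\<lambda>x. W \<omega> * f (x + Y \<omega>)))"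
    unfolding avg_def using L1_norm_integral_le pair_integrable[OF assms] by blast
  also have "\<dots> = mass * L1_norm f" by (simp add: L1_norm_scale mass_def)
  finally show ?thesis .
qed

lemma bounded_integrable:
  assumes "f \<in> borel_measurable borel" "bounded (range f)"
  shows "integrable lborel (\<lambda>\<omega>. W \<omega> * f (x + Y \<omega>))"
proof -
  have [measurable]: "f \<in> borel_measurable borel" by fact
  obtain c where c: "\<And>x. cmod (f x) \<le> c" using assms(2) by (auto simp: bounded_iff)
  show ?thesis
  proof (rule Bochner_Integration.integrable_bound)
    show "integrable lborel (\<lambda>\<omega>. c * cmod (W \<omega>))" using W by simp
    show "AE \<omega> in lborel. norm (W \<omega> * f (x + Y \<omega>)) \<le> norm (c * cmod (W \<omega>))"
      using c order_trans[OF norm_ge_zero c]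
      by (auto simp: norm_mult abs_mult mult.commute[of c] intro!: AE_I2 mult_left_mono)
  qed measurable
qed

lemma avg_bound:
  assumes "\<And>x. cmod (f x) \<le> c"
  shows "cmod (avg W Y f x) \<le> mass * c"
proof -
  have "cmod (avg W Y f x) \<le> (LINT \<omega>|lborel. cmod (W \<omega> * f (x + Y \<omega>)))"
    unfolding avg_def by (rule integral_norm_bound)
  also have "\<dots> \<le> (LINT \<omega>|lborel. cmod (W \<omega>) * c)"
    using W assms order_trans[OF norm_ge_zero assms] by (intro integral_mono_AE') (auto simp: norm_mult intro!: mult_left_mono)
  finally show ?thesis by (simp add: mass_def)
qed

end

section \<open>Smooth functions with bounded derivatives\<close>

text \<open>The class on which an average with a merely integrable weight can be differentiated
  under the integral. \<open>DL1_bdd_smooth\<close> later places \<open>DL1\<close> inside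
  it.\<close>

definition bdd_smooth :: "(real^'n::finite \<Rightarrow> complex) \<Rightarrow> bool" where
  "bdd_smooth f \<longleftrightarrow> smooth f \<and> (\<forall>w. bounded (range (iter_deriv w f)))"

lemma sum_component_le:
  fixes h :: "real^'n::finite" and c :: "'n \<Rightarrow> complex"
  assumes "\<And>i. cmod (c i) \<le> M"
  shows "cmod (\<Sum>i\<in>UNIV. (h $ i) *\<^sub>R c i) \<le> real CARD('n) * M * norm h"
proof -
  have "cmod (\<Sum>i\<in>UNIV. (h $ i) *\<^sub>R c i) \<le> (\<Sum>i\<in>(UNIV::'n set). norm h * M)"
    by (rule sum_norm_le) (auto intro!: mult_mono assms component_le_norm_cart)
  then show ?thesis by (simp add: algebra_simps)
qed

lemma bounded_linear_components:
  fixes c :: "'n::finite \<Rightarrow> complex"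
  shows "bounded_linear (\<lambda>h::real^'n. \<Sum>i\<in>UNIV. (h $ i) *\<^sub>R c i)"
  by (intro bounded_linear_sum bounded_linear_compose[OF bounded_linear_scaleR_left bounded_linear_vec_nth])

lemma smooth_lipschitz:
  fixes f :: "real^'n::finite \<Rightarrow> complex"
  assumes f: "smooth f" and M: "\<And>i x. cmod (iter_deriv (i # w) f x) \<le> M"
  shows "cmod (iter_deriv w f x - iter_deriv w f y) \<le> real CARD('n) * M * norm (x - y)"
proof (rule differentiable_bound[of UNIV])
  show "(iter_deriv w f has_derivative (\<lambda>h. \<Sum>i\<in>UNIV. (h $ i) *\<^sub>R iter_deriv (i # w) f x)) (at x within UNIV)" for x
    using smooth_has_derivative[OF f] by simp
  show "onorm (\<lambda>h. \<Sum>i\<in>UNIV. (h $ i) *\<^sub>R iter_deriv (i # w) f x) \<le> real CARD('n) * M" for x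
    by (intro onorm_le sum_component_le M)
qed auto

text \<open>Mean value inequality for the function minus its linearisation at \<open>x\<close>, on
  the ball of radius \<open>norm h\<close>; there the difference of the first derivatives is itself
  of order \<open>norm h\<close>. One dimension factor arises from each of the two mean value
  estimates.\<close>

lemma smooth_taylor2:
  fixes f :: "real^'n::finite \<Rightarrow> complex"
  assumes f: "smooth f" and M: "\<And>i j x. cmod (iter_deriv (i # j # w) f x) \<le> M"
  shows "cmod (iter_deriv w f (x + h) - iter_deriv w f x - (\<Sum>i\<in>UNIV. (h $ i) *\<^sub>R iter_deriv (i # w) f x))
    \<le> (real CARD('n))\<^sup>2 * M * (norm h)\<^sup>2"
proof -
  let ?n = "real CARD('n)"
  have M0: "M \<ge> 0" using order_trans[OF norm_ge_zero M] .
  let ?g = "\<lambda>y. iter_deriv w f y - (\<Sum>i\<in>UNIV. (y $ i) *\<^sub>R iter_deriv (i # w) f x)"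
  have "cmod (?g (x + h) - ?g x) \<le> (?n * (?n * M * norm h)) * norm (x + h - x)"
  proof (rule differentiable_bound[of "cball x (norm h)"])
    fix y assume "y \<in> cball x (norm h)"
    then have y: "norm (y - x) \<le> norm h" by (simp add: dist_norm norm_minus_commute)
    have D2: "((\<lambda>y. \<Sum>i\<in>UNIV. (y $ i) *\<^sub>R iter_deriv (i # w) f x) has_derivative
      (\<lambda>h. \<Sum>i\<in>UNIV. (h $ i) *\<^sub>R iter_deriv (i # w) f x)) (at y)"
      by (rule bounded_linear_imp_has_derivative[OF bounded_linear_components])
    show "(?g has_derivative (\<lambda>h. (\<Sum>i\<in>UNIV. (h $ i) *\<^sub>R iter_deriv (i # w) f y)
         - (\<Sum>i\<in>UNIV. (h $ i) *\<^sub>R iter_deriv (i # w) f x))) (at y within cball x (norm h))"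
      by (rule has_derivative_at_withinI, rule has_derivative_diff[OF smooth_has_derivative[OF f] D2])
    have "cmod (iter_deriv (i # w) f y - iter_deriv (i # w) f x) \<le> ?n * M * norm h" for i
    proof -
      have "cmod (iter_deriv (i # w) f y - iter_deriv (i # w) f x) \<le> ?n * M * norm (y - x)"
        by (rule smooth_lipschitz[OF f M])
      also have "\<dots> \<le> ?n * M * norm h" using y M0 by (intro mult_left_mono) auto
      finally show ?thesis .
    qed
    from sum_component_le[OF this]
    show "onorm (\<lambda>h. (\<Sum>i\<in>UNIV. (h $ i) *\<^sub>R iter_deriv (i # w) f y)
         - (\<Sum>i\<in>UNIV. (h $ i) *\<^sub>R iter_deriv (i # w) f x)) \<le> ?n * (?n * M * norm h)"
      by (intro onorm_le) (simp add: sum_subtractf[symmetric] scaleR_diff_right[symmetric])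
  qed (auto simp: dist_norm)
  also have "?g (x + h) - ?g x = iter_deriv w f (x + h) - iter_deriv w f x - (\<Sum>i\<in>UNIV. (h $ i) *\<^sub>R iter_deriv (i # w) f x)"
    by (simp add: scaleR_add_left sum.distrib)
  finally show ?thesis by (simp add: power2_eq_square mult_ac)
qed

context averaging
begin

text \<open>Averaging the Taylor remainder leaves a remainder that is quadratic in the increment,
  uniformly in the base point. This gives differentiability of the average directly.\<close>

lemma avg_smooth:
  assumes f: "bdd_smooth f"
  shows "bdd_smooth (avg W Y f)" and "iter_deriv w (avg W Y f) = avg W Y (iter_deriv w f)"
proof -
  have sm: "smooth f" using f by (simp add: bdd_smooth_def)
  have int: "integrable lborel (\<lambda>\<omega>. W \<omega> * iter_deriv w f (x + Y \<omega>))" for w x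
    using f by (intro bounded_integrable smooth_measurable) (auto simp: bdd_smooth_def)
  define F where "F w = avg W Y (iter_deriv w f)" for w
  have "(F w has_derivative (\<lambda>h. \<Sum>i\<in>UNIV. (h $ i) *\<^sub>R F (i # w) x)) (at x)" for w x
  proof -
    have "\<exists>M. \<forall>x. cmod (iter_deriv (i # j # w) f x) \<le> M" for i j
      using f by (auto simp: bdd_smooth_def bounded_iff)
    then obtain M where M0: "\<And>i j x. cmod (iter_deriv (i # j # w) f x) \<le> M i j" by metis
    then have M: "cmod (iter_deriv (i # j # w) f x) \<le> (\<Sum>i\<in>UNIV. \<Sum>j\<in>UNIV. \<bar>M i j\<bar>)" for i j x
    proof -
      have "cmod (iter_deriv (i # j # w) f x) \<le> \<bar>M i j\<bar>"
        using M0[of i j x] by linarith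
      also have "\<dots> \<le> (\<Sum>j\<in>UNIV. \<bar>M i j\<bar>)" by (rule member_le_sum) auto
      also have "\<dots> \<le> (\<Sum>i\<in>UNIV. \<Sum>j\<in>UNIV. \<bar>M i j\<bar>)"
        by (rule member_le_sum[where f = "\<lambda>i. \<Sum>j\<in>UNIV. \<bar>M i j\<bar>"]) (auto intro: sum_nonneg)
      finally show ?thesis .
    qed
    \<comment> \<open>Mass times the Taylor constant; the added 1 makes \<open>K\<close> positive,
      so that \<open>e / K\<close> can serve as the radius.\<close>
    define K where "K = mass * ((real CARD('n))\<^sup>2 * (\<Sum>i\<in>(UNIV::'n set). \<Sum>j\<in>(UNIV::'n set). \<bar>M i j\<bar>)) + 1"
    have K1: "K > 0" unfolding K_def by (intro add_nonneg_pos mult_nonneg_nonneg sum_nonneg) auto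
    have K: "cmod (F w y - F w x - (\<Sum>i\<in>UNIV. ((y - x) $ i) *\<^sub>R F (i # w) x)) \<le> K * (norm (y - x))\<^sup>2" for y
    proof -
      let ?h = "y - x"
      have "F w y - F w x - (\<Sum>i\<in>UNIV. (?h $ i) *\<^sub>R F (i # w) x) =
        avg W Y (\<lambda>z. iter_deriv w f (z + ?h) - iter_deriv w f z - (\<Sum>i\<in>UNIV. (?h $ i) *\<^sub>R iter_deriv (i # w) f z)) x"
      proof -
        have 1: "F w y = (LINT \<omega>|lborel. W \<omega> * iter_deriv w f (x + Y \<omega> + ?h))"
          by (simp add: F_def avg_def algebra_simps)
        have 2: "integrable lborel (\<lambda>\<omega>. W \<omega> * iter_deriv w f (x + Y \<omega> + ?h))"
          using int[of w y] by (simp add: algebra_simps)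
        have 3: "integrable lborel (\<lambda>\<omega>. (?h $ i) *\<^sub>R (W \<omega> * iter_deriv (i # w) f (x + Y \<omega>)))" for i
          by (rule integrable_scaleR_right[OF int])
        have 4: "(\<Sum>i\<in>UNIV. (?h $ i) *\<^sub>R F (i # w) x) = (LINT \<omega>|lborel. (\<Sum>i\<in>UNIV. (?h $ i) *\<^sub>R (W \<omega> * iter_deriv (i # w) f (x + Y \<omega>))))"
          unfolding F_def avg_def using 3 by (subst Bochner_Integration.integral_sum) (auto simp del: vector_minus_component)
        have "F w y - F w x - (\<Sum>i\<in>UNIV. (?h $ i) *\<^sub>R F (i # w) x) =
          (LINT \<omega>|lborel. W \<omega> * iter_deriv w f (x + Y \<omega> + ?h) - W \<omega> * iter_deriv w f (x + Y \<omega>)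
            - (\<Sum>i\<in>UNIV. (?h $ i) *\<^sub>R (W \<omega> * iter_deriv (i # w) f (x + Y \<omega>))))"
          unfolding 1 4 using int 2 3
          by (subst Bochner_Integration.integral_diff, force, force)
             (subst Bochner_Integration.integral_diff, auto simp: F_def avg_def)
        also have "\<dots> = avg W Y (\<lambda>z. iter_deriv w f (z + ?h) - iter_deriv w f z - (\<Sum>i\<in>UNIV. (?h $ i) *\<^sub>R iter_deriv (i # w) f z)) x"
          unfolding avg_def
          by (intro Bochner_Integration.integral_cong refl) (simp add: right_diff_distrib sum_distrib_left)
        finally show ?thesis .
      qed
      also have "cmod \<dots> \<le> mass * ((real CARD('n))\<^sup>2 * (\<Sum>i\<in>(UNIV::'n set). \<Sum>j\<in>(UNIV::'n set). \<bar>M i j\<bar>) * (norm ?h)\<^sup>2)"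
        by (rule avg_bound) (rule smooth_taylor2[OF sm M])
      also have "\<dots> \<le> K * (norm ?h)\<^sup>2" by (simp add: K_def algebra_simps)
      finally show ?thesis .
    qed
    show ?thesis
      unfolding has_derivative_at_alt
    proof (intro conjI allI impI)
      show "bounded_linear (\<lambda>h. \<Sum>i\<in>UNIV. (h $ i) *\<^sub>R F (i # w) x)"
        by (rule bounded_linear_components)
      fix e :: real assume e: "e > 0"
      show "\<exists>d>0. \<forall>y. norm (y - x) < d \<longrightarrow> cmod (F w y - F w x - (\<Sum>i\<in>UNIV. (y - x) $ i *\<^sub>R F (i # w) x)) \<le> e * norm (y - x)"
      proof (intro exI[of _ "e / K"] conjI allI impI)
        fix y assume "norm (y - x) < e / K"
        then have "K * norm (y - x) * norm (y - x) \<le> e * norm (y - x)"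
          using K1 by (intro mult_right_mono) (auto simp: field_simps)
        then show "cmod (F w y - F w x - (\<Sum>i\<in>UNIV. (y - x) $ i *\<^sub>R F (i # w) x)) \<le> e * norm (y - x)"
          using K[of y] by (simp add: power2_eq_square algebra_simps)
      qed (use e K1 in simp)
    qed
  qed
  from smooth_family[of F, OF this] have *: "smooth (avg W Y f)" "\<And>w. iter_deriv w (avg W Y f) = avg W Y (iter_deriv w f)"
    by (simp_all add: F_def)
  then show "iter_deriv w (avg W Y f) = avg W Y (iter_deriv w f)" by simp
  have "bounded (range (avg W Y (iter_deriv w f)))" for w
  proof -
    obtain c where c: "\<And>x. cmod (iter_deriv w f x) \<le> c" using f by (auto simp: bdd_smooth_def bounded_iff)
    have "cmod (avg W Y (iter_deriv w f) x) \<le> mass * c" for x by (rule avg_bound[OF c])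
    then show ?thesis by (auto simp: bounded_iff)
  qed
  with * show "bdd_smooth (avg W Y f)" by (simp add: bdd_smooth_def)
qed

lemma avg_DL1:
  assumes "bdd_smooth f" "f \<in> DL1"
  shows "avg W Y f \<in> DL1"
  using avg_smooth[OF assms(1)] assms(2) by (auto simp: DL1_def bdd_smooth_def avg_integrable)

lemma DL1_norm_avg:
  assumes "bdd_smooth f" "f \<in> DL1"
  shows "DL1_norm m (avg W Y f) \<le> mass * DL1_norm m f"
proof (rule DL1_norm_least)
  fix w :: "'n list" assume w: "length w \<le> m"
  have "L1_norm (iter_deriv w (avg W Y f)) \<le> mass * L1_norm (iter_deriv w f)"
    using assms by (simp add: avg_smooth L1_norm_avg DL1_integrable)
  also have "\<dots> \<le> mass * DL1_norm m f" by (intro mult_left_mono L1_norm_le_DL1_norm w) auto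
  finally show "L1_norm (iter_deriv w (avg W Y f)) \<le> mass * DL1_norm m f" .
qed

end

section \<open>Translation in the mean and integration by parts\<close>

text \<open>The fundamental theorem of calculus along the segment from \<open>x\<close> to
  \<open>x + v\<close>, read as an average of translates of the derivative. This makes the bounds
  for averages available for differences.\<close>

lemma segment_average:
  fixes g g' :: "real^'n::finite \<Rightarrow> complex"
  assumes D: "\<And>x. ((\<lambda>s. g (x + s *\<^sub>R v)) has_vector_derivative g' x) (at 0)"
    and c: "continuous_on UNIV g'"
  shows "g (x + v) - g x = avg (\<lambda>s. complex_of_real (indicator {0..1::real} s)) (\<lambda>s. s *\<^sub>R v) g' x"
proof -
  have D': "((\<lambda>s. g (x + s *\<^sub>R v)) has_vector_derivative g' (x + s *\<^sub>R v)) (at s within T)" for s T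
  proof -
    have "((\<lambda>t. t - s) has_vector_derivative 1) (at s)" by (auto intro!: derivative_eq_intros)
    moreover have "((\<lambda>t. g (x + s *\<^sub>R v + t *\<^sub>R v)) has_vector_derivative g' (x + s *\<^sub>R v)) (at (s - s))"
      using D[of "x + s *\<^sub>R v"] by simp
    ultimately have "((\<lambda>t. g (x + s *\<^sub>R v + t *\<^sub>R v)) \<circ> (\<lambda>t. t - s) has_vector_derivative 1 *\<^sub>R g' (x + s *\<^sub>R v)) (at s)"
      by (rule vector_diff_chain_at)
    then have "((\<lambda>t. g (x + t *\<^sub>R v)) has_vector_derivative g' (x + s *\<^sub>R v)) (at s)"
      by (simp add: o_def scaleR_diff_left)
    then show ?thesis by (rule has_vector_derivative_at_within)
  qed
  have "(LINT s|lborel. indicator {0..1::real} s *\<^sub>R g' (x + s *\<^sub>R v)) = g (x + 1 *\<^sub>R v) - g (x + 0 *\<^sub>R v)"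
    by (rule integral_FTC_Icc)
       (auto intro!: D' continuous_on_compose2[OF c] continuous_intros)
  then show ?thesis by (simp add: avg_def scaleR_conv_of_real)
qed

lemma averaging_segment: "averaging (\<lambda>s. complex_of_real (indicator {0..1::real} s)) (\<lambda>s. s *\<^sub>R v)"
  by unfold_locales auto

text \<open>Integrating the segment formula over all \<open>x\<close> gives the integral of
  \<open>g'\<close> on one side, because the weight has mass 1, and on the other a difference that
  vanishes by translation invariance. This is the form in which integration by parts is used
  throughout: no boundary terms appear.\<close>

lemma integral_derivative_zero:
  fixes g g' :: "real^'n::finite \<Rightarrow> complex"
  assumes D: "\<And>x. ((\<lambda>s. g (x + s *\<^sub>R v)) has_vector_derivative g' x) (at 0)"
    and c: "continuous_on UNIV g'" and g: "integrable lborel g" "integrable lborel g'"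
  shows "(LINT x|lborel. g' x) = 0"
proof -
  interpret averaging "\<lambda>s. complex_of_real (indicator {0..1::real} s)" "\<lambda>s. s *\<^sub>R v" by (rule averaging_segment)
  have "(LINT x|lborel. g' x) = (LINT x|lborel. g (x + v) - g x)"
    unfolding segment_average[OF D c] avg_integral[OF g(2)] by simp
  also have "\<dots> = 0"
    by (subst Bochner_Integration.integral_diff) (auto simp: g lborel_translation)
  finally show ?thesis .
qed

lemma L1_norm_translate_le:
  fixes g g' :: "real^'n::finite \<Rightarrow> complex"
  assumes D: "\<And>x. ((\<lambda>s. g (x + s *\<^sub>R v)) has_vector_derivative g' x) (at 0)"
    and c: "continuous_on UNIV g'" and g: "integrable lborel g'"
  shows "L1_norm (\<lambda>x. g (x + v) - g x) \<le> L1_norm g'"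
proof -
  interpret averaging "\<lambda>s. complex_of_real (indicator {0..1::real} s)" "\<lambda>s. s *\<^sub>R v" by (rule averaging_segment)
  have "mass = 1" by (simp add: mass_def)
  then show ?thesis
    unfolding segment_average[OF D c] using L1_norm_avg[OF g] by simp
qed

lemma smooth_directional_derivative:
  assumes "smooth f"
  shows "((\<lambda>s. iter_deriv w f (x + s *\<^sub>R v)) has_vector_derivative (\<Sum>i\<in>UNIV. (v $ i) *\<^sub>R iter_deriv (i # w) f x)) (at 0)"
proof -
  have "((\<lambda>s. x + s *\<^sub>R v) has_derivative (\<lambda>s. s *\<^sub>R v)) (at 0)"
    by (auto intro!: derivative_eq_intros)
  moreover have "(iter_deriv w f has_derivative (\<lambda>h. \<Sum>i\<in>UNIV. (h $ i) *\<^sub>R iter_deriv (i # w) f x)) (at (x + 0 *\<^sub>R v))"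
    using smooth_has_derivative[OF assms] by simp
  ultimately show ?thesis
    unfolding has_vector_derivative_def
    by (rule has_derivative_eq_rhs[OF has_derivative_compose])
       (simp add: scaleR_sum_right)
qed

lemma smooth_axis_derivative:
  assumes "smooth f"
  shows "((\<lambda>s. iter_deriv w f (x + s *\<^sub>R axis i 1)) has_vector_derivative iter_deriv (i # w) f x) (at 0)"
proof -
  have "(\<Sum>j\<in>UNIV. (axis i 1 $ j) *\<^sub>R iter_deriv (j # w) f x) = (\<Sum>j\<in>UNIV. if j = i then iter_deriv (j # w) f x else 0)"
    by (intro sum.cong) (auto simp: axis_def)
  then show ?thesis using smooth_directional_derivative[OF assms, of w x "axis i 1"] by simp
qed

text \<open>Translation by \<open>v\<close> costs one derivative and gains the factor
  \<open>norm v\<close>; this trade is behind both the mollification rate and the continuity of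
  functionals along translates.\<close>

lemma DL1_translate_le:
  fixes \<phi> :: "real^'n::finite \<Rightarrow> complex"
  assumes \<phi>: "\<phi> \<in> DL1"
  shows "L1_norm (\<lambda>x. iter_deriv w \<phi> (x + v) - iter_deriv w \<phi> x) \<le> real CARD('n) * norm v * DL1_norm (Suc (length w)) \<phi>"
proof -
  let ?g = "\<lambda>x. \<Sum>i\<in>UNIV. (v $ i) *\<^sub>R iter_deriv (i # w) \<phi> x"
  have int: "integrable lborel (\<lambda>x. (v $ i) *\<^sub>R iter_deriv (i # w) \<phi> x)" for i
    using DL1_integrable[OF \<phi>] by simp
  have "L1_norm (\<lambda>x. iter_deriv w \<phi> (x + v) - iter_deriv w \<phi> x) \<le> L1_norm ?g"
    using smooth_directional_derivative[OF DL1_smooth[OF \<phi>]] int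
    by (intro L1_norm_translate_le)
       (auto intro!: continuous_intros smooth_continuous DL1_smooth \<phi> Bochner_Integration.integrable_sum)
  also have "\<dots> \<le> (LINT x|lborel. (\<Sum>i\<in>UNIV. cmod ((v $ i) *\<^sub>R iter_deriv (i # w) \<phi> x)))"
    unfolding L1_norm_def
    by (intro integral_mono norm_sum integrable_norm Bochner_Integration.integrable_sum int)
  also have "\<dots> = (\<Sum>i\<in>UNIV. \<bar>v $ i\<bar> * L1_norm (iter_deriv (i # w) \<phi>))"
    by (subst Bochner_Integration.integral_sum, rule integrable_norm[OF int]) (simp add: L1_norm_def)
  also have "\<dots> \<le> (\<Sum>i\<in>(UNIV::'n set). norm v * DL1_norm (Suc (length w)) \<phi>)"
    by (intro sum_mono mult_mono L1_norm_le_DL1_norm component_le_norm_cart) auto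
  finally show ?thesis by (simp add: algebra_simps)
qed

section \<open>Product integrals, scaling and the Gaussian\<close>

text \<open>Lebesgue measure on \<open>real^'n\<close> is the image of a product measure indexed by
  basis vectors, whereas the factors \<open>f i\<close> are indexed by coordinates; the injection
  sending \<open>i\<close> to \<open>axis i 1\<close> translates between the two.\<close>

lemma lborel_prod_integral:
  fixes f :: "'n::finite \<Rightarrow> real \<Rightarrow> complex"
  assumes f: "\<And>i. integrable lborel (f i)"
  shows "integrable lborel (\<lambda>x::real^'n. \<Prod>i\<in>UNIV. f i (x $ i))"
    and "(LINT x|lborel. (\<Prod>i\<in>UNIV. f i ((x::real^'n) $ i))) = (\<Prod>i\<in>UNIV. LINT s|lborel. f i s)"
proof -
  interpret product_sigma_finite "\<lambda>b::real^'n. lborel :: real measure" ..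
  have [measurable]: "f i \<in> borel_measurable borel" for i using f[of i] by auto
  let ?ax = "\<lambda>i::'n. axis i (1::real)"
  have inj: "inj ?ax" by (rule injI) (simp add: axis_eq_axis)
  have Basis: "(Basis :: (real^'n) set) = range ?ax" by (auto simp: Basis_vec_def)
  let ?g = "\<lambda>b. f (inv ?ax b)"
  let ?P = "\<Pi>\<^sub>M b\<in>(Basis :: (real^'n) set). lborel :: real measure"
  let ?s = "\<lambda>y. \<Sum>b\<in>(Basis :: (real^'n) set). y b *\<^sub>R b"
  have coord: "?s y $ i = y (?ax i)" for y i
  proof -
    have "?s y $ i = ?s y \<bullet> ?ax i" by (simp add: inner_axis)
    also have "\<dots> = y (?ax i)" by (rule inner_sum_left_Basis) (simp add: Basis)
    finally show ?thesis .
  qed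
  have eq: "(\<Prod>i\<in>UNIV. f i (?s y $ i)) = (\<Prod>b\<in>Basis. ?g b (y b))" for y
  proof -
    have "(\<Prod>b\<in>Basis. ?g b (y b)) = (\<Prod>i\<in>UNIV. f i (y (?ax i)))"
      by (simp only: Basis prod.reindex[OF inj] o_def inv_f_f[OF inj])
    then show ?thesis by (simp only: coord)
  qed
  have L: "(lborel :: (real^'n) measure) = distr ?P borel ?s" by (rule lborel_eq)
  have m: "?s \<in> measurable ?P borel" by measurable
  have int: "integrable ?P (\<lambda>y. \<Prod>b\<in>Basis. ?g b (y b))"
    by (rule product_integrable_prod) (use f in auto)
  have [measurable]: "(\<lambda>x::real^'n. \<Prod>i\<in>UNIV. f i (x $ i)) \<in> borel_measurable borel" by measurable
  show "integrable lborel (\<lambda>x::real^'n. \<Prod>i\<in>UNIV. f i (x $ i))"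
    unfolding L using int by (subst integrable_distr_eq[OF m], measurable) (simp only: eq)
  have "(LINT x|lborel. (\<Prod>i\<in>UNIV. f i ((x::real^'n) $ i))) = (LINT y|?P. (\<Prod>b\<in>Basis. ?g b (y b)))"
    unfolding L by (subst integral_distr[OF m], measurable) (simp only: eq)
  also have "\<dots> = (\<Prod>b\<in>(Basis :: (real^'n) set). LINT s|lborel. ?g b s)"
    by (rule product_integral_prod) (use f in auto)
  also have "\<dots> = (\<Prod>i\<in>UNIV. LINT s|lborel. f i s)"
    unfolding Basis by (subst prod.reindex[OF inj]) (simp add: inv_f_f[OF inj])
  finally show "(LINT x|lborel. (\<Prod>i\<in>UNIV. f i ((x::real^'n) $ i))) = (\<Prod>i\<in>UNIV. LINT s|lborel. f i s)" .
qed

lemma lborel_scale: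
  fixes f :: "'a::euclidean_space \<Rightarrow> complex"
  assumes c: "c \<noteq> 0" and [measurable]: "f \<in> borel_measurable borel"
  shows "(LINT x|lborel. f x) = \<bar>c\<bar> ^ DIM('a) *\<^sub>R (LINT x|lborel. f (c *\<^sub>R x))"
    and "integrable lborel (\<lambda>x. f (c *\<^sub>R x)) \<longleftrightarrow> integrable lborel f"
proof -
  let ?k = "\<bar>c\<bar> ^ DIM('a)"
  have k: "?k > 0" using c by simp
  have eq: "lborel = density (distr lborel borel (\<lambda>x::'a. c *\<^sub>R x)) (\<lambda>_. ennreal ?k)"
    using lborel_affine[OF c, of "0::'a"] by simp
  have "(LINT x|lborel. f x) = (LINT x|distr lborel borel (\<lambda>x::'a. c *\<^sub>R x). ?k *\<^sub>R f x)"
    by (subst eq, subst integral_density) (use k in auto)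
  also have "\<dots> = (LINT x|lborel. ?k *\<^sub>R f (c *\<^sub>R x))" by (rule integral_distr) auto
  finally show "(LINT x|lborel. f x) = ?k *\<^sub>R (LINT x|lborel. f (c *\<^sub>R x))" by simp
  have "integrable lborel f \<longleftrightarrow> integrable (distr lborel borel (\<lambda>x::'a. c *\<^sub>R x)) (\<lambda>x. ?k *\<^sub>R f x)"
    by (subst eq, subst integrable_density) (use k in auto)
  also have "\<dots> \<longleftrightarrow> integrable lborel (\<lambda>x. ?k *\<^sub>R f (c *\<^sub>R x))" by (rule integrable_distr_eq) auto
  also have "\<dots> \<longleftrightarrow> integrable lborel (\<lambda>x. f (c *\<^sub>R x))"
    using k integrable_scaleR_right[of "1 / ?k" lborel "\<lambda>x. ?k *\<^sub>R f (c *\<^sub>R x)"]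
      integrable_scaleR_right[of ?k lborel "\<lambda>x. f (c *\<^sub>R x)"] c by auto
  finally show "integrable lborel (\<lambda>x. f (c *\<^sub>R x)) \<longleftrightarrow> integrable lborel f" by simp
qed

lemma lborel_uminus:
  fixes f :: "'a::euclidean_space \<Rightarrow> complex"
  assumes "f \<in> borel_measurable borel"
  shows "(LINT x|lborel. f (- x)) = (LINT x|lborel. f x)"
    and "integrable lborel (\<lambda>x. f (- x)) \<longleftrightarrow> integrable lborel f"
  using lborel_scale[OF _ assms, of "-1"] by simp_all

definition gauss :: "real^'n::finite \<Rightarrow> real" where
  "gauss z = (1 / sqrt (2 * pi)) ^ CARD('n) * exp (- (norm z)\<^sup>2 / 2)"

lemma norm_vec_square: "(norm (z::real^'n::finite))\<^sup>2 = (\<Sum>i\<in>UNIV. (z $ i)\<^sup>2)"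
  unfolding power2_norm_eq_inner by (simp add: inner_vec_def power2_eq_square)

lemma exp_norm_square_prod: "exp (- (norm (z::real^'n::finite))\<^sup>2 / 2) = (\<Prod>i\<in>UNIV. exp (- (z $ i)\<^sup>2 / 2))"
proof -
  have "- (norm z)\<^sup>2 / 2 = (\<Sum>i\<in>UNIV. - (z $ i)\<^sup>2 / 2)"
    by (simp only: norm_vec_square sum_divide_distrib[symmetric] sum_negf)
  then show ?thesis by (simp only: exp_sum finite_code)
qed

lemma gauss_prod: "gauss z = (\<Prod>i\<in>UNIV. std_normal_density (z $ i))"
  by (simp only: gauss_def std_normal_density_def exp_norm_square_prod prod.distrib prod_constant)

lemma gauss_nonneg [simp]: "gauss z \<ge> 0"
  by (simp add: gauss_def)

lemma gauss_measurable [measurable]: "gauss \<in> borel_measurable borel"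
  unfolding gauss_def[abs_def] by measurable

lemma gauss_uminus [simp]: "gauss (- z) = gauss z"
  by (simp add: gauss_def)

lemma std_normal_fourier:
  "integrable lborel (\<lambda>s. complex_of_real (std_normal_density s) * exp (\<i> * complex_of_real (t * s)))"
  "(LINT s|lborel. complex_of_real (std_normal_density s) * exp (\<i> * complex_of_real (t * s))) = complex_of_real (exp (- t\<^sup>2 / 2))"
proof -
  show "integrable lborel (\<lambda>s. complex_of_real (std_normal_density s) * exp (\<i> * complex_of_real (t * s)))"
    by (rule Bochner_Integration.integrable_bound[OF integrable_std_normal_moment[of 0]])
       (auto simp: norm_mult norm_exp_i_times)
  have "(LINT s|lborel. complex_of_real (std_normal_density s) * exp (\<i> * complex_of_real (t * s))) = char std_normal_distribution t"
    unfolding char_def by (subst integral_density) (auto simp: scaleR_conv_of_real)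
  then show "(LINT s|lborel. complex_of_real (std_normal_density s) * exp (\<i> * complex_of_real (t * s))) = complex_of_real (exp (- t\<^sup>2 / 2))"
    by (simp add: char_std_normal_distribution)
qed

lemma exp_inner_prod:
  "exp (\<i> * complex_of_real (\<xi> \<bullet> z)) = (\<Prod>i\<in>UNIV. exp (\<i> * complex_of_real ((\<xi>::real^'n::finite) $ i * z $ i)))"
  by (simp add: inner_vec_def sum_distrib_left flip: exp_sum)

lemma gauss_fourier:
  fixes \<xi> :: "real^'n::finite"
  shows "integrable lborel (\<lambda>z. complex_of_real (gauss z) * exp (\<i> * complex_of_real (\<xi> \<bullet> z)))"
    and "(LINT z|lborel. complex_of_real (gauss z) * exp (\<i> * complex_of_real (\<xi> \<bullet> z))) = complex_of_real (exp (- (norm \<xi>)\<^sup>2 / 2))"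
proof -
  have eq: "complex_of_real (gauss z) * exp (\<i> * complex_of_real (\<xi> \<bullet> z)) =
     (\<Prod>i\<in>UNIV. complex_of_real (std_normal_density (z $ i)) * exp (\<i> * complex_of_real (\<xi> $ i * z $ i)))" for z
    by (simp only: gauss_prod exp_inner_prod of_real_prod prod.distrib)
  show "integrable lborel (\<lambda>z. complex_of_real (gauss z) * exp (\<i> * complex_of_real (\<xi> \<bullet> z)))"
    unfolding eq by (rule lborel_prod_integral) (rule std_normal_fourier)
  have "(LINT z|lborel. complex_of_real (gauss z) * exp (\<i> * complex_of_real (\<xi> \<bullet> z))) =
    (\<Prod>i\<in>UNIV. complex_of_real (exp (- (\<xi> $ i)\<^sup>2 / 2)))"
    unfolding eq by (subst lborel_prod_integral, rule std_normal_fourier) (simp only: std_normal_fourier(2))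
  also have "\<dots> = complex_of_real (exp (- (norm \<xi>)\<^sup>2 / 2))"
    by (simp only: exp_norm_square_prod of_real_prod)
  finally show "(LINT z|lborel. complex_of_real (gauss z) * exp (\<i> * complex_of_real (\<xi> \<bullet> z))) = complex_of_real (exp (- (norm \<xi>)\<^sup>2 / 2))" .
qed

lemma gauss_integrable: "integrable lborel (\<lambda>z::real^'n::finite. complex_of_real (gauss z))"
  and gauss_integral: "(LINT z|lborel. complex_of_real (gauss (z::real^'n::finite))) = 1"
  using gauss_fourier[of "0::real^'n"] by simp_all

text \<open>The weight \<open>z $ i * gauss z\<close> arises when a derivative is moved from the
  averaged function onto the Gaussian.\<close>

lemma gauss_moment_integrable: "integrable lborel (\<lambda>z::real^'n::finite. complex_of_real (z $ j * gauss z))"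
proof -
  have "complex_of_real (z $ j * gauss z) =
    (\<Prod>i\<in>UNIV. complex_of_real ((if i = j then z $ i else 1) * std_normal_density (z $ i)))" for z :: "real^'n"
    by (simp add: gauss_prod prod.distrib del: of_real_mult flip: of_real_prod)
  moreover have "integrable lborel (\<lambda>s. complex_of_real ((if i = j then s else 1) * std_normal_density s))" for i
    using integrable_std_normal_moment[of 0] integrable_std_normal_moment[of 1]
    by (cases "i = j") (simp_all add: mult.commute del: of_real_mult)
  ultimately show ?thesis
    using lborel_prod_integral(1)[of "\<lambda>i s. complex_of_real ((if i = j then s else 1) * std_normal_density s)"] by simp
qed

section \<open>The inverse Fourier transform on DL1\<close>

lemma inverse_fourier_measurable [measurable]:
  assumes [measurable]: "f \<in> borel_measurable borel"
  shows "inverse_fourier f \<in> borel_measurable borel"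
  unfolding inverse_fourier_def by measurable

lemma integrable_exp_mult:
  assumes "integrable lborel f"
  shows "integrable lborel (\<lambda>y. exp (\<i> * complex_of_real (\<xi> \<bullet> y)) * f y)"
proof -
  have [measurable]: "f \<in> borel_measurable borel" using assms by auto
  show ?thesis
    by (rule Bochner_Integration.integrable_bound[OF assms])
       (auto simp: norm_mult norm_exp_i_times)
qed

lemma inverse_fourier_bound:
  fixes f :: "real^'n::finite \<Rightarrow> complex"
  shows "cmod (inverse_fourier f \<xi>) \<le> L1_norm f"
proof -
  have "cmod (inverse_fourier f \<xi>) \<le> 1 / (2 * pi) ^ CARD('n) * L1_norm f"
    unfolding inverse_fourier_def norm_mult L1_norm_def
    using integral_norm_bound[of lborel "\<lambda>y. exp (\<i> * complex_of_real (\<xi> \<bullet> y)) * f y"]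
    by (intro mult_mono) (auto simp: norm_mult norm_exp_i_times norm_divide norm_power)
  also have "\<dots> \<le> 1 * L1_norm f"
  proof (rule mult_right_mono)
    have "2 * pi \<ge> 1" using pi_gt3 by simp
    from one_le_power[OF this, of "CARD('n)"] show "1 / (2 * pi) ^ CARD('n) \<le> 1" by simp
  qed simp
  finally show ?thesis by simp
qed

lemma inverse_fourier_lincomb:
  assumes "integrable lborel f" "integrable lborel g"
  shows "inverse_fourier (\<lambda>x. a * f x + b * g x) \<xi> = a * inverse_fourier f \<xi> + b * inverse_fourier g \<xi>"
proof -
  let ?e = "\<lambda>y. exp (\<i> * complex_of_real (\<xi> \<bullet> y))"
  have "(LINT y|lborel. ?e y * (a * f y + b * g y)) = (LINT y|lborel. a * (?e y * f y) + b * (?e y * g y))"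
    by (simp add: algebra_simps)
  also have "\<dots> = a * (LINT y|lborel. ?e y * f y) + b * (LINT y|lborel. ?e y * g y)"
    using integrable_exp_mult[OF assms(1)] integrable_exp_mult[OF assms(2)]
    by (subst Bochner_Integration.integral_add) auto
  finally have eq: "(LINT y|lborel. ?e y * (a * f y + b * g y)) = a * (LINT y|lborel. ?e y * f y) + b * (LINT y|lborel. ?e y * g y)" .
  show ?thesis unfolding inverse_fourier_def eq by (simp only: distrib_left mult.left_commute)
qed

lemma inverse_fourier_shift:
  "inverse_fourier (\<lambda>y. f (x + y)) \<xi> = exp (- (\<i> * complex_of_real (\<xi> \<bullet> x))) * inverse_fourier f \<xi>"
proof -
  have "(LINT y|lborel. exp (\<i> * complex_of_real (\<xi> \<bullet> y)) * f (x + y)) =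
    (LINT y|lborel. (\<lambda>y. exp (\<i> * complex_of_real (\<xi> \<bullet> (y - x))) * f y) (y + x))"
    by (simp add: add.commute)
  also have "\<dots> = (LINT y|lborel. exp (\<i> * complex_of_real (\<xi> \<bullet> (y - x))) * f y)"
    by (rule lborel_translation)
  also have "\<dots> = (LINT y|lborel. exp (- (\<i> * complex_of_real (\<xi> \<bullet> x))) * (exp (\<i> * complex_of_real (\<xi> \<bullet> y)) * f y))"
    by (intro Bochner_Integration.integral_cong refl)
       (simp add: inner_diff_right right_diff_distrib exp_diff exp_minus divide_inverse)
  finally show ?thesis by (simp add: inverse_fourier_def)
qed

text \<open>The derivative of the exponential times the function integrates to 0. The sign of the
  multiplier is negative because the transform has the kernel with exponent plus i.\<close>

lemma inverse_fourier_deriv: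
  assumes \<phi>: "\<phi> \<in> DL1"
  shows "inverse_fourier (iter_deriv (i # w) \<phi>) \<xi> = - \<i> * complex_of_real (\<xi> $ i) * inverse_fourier (iter_deriv w \<phi>) \<xi>"
proof -
  let ?e = "\<lambda>y. exp (\<i> * complex_of_real (\<xi> \<bullet> y))"
  let ?a = "\<i> * complex_of_real (\<xi> $ i)"
  let ?f = "iter_deriv w \<phi>" and ?f' = "iter_deriv (i # w) \<phi>"
  note int = integrable_exp_mult[OF DL1_integrable[OF \<phi>]]
  have "(LINT x|lborel. ?a * (?e x * ?f x) + ?e x * ?f' x) = 0"
  proof (rule integral_derivative_zero[where v = "axis i 1" and g = "\<lambda>x. ?e x * ?f x"])
    fix x
    have "((\<lambda>s::real. exp (\<i> * complex_of_real (\<xi> \<bullet> x + s * \<xi> $ i))) has_vector_derivative ?e x * ?a) (at 0)"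
    proof -
      have "((\<lambda>s. exp (\<i> * (complex_of_real (\<xi> \<bullet> x) + s * complex_of_real (\<xi> $ i)))) has_field_derivative ?e x * ?a) (at (complex_of_real 0))"
        by (auto intro!: derivative_eq_intros)
      from has_vector_derivative_real_field[OF this]
      show ?thesis by (simp add: o_def)
    qed
    from has_vector_derivative_mult[OF this smooth_axis_derivative[OF DL1_smooth[OF \<phi>], of w x i]]
    show "((\<lambda>s. ?e (x + s *\<^sub>R axis i 1) * ?f (x + s *\<^sub>R axis i 1)) has_vector_derivative ?a * (?e x * ?f x) + ?e x * ?f' x) (at 0)"
      by (simp add: inner_add_right inner_axis algebra_simps)
  next
    show "continuous_on UNIV (\<lambda>x. ?a * (?e x * ?f x) + ?e x * ?f' x)"
      by (intro continuous_intros smooth_continuous DL1_smooth \<phi>)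
  qed (use int in auto)
  then have "?a * (LINT x|lborel. ?e x * ?f x) + (LINT x|lborel. ?e x * ?f' x) = 0"
    using int by (subst (asm) Bochner_Integration.integral_add) auto
  then have "(LINT x|lborel. ?e x * ?f' x) = - ?a * (LINT x|lborel. ?e x * ?f x)"
    by (simp add: add_eq_0_iff2)
  then show ?thesis by (simp add: inverse_fourier_def)
qed

section \<open>The operator 1 - \<Delta> and its Fourier multiplier\<close>

definition bessel_op :: "(real^'n::finite \<Rightarrow> complex) \<Rightarrow> real^'n \<Rightarrow> complex" where
  "bessel_op \<phi> = (\<lambda>x. \<phi> x - (\<Sum>i\<in>UNIV. iter_deriv [i, i] \<phi> x))"

lemma iter_deriv_bessel_op:
  assumes "\<phi> \<in> DL1"
  shows "iter_deriv w (bessel_op \<phi>) = (\<lambda>x. iter_deriv w \<phi> x - (\<Sum>i\<in>UNIV. iter_deriv (w @ [i, i]) \<phi> x))"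
  unfolding bessel_op_def
  by (simp add: iter_deriv_diff DL1_smooth DL1_sum DL1_iter_deriv assms iter_deriv_append)

lemma bessel_op_DL1: "\<phi> \<in> DL1 \<Longrightarrow> bessel_op \<phi> \<in> DL1"
  unfolding bessel_op_def by (intro DL1_diff DL1_sum DL1_iter_deriv) auto

lemma L1_norm_sum_le:
  assumes "\<And>i. i \<in> I \<Longrightarrow> integrable lborel (f i)"
  shows "L1_norm (\<lambda>x. \<Sum>i\<in>I. f i x) \<le> (\<Sum>i\<in>I. L1_norm (f i))"
proof -
  have "L1_norm (\<lambda>x. \<Sum>i\<in>I. f i x) \<le> (LINT x|lborel. (\<Sum>i\<in>I. cmod (f i x)))"
    unfolding L1_norm_def
    by (intro integral_mono norm_sum integrable_norm Bochner_Integration.integrable_sum assms)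
  also have "\<dots> = (\<Sum>i\<in>I. L1_norm (f i))"
    unfolding L1_norm_def by (rule Bochner_Integration.integral_sum) (rule integrable_norm[OF assms])
  finally show ?thesis .
qed

lemma L1_norm_diff_le:
  assumes "integrable lborel f" "integrable lborel g"
  shows "L1_norm (\<lambda>x. f x - g x) \<le> L1_norm f + L1_norm g"
  using L1_norm_add_le[of f "\<lambda>x. - g x"] assms by (simp add: L1_norm_def)

lemma DL1_norm_bessel_op:
  fixes \<phi> :: "real^'n::finite \<Rightarrow> complex"
  assumes "\<phi> \<in> DL1"
  shows "DL1_norm k (bessel_op \<phi>) \<le> (1 + real CARD('n)) * DL1_norm (k + 2) \<phi>"
proof (rule DL1_norm_least)
  fix w :: "'n list" assume w: "length w \<le> k"
  have "L1_norm (iter_deriv w (bessel_op \<phi>)) \<le> L1_norm (iter_deriv w \<phi>) + L1_norm (\<lambda>x. \<Sum>i\<in>UNIV. iter_deriv (w @ [i, i]) \<phi> x)"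
    unfolding iter_deriv_bessel_op[OF assms]
    by (intro L1_norm_diff_le Bochner_Integration.integrable_sum DL1_integrable assms)
  also have "L1_norm (\<lambda>x. \<Sum>i\<in>UNIV. iter_deriv (w @ [i, i]) \<phi> x) \<le> (\<Sum>i\<in>UNIV. L1_norm (iter_deriv (w @ [i, i]) \<phi>))"
    by (intro L1_norm_sum_le DL1_integrable assms)
  also have "\<dots> \<le> (\<Sum>i\<in>(UNIV::'n set). DL1_norm (k + 2) \<phi>)"
    using w by (intro sum_mono L1_norm_le_DL1_norm) auto
  also have "L1_norm (iter_deriv w \<phi>) \<le> DL1_norm (k + 2) \<phi>"
    using w by (intro L1_norm_le_DL1_norm) auto
  finally show "L1_norm (iter_deriv w (bessel_op \<phi>)) \<le> (1 + real CARD('n)) * DL1_norm (k + 2) \<phi>"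
    by (simp add: algebra_simps)
qed

lemma inverse_fourier_sum:
  assumes "finite I" "\<And>i. i \<in> I \<Longrightarrow> integrable lborel (f i)"
  shows "inverse_fourier (\<lambda>x. \<Sum>i\<in>I. f i x) \<xi> = (\<Sum>i\<in>I. inverse_fourier (f i) \<xi>)"
  unfolding inverse_fourier_def sum_distrib_left
  by (subst Bochner_Integration.integral_sum) (auto intro!: integrable_exp_mult assms simp: sum_distrib_left)

lemma inverse_fourier_bessel_op:
  assumes \<phi>: "\<phi> \<in> DL1"
  shows "inverse_fourier (bessel_op \<phi>) \<xi> = complex_of_real (1 + (norm \<xi>)\<^sup>2) * inverse_fourier \<phi> \<xi>"
proof -
  have int: "integrable lborel (\<lambda>x. \<Sum>i\<in>UNIV. iter_deriv [i, i] \<phi> x)"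
    by (intro Bochner_Integration.integrable_sum DL1_integrable \<phi>)
  have "inverse_fourier (iter_deriv [i, i] \<phi>) \<xi> = - complex_of_real ((\<xi> $ i)\<^sup>2) * inverse_fourier \<phi> \<xi>" for i
    using inverse_fourier_deriv[OF \<phi>, of i "[i]"] inverse_fourier_deriv[OF \<phi>, of i "[]"]
    by (simp add: power2_eq_square algebra_simps)
  then have "inverse_fourier (\<lambda>x. \<Sum>i\<in>UNIV. iter_deriv [i, i] \<phi> x) \<xi> = - complex_of_real ((norm \<xi>)\<^sup>2) * inverse_fourier \<phi> \<xi>"
    by (simp add: inverse_fourier_sum DL1_integrable \<phi> norm_vec_square sum_negf flip: sum_distrib_right)
  then show ?thesis
    using inverse_fourier_lincomb[OF DL1_integrable0[OF \<phi>] int, of 1 "-1" \<xi>]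
    by (simp add: bessel_op_def algebra_simps)
qed

lemma bessel_op_iter:
  assumes \<phi>: "\<phi> \<in> DL1"
  shows "(bessel_op ^^ N) \<phi> \<in> DL1"
    and "inverse_fourier ((bessel_op ^^ N) \<phi>) \<xi> = complex_of_real (1 + (norm \<xi>)\<^sup>2) ^ N * inverse_fourier \<phi> \<xi>"
proof -
  show *: "(bessel_op ^^ N) \<phi> \<in> DL1" for N by (induction N) (auto simp: \<phi> bessel_op_DL1)
  show "inverse_fourier ((bessel_op ^^ N) \<phi>) \<xi> = complex_of_real (1 + (norm \<xi>)\<^sup>2) ^ N * inverse_fourier \<phi> \<xi>"
    by (induction N) (simp_all add: inverse_fourier_bessel_op[OF *])
qed

text \<open>With as many factors as coordinates, the factors can be compared one by one with a
  product of one-dimensional functions 1 / (1 + s^2), each of which is integrable.\<close>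

lemma integrable_bessel_weight:
  "integrable lborel (\<lambda>\<xi>::real^'n::finite. 1 / (1 + (norm \<xi>)\<^sup>2) ^ CARD('n))"
proof -
  have "integrable lborel (\<lambda>s::real. inverse (1 + s\<^sup>2))"
    using integrable_inverse_1_plus_square by (simp add: set_integrable_def)
  then have "integrable lborel (\<lambda>s::real. complex_of_real (inverse (1 + s\<^sup>2)))" by (rule integrable_of_real)
  from lborel_prod_integral(1)[of "\<lambda>i::'n. \<lambda>s. complex_of_real (inverse (1 + s\<^sup>2))", OF this]
  show ?thesis
  proof (rule Bochner_Integration.integrable_bound)
    have "1 / (1 + (norm \<xi>)\<^sup>2) ^ CARD('n) \<le> (\<Prod>i\<in>UNIV. inverse (1 + (\<xi> $ i)\<^sup>2))" for \<xi> :: "real^'n"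
    proof -
      have "inverse (1 + (norm \<xi>)\<^sup>2) \<le> inverse (1 + (\<xi> $ i)\<^sup>2)" for i
      proof -
        have "\<bar>\<xi> $ i\<bar>\<^sup>2 \<le> (norm \<xi>)\<^sup>2" by (rule power_mono) (auto intro: component_le_norm_cart)
        then show ?thesis by (simp add: add_pos_nonneg)
      qed
      then have "(\<Prod>i\<in>(UNIV::'n set). inverse (1 + (norm \<xi>)\<^sup>2)) \<le> (\<Prod>i\<in>UNIV. inverse (1 + (\<xi> $ i)\<^sup>2))"
        by (intro prod_mono) (auto simp: add_nonneg_nonneg)
      then show ?thesis by (simp add: divide_inverse power_inverse)
    qed
    then show "AE \<xi>::real^'n in lborel. norm (1 / (1 + (norm \<xi>)\<^sup>2) ^ CARD('n)) \<le> norm (\<Prod>i\<in>UNIV. complex_of_real (inverse (1 + (\<xi> $ i)\<^sup>2)))"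
      by (intro AE_I2) (simp add: add_nonneg_nonneg norm_divide norm_power abs_of_nonneg prod_nonneg del: of_real_inverse of_real_add flip: of_real_prod)
  qed measurable
qed

text \<open>Multiplied by the n-th power of 1 + |\<xi>|^2, the transform of \<phi> becomes the
  transform of an n-fold \<open>bessel_op\<close> image of \<phi>, which is bounded by an L^1
  norm.\<close>

lemma inverse_fourier_integrable:
  fixes \<phi> :: "real^'n::finite \<Rightarrow> complex"
  assumes \<phi>: "\<phi> \<in> DL1"
  shows "integrable lborel (inverse_fourier \<phi>)"
proof -
  let ?c = "L1_norm ((bessel_op ^^ CARD('n)) \<phi>)"
  have [measurable]: "\<phi> \<in> borel_measurable borel" using DL1_integrable0[OF \<phi>] by auto
  have "integrable lborel (\<lambda>\<xi>::real^'n. ?c * (1 / (1 + (norm \<xi>)\<^sup>2) ^ CARD('n)))"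
    by (intro integrable_mult_right integrable_bessel_weight)
  then show ?thesis
  proof (rule Bochner_Integration.integrable_bound)
    have "cmod (inverse_fourier \<phi> \<xi>) \<le> ?c * (1 / (1 + (norm \<xi>)\<^sup>2) ^ CARD('n))" for \<xi>
    proof -
      have pos: "1 + (norm \<xi>)\<^sup>2 > 0" by (simp add: add_pos_nonneg)
      have "(1 + (norm \<xi>)\<^sup>2) ^ CARD('n) * cmod (inverse_fourier \<phi> \<xi>) = cmod (inverse_fourier ((bessel_op ^^ CARD('n)) \<phi>) \<xi>)"
        using pos unfolding bessel_op_iter(2)[OF \<phi>] norm_mult norm_power norm_of_real by simp
      also have "\<dots> \<le> ?c" by (rule inverse_fourier_bound)
      finally show ?thesis using pos by (simp add: field_simps)
    qed
    then show "AE \<xi> in lborel. norm (inverse_fourier \<phi> \<xi>) \<le> norm (?c * (1 / (1 + (norm \<xi>)\<^sup>2) ^ CARD('n)))"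
      by (intro AE_I2) (auto intro: order_trans[OF _ abs_ge_self])
  qed measurable
qed

section \<open>Fourier inversion by Gaussian summation\<close>

lemma gauss_scaled_fourier:
  fixes x :: "real^'n::finite"
  assumes e: "e > 0"
  shows "integrable lborel (\<lambda>\<xi>. complex_of_real (gauss (e *\<^sub>R \<xi>)) * exp (\<i> * complex_of_real (\<xi> \<bullet> x)))"
    and "gauss (0::real^'n) * gauss (0::real^'n) * e ^ CARD('n) *
      (LINT \<xi>|lborel. complex_of_real (gauss (e *\<^sub>R \<xi>)) * exp (\<i> * complex_of_real (\<xi> \<bullet> x))) =
      gauss (0::real^'n) * complex_of_real (gauss (x /\<^sub>R e))"
proof -
  let ?f = "\<lambda>\<eta>. complex_of_real (gauss \<eta>) * exp (\<i> * complex_of_real ((x /\<^sub>R e) \<bullet> \<eta>))"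
  have f: "?f (e *\<^sub>R \<xi>) = complex_of_real (gauss (e *\<^sub>R \<xi>)) * exp (\<i> * complex_of_real (\<xi> \<bullet> x))" for \<xi>
  proof -
    have "(x /\<^sub>R e) \<bullet> (e *\<^sub>R \<xi>) = \<xi> \<bullet> x" using e by (simp add: inner_commute)
    then show ?thesis by simp
  qed
  have m: "?f \<in> borel_measurable borel" by measurable
  have "integrable lborel (\<lambda>\<xi>. ?f (e *\<^sub>R \<xi>))"
    using lborel_scale(2)[OF _ m, of e] e gauss_fourier(1) by blast
  then show "integrable lborel (\<lambda>\<xi>. complex_of_real (gauss (e *\<^sub>R \<xi>)) * exp (\<i> * complex_of_real (\<xi> \<bullet> x)))"
    by (simp only: f)
  have "complex_of_real (e ^ CARD('n)) * (LINT \<xi>|lborel. complex_of_real (gauss (e *\<^sub>R \<xi>)) * exp (\<i> * complex_of_real (\<xi> \<bullet> x))) = (LINT \<eta>|lborel. ?f \<eta>)"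
    using lborel_scale(1)[OF _ m, of e] e by (simp only: f) (simp add: scaleR_conv_of_real)
  also have "\<dots> = complex_of_real (exp (- (norm (x /\<^sub>R e))\<^sup>2 / 2))" by (rule gauss_fourier)
  finally show "gauss (0::real^'n) * gauss (0::real^'n) * e ^ CARD('n) *
      (LINT \<xi>|lborel. complex_of_real (gauss (e *\<^sub>R \<xi>)) * exp (\<i> * complex_of_real (\<xi> \<bullet> x))) =
      gauss (0::real^'n) * complex_of_real (gauss (x /\<^sub>R e))"
    by (simp add: gauss_def mult.assoc)
qed

text \<open>This is the normalising constant of \<open>inverse_fourier\<close>; one factor
  \<open>gauss 0\<close> is absorbed by the damping factor, the other by the kernel on the space
  side.\<close>

lemma gauss_zero_square: "gauss (0::real^'n::finite) * gauss (0::real^'n) = 1 / (2 * pi) ^ CARD('n)"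
proof -
  have "gauss (0::real^'n) = (1 / sqrt (2 * pi)) ^ CARD('n)" by (simp add: gauss_def)
  then have "gauss (0::real^'n) * gauss (0::real^'n) = (1 / sqrt (2 * pi) * (1 / sqrt (2 * pi))) ^ CARD('n)"
    by (simp only: power_mult_distrib)
  also have "1 / sqrt (2 * pi) * (1 / sqrt (2 * pi)) = 1 / (2 * pi)" by simp
  finally show ?thesis by (simp only: power_one_over)
qed

lemma gauss_zero_pos: "gauss (0::real^'n::finite) > 0"
  by (simp add: gauss_def)

text \<open>The Gaussian factor, equal to 1 at the origin, makes the double integral absolutely
  convergent, so Fubini applies. On the right it has turned into an approximate identity of width
  \<open>e\<close>.\<close>

lemma damped_inversion:
  fixes \<psi> :: "real^'n::finite \<Rightarrow> complex"
  assumes \<psi>: "integrable lborel \<psi>" and e: "e > 0"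
  shows "(LINT \<xi>|lborel. complex_of_real (gauss (e *\<^sub>R \<xi>) / gauss (0::real^'n)) * inverse_fourier \<psi> \<xi>) =
    (LINT x|lborel. \<psi> x * complex_of_real (gauss (x /\<^sub>R e) / e ^ CARD('n)))"
proof -
  let ?g0 = "gauss (0::real^'n)"
  have [measurable]: "\<psi> \<in> borel_measurable borel" using \<psi> by auto
  define F where "F \<xi> x = complex_of_real (gauss (e *\<^sub>R \<xi>) * ?g0) * (exp (\<i> * complex_of_real (\<xi> \<bullet> x)) * \<psi> x)" for \<xi> x :: "real^'n"
  have g: "integrable lborel (\<lambda>\<xi>::real^'n. gauss (e *\<^sub>R \<xi>))"
    using integrable_norm[OF gauss_scaled_fourier(1)[OF e, of 0]] by simp
  have int: "integrable (lborel \<Otimes>\<^sub>M lborel) (case_prod F)"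
  proof (rule lborel_pair_Fubini_integrable)
    show "case_prod F \<in> borel_measurable (lborel \<Otimes>\<^sub>M lborel)" unfolding F_def by measurable
    show "integrable lborel (F \<xi>)" for \<xi>
      unfolding F_def by (intro integrable_mult_right integrable_exp_mult \<psi>)
    have "(LINT x|lborel. norm (F \<xi> x)) = gauss (e *\<^sub>R \<xi>) * (?g0 * L1_norm \<psi>)" for \<xi>
      by (simp add: F_def norm_mult norm_exp_i_times L1_norm_def)
    then show "integrable lborel (\<lambda>\<xi>. LINT x|lborel. norm (F \<xi> x))" using g by simp
  qed
  have "complex_of_real (gauss (e *\<^sub>R \<xi>) / ?g0) * inverse_fourier \<psi> \<xi> = (LINT x|lborel. F \<xi> x)" for \<xi>
    unfolding F_def inverse_fourier_def gauss_zero_square[symmetric]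
    using gauss_zero_pos[where 'n='n] by simp
  then have "(LINT \<xi>|lborel. complex_of_real (gauss (e *\<^sub>R \<xi>) / ?g0) * inverse_fourier \<psi> \<xi>) = (LINT \<xi>|lborel. LINT x|lborel. F \<xi> x)"
    by simp
  also have "\<dots> = (LINT x|lborel. LINT \<xi>|lborel. F \<xi> x)"
    by (rule lborel_pair.Fubini_integral[OF int, symmetric])
  also have "\<dots> = (LINT x|lborel. \<psi> x * complex_of_real (gauss (x /\<^sub>R e) / e ^ CARD('n)))"
  proof (intro Bochner_Integration.integral_cong refl)
    fix x :: "real^'n"
    let ?I = "LINT \<xi>|lborel. complex_of_real (gauss (e *\<^sub>R \<xi>)) * exp (\<i> * complex_of_real (\<xi> \<bullet> x))"
    have "(LINT \<xi>|lborel. F \<xi> x) = (LINT \<xi>|lborel. (?g0 * \<psi> x) * (complex_of_real (gauss (e *\<^sub>R \<xi>)) * exp (\<i> * complex_of_real (\<xi> \<bullet> x))))"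
      unfolding F_def by (intro Bochner_Integration.integral_cong refl) (simp add: mult_ac)
    also have "\<dots> = ?g0 * \<psi> x * ?I" by simp
    also have "\<dots> = \<psi> x * complex_of_real (gauss (x /\<^sub>R e) / e ^ CARD('n))"
      using gauss_scaled_fourier(2)[OF e, of x] e gauss_zero_pos[where 'n='n] by (simp add: field_simps)
    finally show "(LINT \<xi>|lborel. F \<xi> x) = \<psi> x * complex_of_real (gauss (x /\<^sub>R e) / e ^ CARD('n))" .
  qed
  finally show ?thesis .
qed

lemma power_gauss_tendsto_0: "(\<lambda>j. real (Suc j) ^ n * exp (- (real (Suc j))\<^sup>2 / 2)) \<longlonglongrightarrow> 0"
proof (rule tendsto_sandwich[OF _ _ tendsto_const])
  have "((\<lambda>x::real. x ^ n / exp x) \<longlongrightarrow> 0) at_top" by (rule tendsto_power_div_exp_0)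
  then have "(\<lambda>j. real (Suc j) ^ n / exp (real (Suc j))) \<longlonglongrightarrow> 0"
    by (rule filterlim_compose) (rule filterlim_compose[OF filterlim_real_sequentially filterlim_Suc])
  then show "(\<lambda>j. exp (1/2) * (real (Suc j) ^ n / exp (real (Suc j)))) \<longlonglongrightarrow> 0"
    by (rule tendsto_mult_right_zero)
  have "real (Suc j) ^ n * exp (- (real (Suc j))\<^sup>2 / 2) \<le> exp (1/2) * (real (Suc j) ^ n / exp (real (Suc j)))" for j
  proof -
    \<comment> \<open>Completing the square bounds the Gaussian by an exponential, against which
      powers are known to vanish.\<close>
    have "0 \<le> (real (Suc j) - 1)\<^sup>2" by simp
    then have "- (real (Suc j))\<^sup>2 / 2 \<le> 1/2 - real (Suc j)"
      unfolding power2_diff by (simp add: field_simps)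
    then have "exp (- (real (Suc j))\<^sup>2 / 2) \<le> exp (1/2) / exp (real (Suc j))"
      by (simp flip: exp_diff)
    from mult_left_mono[OF this, of "real (Suc j) ^ n"] show ?thesis by (simp add: mult_ac del: of_nat_Suc)
  qed
  then show "\<forall>\<^sub>F j in sequentially. real (Suc j) ^ n * exp (- (real (Suc j))\<^sup>2 / 2) \<le> exp (1/2) * (real (Suc j) ^ n / exp (real (Suc j)))"
    by simp
qed simp

text \<open>Both sides of \<open>damped_inversion\<close> are followed as the width tends to 0.
  Boundedness of \<psi> is not yet at hand, being a consequence of inversion, so the space side is
  cut at the unit ball: inside, \<psi> is bounded by compactness; outside, only its integrability is
  used. Evaluation at 0 suffices because \<open>DL1\<close> is translation invariant.\<close>

theorem DL1_fourier_inversion_0: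
  fixes \<psi> :: "real^'n::finite \<Rightarrow> complex"
  assumes \<psi>: "\<psi> \<in> DL1"
  shows "(LINT \<xi>|lborel. inverse_fourier \<psi> \<xi>) = \<psi> 0"
proof -
  let ?g0 = "gauss (0::real^'n)"
  define e where "e j = 1 / real (Suc j)" for j
  have e: "e j > 0" "e j \<le> 1" for j by (auto simp: e_def)
  have e0: "e \<longlonglongrightarrow> 0" unfolding e_def[abs_def] by (rule LIMSEQ_Suc[OF lim_1_over_n])
  have \<psi>c: "continuous_on UNIV \<psi>" using smooth_continuous[OF DL1_smooth[OF \<psi>], of "[]"] by simp
  have [measurable]: "\<psi> \<in> borel_measurable borel" by (rule borel_measurable_continuous_onI[OF \<psi>c])
  have [measurable]: "cball (0::real^'n) 1 \<in> sets borel" by (rule borel_closed) simp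
  have g1: "gauss z \<le> ?g0" for z :: "real^'n" by (simp add: gauss_def mult_le_cancel_left1)
  let ?A = "\<lambda>j. LINT \<xi>|lborel. complex_of_real (gauss (e j *\<^sub>R \<xi>) / ?g0) * inverse_fourier \<psi> \<xi>"
  have A: "?A \<longlonglongrightarrow> (LINT \<xi>|lborel. inverse_fourier \<psi> \<xi>)"
  proof (rule integral_dominated_convergence[where w = "\<lambda>\<xi>. cmod (inverse_fourier \<psi> \<xi>)"])
    show "integrable lborel (\<lambda>\<xi>. cmod (inverse_fourier \<psi> \<xi>))"
      using inverse_fourier_integrable[OF \<psi>] by simp
    show "AE \<xi> in lborel. (\<lambda>j. complex_of_real (gauss (e j *\<^sub>R \<xi>) / ?g0) * inverse_fourier \<psi> \<xi>) \<longlonglongrightarrow> inverse_fourier \<psi> \<xi>"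
    proof (intro AE_I2)
      fix \<xi> :: "real^'n"
      have "(\<lambda>j. complex_of_real (gauss (e j *\<^sub>R \<xi>) / ?g0) * inverse_fourier \<psi> \<xi>) \<longlonglongrightarrow>
          complex_of_real ((1 / sqrt (2 * pi)) ^ CARD('n) * exp (- (norm (0 *\<^sub>R \<xi>))\<^sup>2 / 2) / ?g0) * inverse_fourier \<psi> \<xi>"
        unfolding gauss_def[of "_ *\<^sub>R \<xi>"] using gauss_zero_pos[where 'n='n] by (intro tendsto_intros e0) auto
      then show "(\<lambda>j. complex_of_real (gauss (e j *\<^sub>R \<xi>) / ?g0) * inverse_fourier \<psi> \<xi>) \<longlonglongrightarrow> inverse_fourier \<psi> \<xi>"
        by (simp add: gauss_def[of 0])
    qed
    show "AE \<xi> in lborel. norm (complex_of_real (gauss (e j *\<^sub>R \<xi>) / ?g0) * inverse_fourier \<psi> \<xi>) \<le> cmod (inverse_fourier \<psi> \<xi>)" for j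
      using g1 gauss_zero_pos[where 'n='n]
      by (intro AE_I2) (simp add: norm_mult norm_divide divide_le_eq mult.commute[of "cmod _"] mult_right_mono)
  qed measurable
  let ?k = "\<lambda>j x::real^'n. complex_of_real (gauss (x /\<^sub>R e j) / e j ^ CARD('n))"
  let ?\<chi> = "\<lambda>x::real^'n. complex_of_real (indicator (cball 0 1) x)"
  have \<chi>: "integrable lborel (\<lambda>x. f x * \<psi> x * ?k j x)" if "\<And>x. cmod (f x) \<le> 1" and [measurable]: "f \<in> borel_measurable borel" for f j
  proof (rule Bochner_Integration.integrable_bound)
    show "integrable lborel (\<lambda>x. (?g0 / e j ^ CARD('n)) * cmod (\<psi> x))"
      using DL1_integrable0[OF \<psi>] by simp
    have "cmod (f x * \<psi> x * ?k j x) \<le> 1 * cmod (\<psi> x) * (?g0 / e j ^ CARD('n))" for x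
      unfolding norm_mult using that(1)[of x] g1[of "x /\<^sub>R e j"] e(1)[of j]
      by (intro mult_mono) (auto simp: norm_divide norm_power intro!: divide_right_mono)
    then show "AE x in lborel. norm (f x * \<psi> x * ?k j x) \<le> norm ((?g0 / e j ^ CARD('n)) * cmod (\<psi> x))"
      using e(1)[of j] by (intro AE_I2) (simp add: abs_mult mult.commute)
  qed measurable
  \<comment> \<open>After the substitution \<open>x = e j *\<^sub>R z\<close> the Gaussian weight no
    longer depends on \<open>j\<close>, and dominated convergence applies.\<close>
  have near: "(\<lambda>j. LINT x|lborel. ?\<chi> x * \<psi> x * ?k j x) \<longlonglongrightarrow> \<psi> 0"
  proof -
    have "bounded (\<psi> ` cball 0 1)"
      by (intro compact_imp_bounded compact_continuous_image continuous_on_subset[OF \<psi>c]) auto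
    then obtain b where b: "\<And>x. x \<in> cball 0 1 \<Longrightarrow> cmod (\<psi> x) \<le> b" unfolding bounded_iff by blast
    have b0: "b \<ge> 0" using order_trans[OF norm_ge_zero b[of 0]] by simp
    have eq: "(LINT x|lborel. ?\<chi> x * \<psi> x * ?k j x) = (LINT z|lborel. ?\<chi> (e j *\<^sub>R z) * \<psi> (e j *\<^sub>R z) * gauss z)" for j
    proof -
      have ej: "e j \<noteq> 0" using e(1)[of j] by simp
      have ez: "(e j *\<^sub>R z) /\<^sub>R e j = z" for z :: "real^'n" using e(1)[of j] by simp
      have "(LINT x|lborel. ?\<chi> x * \<psi> x * ?k j x) =
          \<bar>e j\<bar> ^ DIM(real^'n) *\<^sub>R (LINT z|lborel. ?\<chi> (e j *\<^sub>R z) * \<psi> (e j *\<^sub>R z) * ?k j (e j *\<^sub>R z))"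
        by (rule lborel_scale(1)[OF ej]) measurable
      also have "\<dots> = (LINT z|lborel. \<bar>e j\<bar> ^ DIM(real^'n) *\<^sub>R (?\<chi> (e j *\<^sub>R z) * \<psi> (e j *\<^sub>R z) * ?k j (e j *\<^sub>R z)))"
        by (rule integral_scaleR_right[symmetric])
      also have "\<dots> = (LINT z|lborel. ?\<chi> (e j *\<^sub>R z) * \<psi> (e j *\<^sub>R z) * gauss z)"
        unfolding ez using e(1)[of j]
        by (intro Bochner_Integration.integral_cong refl) (simp add: scaleR_conv_of_real[of _ "_ :: complex"])
      finally show ?thesis .
    qed
    have "(\<lambda>j. LINT z|lborel. ?\<chi> (e j *\<^sub>R z) * \<psi> (e j *\<^sub>R z) * gauss z) \<longlonglongrightarrow> (LINT z::real^'n|lborel. \<psi> 0 * gauss z)"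
    proof (rule integral_dominated_convergence[where w = "\<lambda>z. b * gauss z"])
      show "integrable lborel (\<lambda>z::real^'n. b * gauss z)"
        using integrable_norm[OF gauss_integrable[where 'n='n]] by simp
      show "AE z in lborel. norm (?\<chi> (e j *\<^sub>R z) * \<psi> (e j *\<^sub>R z) * gauss z) \<le> b * gauss z" for j
        using b b0 by (intro AE_I2) (auto simp: norm_mult indicator_def intro!: mult_right_mono)
      show "AE z in lborel. (\<lambda>j. ?\<chi> (e j *\<^sub>R z) * \<psi> (e j *\<^sub>R z) * gauss z) \<longlonglongrightarrow> \<psi> 0 * gauss z"
      proof (intro AE_I2)
        fix z :: "real^'n"
        have ez: "(\<lambda>j. e j *\<^sub>R z) \<longlonglongrightarrow> 0" using tendsto_scaleR[OF e0 tendsto_const[of z]] by simp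
        have "\<forall>\<^sub>F j in sequentially. norm (e j *\<^sub>R z) < 1"
          using tendsto_norm[OF ez] by (intro order_tendstoD(2)) auto
        then have "\<forall>\<^sub>F j in sequentially. ?\<chi> (e j *\<^sub>R z) * \<psi> (e j *\<^sub>R z) * gauss z = \<psi> (e j *\<^sub>R z) * gauss z"
          by eventually_elim (simp add: indicator_def)
        moreover have "(\<lambda>j. \<psi> (e j *\<^sub>R z) * gauss z) \<longlonglongrightarrow> \<psi> 0 * gauss z"
          by (intro tendsto_intros continuous_on_tendsto_compose[OF \<psi>c ez]) auto
        ultimately show "(\<lambda>j. ?\<chi> (e j *\<^sub>R z) * \<psi> (e j *\<^sub>R z) * gauss z) \<longlonglongrightarrow> \<psi> 0 * gauss z"
          by (rule tendsto_cong[THEN iffD2])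
      qed
    qed measurable
    then show ?thesis unfolding eq integral_mult_right_zero gauss_integral mult_1_right .
  qed
  \<comment> \<open>Outside the unit ball the rescaled argument has norm at least
    \<open>Suc j\<close>, so the kernel tends to 0 uniformly there, even with the factor
    \<open>real (Suc j) ^ CARD('n)\<close>.\<close>
  have far: "(\<lambda>j. LINT x|lborel. (1 - ?\<chi> x) * \<psi> x * ?k j x) \<longlonglongrightarrow> 0"
  proof (rule Lim_null_comparison)
    show "(\<lambda>j. ?g0 * L1_norm \<psi> * (real (Suc j) ^ CARD('n) * exp (- (real (Suc j))\<^sup>2 / 2))) \<longlonglongrightarrow> 0"
      by (rule tendsto_mult_right_zero[OF power_gauss_tendsto_0])
    have "norm (LINT x|lborel. (1 - ?\<chi> x) * \<psi> x * ?k j x) \<le> ?g0 * L1_norm \<psi> * (real (Suc j) ^ CARD('n) * exp (- (real (Suc j))\<^sup>2 / 2))" for j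
    proof -
      let ?b = "?g0 * (real (Suc j) ^ CARD('n) * exp (- (real (Suc j))\<^sup>2 / 2))"
      have b: "cmod ((1 - ?\<chi> x) * \<psi> x * ?k j x) \<le> ?b * cmod (\<psi> x)" for x
      proof (cases "norm x \<le> 1")
        case False
        have "real (Suc j) \<le> norm (x /\<^sub>R e j)" using False by (simp add: e_def mult_le_cancel_left1)
        then have "(real (Suc j))\<^sup>2 \<le> (norm (x /\<^sub>R e j))\<^sup>2" by (intro power_mono) auto
        then have "gauss (x /\<^sub>R e j) \<le> ?g0 * exp (- (real (Suc j))\<^sup>2 / 2)"
          unfolding gauss_def by (simp add: mult_left_mono)
        then have "real (Suc j) ^ CARD('n) * gauss (x /\<^sub>R e j) \<le> ?b"
          by (simp add: mult.left_commute[of ?g0] mult_left_mono del: of_nat_Suc)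
        moreover have "cmod (?k j x) = real (Suc j) ^ CARD('n) * gauss (x /\<^sub>R e j)"
          by (simp only: norm_of_real) (simp add: e_def power_divide divide_simps mult.commute del: of_nat_Suc)
        ultimately have k: "cmod (?k j x) \<le> ?b" by simp
        have "cmod ((1 - ?\<chi> x) * \<psi> x * ?k j x) = cmod (?k j x) * cmod (\<psi> x)"
          using False by (simp add: norm_mult norm_divide indicator_def)
        also have "\<dots> \<le> ?b * cmod (\<psi> x)" by (rule mult_right_mono[OF k]) simp
        finally show ?thesis .
      qed (use gauss_nonneg in \<open>auto intro!: mult_nonneg_nonneg\<close>)
      have "norm (LINT x|lborel. (1 - ?\<chi> x) * \<psi> x * ?k j x) \<le> (LINT x|lborel. cmod ((1 - ?\<chi> x) * \<psi> x * ?k j x))"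
        by (rule integral_norm_bound)
      also have "\<dots> \<le> (LINT x|lborel. ?b * cmod (\<psi> x))"
        using b DL1_integrable0[OF \<psi>] by (intro integral_mono_AE') (auto simp del: of_nat_Suc)
      also have "\<dots> = ?b * L1_norm \<psi>" by (simp add: L1_norm_def)
      finally show ?thesis by (simp add: mult_ac del: of_nat_Suc)
    qed
    then show "\<forall>\<^sub>F j in sequentially. norm (LINT x|lborel. (1 - ?\<chi> x) * \<psi> x * ?k j x) \<le> ?g0 * L1_norm \<psi> * (real (Suc j) ^ CARD('n) * exp (- (real (Suc j))\<^sup>2 / 2))"
      by (intro always_eventually allI)
  qed
  have "?A j = (LINT x|lborel. ?\<chi> x * \<psi> x * ?k j x) + (LINT x|lborel. (1 - ?\<chi> x) * \<psi> x * ?k j x)" for j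
  proof -
    have "integrable lborel (\<lambda>x. ?\<chi> x * \<psi> x * ?k j x)" "integrable lborel (\<lambda>x. (1 - ?\<chi> x) * \<psi> x * ?k j x)"
      by (rule \<chi>, simp add: indicator_def, measurable)+
    then have "(LINT x|lborel. ?\<chi> x * \<psi> x * ?k j x) + (LINT x|lborel. (1 - ?\<chi> x) * \<psi> x * ?k j x) =
      (LINT x|lborel. ?\<chi> x * \<psi> x * ?k j x + (1 - ?\<chi> x) * \<psi> x * ?k j x)"
      by (rule Bochner_Integration.integral_add[symmetric])
    also have "\<dots> = (LINT x|lborel. \<psi> x * ?k j x)"
      by (intro Bochner_Integration.integral_cong refl) (simp only: distrib_right[symmetric], simp)
    finally show ?thesis using damped_inversion[OF DL1_integrable0[OF \<psi>] e(1), of j] by simp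
  qed
  then have "?A \<longlonglongrightarrow> \<psi> 0 + 0" using tendsto_add[OF near far] by simp
  with A show ?thesis using LIMSEQ_unique by auto
qed

section \<open>Consequences of Fourier inversion\<close>

lemma DL1_shift': "\<phi> \<in> DL1 \<Longrightarrow> (\<lambda>y. \<phi> (x + y)) \<in> DL1"
  using DL1_shift[of \<phi> x] by (simp add: add.commute)

lemma DL1_fourier_inversion:
  assumes \<phi>: "\<phi> \<in> DL1"
  shows "\<phi> x = (LINT \<xi>|lborel. exp (- (\<i> * complex_of_real (\<xi> \<bullet> x))) * inverse_fourier \<phi> \<xi>)"
  using DL1_fourier_inversion_0[OF DL1_shift'[OF \<phi>, of x]] by (simp add: inverse_fourier_shift)

text \<open>Through this uniqueness, identities between operators on \<open>DL1\<close> reduce to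
  identities between their multipliers.\<close>

lemma DL1_eqI_fourier:
  assumes "\<phi> \<in> DL1" "\<psi> \<in> DL1" "\<And>\<xi>. inverse_fourier \<phi> \<xi> = inverse_fourier \<psi> \<xi>"
  shows "\<phi> = \<psi>"
  using DL1_fourier_inversion[OF assms(1)] DL1_fourier_inversion[OF assms(2)] assms(3) by auto

text \<open>A Sobolev embedding: by inversion a function in \<open>DL1\<close> is bounded by the L^1
  norm of its transform, and each of its derivatives is again in \<open>DL1\<close>.\<close>

lemma DL1_bdd_smooth:
  assumes "\<phi> \<in> DL1" shows "bdd_smooth \<phi>"
proof -
  have "cmod (\<psi> x) \<le> (LINT \<xi>|lborel. cmod (inverse_fourier \<psi> \<xi>))" if "\<psi> \<in> DL1" for \<psi> :: "real^'a \<Rightarrow> complex" and x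
    unfolding DL1_fourier_inversion[OF that, of x]
    using integral_norm_bound[of lborel "\<lambda>\<xi>. exp (- (\<i> * complex_of_real (\<xi> \<bullet> x))) * inverse_fourier \<psi> \<xi>"]
    by (simp add: norm_mult)
  then have "bounded (range \<psi>)" if "\<psi> \<in> DL1" for \<psi> :: "real^'a \<Rightarrow> complex"
    using that by (auto simp: bounded_iff)
  then show ?thesis using DL1_iter_deriv[OF assms] DL1_smooth[OF assms] by (auto simp: bdd_smooth_def)
qed

context averaging
begin

text \<open>Each translate contributes a phase, so the multiplier of an average is the Fourier
  integral of the weighted distribution of its shifts.\<close>

lemma inverse_fourier_avg:
  assumes f: "integrable lborel f"
  shows "inverse_fourier (avg W Y f) \<xi> =
    (LINT \<omega>|lborel. W \<omega> * exp (- (\<i> * complex_of_real (\<xi> \<bullet> Y \<omega>)))) * inverse_fourier f \<xi>"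
proof -
  let ?e = "\<lambda>x. exp (\<i> * complex_of_real (\<xi> \<bullet> x))"
  have [measurable]: "f \<in> borel_measurable borel" using f by auto
  have int: "integrable (lborel \<Otimes>\<^sub>M lborel) (\<lambda>(\<omega>, x). ?e x * (W \<omega> * f (x + Y \<omega>)))"
    by (rule Bochner_Integration.integrable_bound[OF pair_integrable[OF f]])
       (auto simp: norm_mult norm_exp_i_times)
  have "(LINT x|lborel. ?e x * avg W Y f x) = (LINT x|lborel. LINT \<omega>|lborel. ?e x * (W \<omega> * f (x + Y \<omega>)))"
    by (simp add: avg_def)
  also have "\<dots> = (LINT \<omega>|lborel. LINT x|lborel. ?e x * (W \<omega> * f (x + Y \<omega>)))"
    by (rule lborel_pair.Fubini_integral[OF int])
  also have "\<dots> = (LINT \<omega>|lborel. W \<omega> * exp (- (\<i> * complex_of_real (\<xi> \<bullet> Y \<omega>))) * (LINT x|lborel. ?e x * f x))"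
  proof (intro Bochner_Integration.integral_cong refl)
    fix \<omega> :: 'a
    have "(LINT x|lborel. ?e x * (W \<omega> * f (x + Y \<omega>))) = W \<omega> * (LINT x|lborel. ?e x * f (x + Y \<omega>))"
      by (simp add: mult.left_commute)
    also have "(LINT x|lborel. ?e x * f (x + Y \<omega>)) = (LINT x|lborel. (\<lambda>x. exp (- (\<i> * complex_of_real (\<xi> \<bullet> Y \<omega>))) * (?e x * f x)) (x + Y \<omega>))"
      by (intro Bochner_Integration.integral_cong refl)
         (simp add: inner_add_right distrib_left exp_add exp_minus field_simps)
    also have "\<dots> = (LINT x|lborel. exp (- (\<i> * complex_of_real (\<xi> \<bullet> Y \<omega>))) * (?e x * f x))"
      by (rule lborel_translation)
    finally show "(LINT x|lborel. ?e x * (W \<omega> * f (x + Y \<omega>))) = W \<omega> * exp (- (\<i> * complex_of_real (\<xi> \<bullet> Y \<omega>))) * (LINT x|lborel. ?e x * f x)"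
      by simp
  qed
  also have "\<dots> = (LINT \<omega>|lborel. W \<omega> * exp (- (\<i> * complex_of_real (\<xi> \<bullet> Y \<omega>)))) * (LINT x|lborel. ?e x * f x)"
    by (rule integral_mult_left_zero)
  finally have eq: "(LINT x|lborel. ?e x * avg W Y f x) =
    (LINT \<omega>|lborel. W \<omega> * exp (- (\<i> * complex_of_real (\<xi> \<bullet> Y \<omega>)))) * (LINT x|lborel. ?e x * f x)" .
  show ?thesis unfolding inverse_fourier_def eq by (simp only: mult_ac)
qed

end

section \<open>The resolvent of the Laplacian\<close>

text \<open>Taken at 1 for the exponential time, and at 1/2 for the time weight that is left after
  one integration by parts.\<close>

lemma Gamma_integrable:
  assumes "a > 0"
  shows "integrable lborel (\<lambda>t::real. indicator {0..} t * t powr (a - 1) / exp t)"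
    and "(LINT t::real|lborel. indicator {0..} t * t powr (a - 1) / exp t) = Gamma a"
proof -
  have nn: "0 \<le> indicator {0..} t * t powr (a - 1) / exp t" for t :: real
    by (simp add: indicator_def)
  have I: "nn_integral lborel (\<lambda>t::real. ennreal (indicator {0..} t * t powr (a - 1) / exp t)) = ennreal (Gamma a)"
    by (rule Gamma_conv_nn_integral_real[OF assms, symmetric])
  have G: "0 \<le> Gamma a" using Gamma_real_pos[OF assms] by simp
  have M: "(\<lambda>t::real. indicator {0..} t * t powr (a - 1) / exp t) \<in> borel_measurable lborel" by measurable
  show "integrable lborel (\<lambda>t::real. indicator {0..} t * t powr (a - 1) / exp t)"
    by (rule integrableI_nn_integral_finite[OF M _ I]) (use nn G in auto)
  show "(LINT t::real|lborel. indicator {0..} t * t powr (a - 1) / exp t) = Gamma a"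
    by (subst integral_eq_nn_integral[OF M]) (use nn G I in auto)
qed

definition expw :: "real \<Rightarrow> real" where
  "expw t = indicator {0<..} t * exp (- t)"

lemma expw_nonneg [simp]: "expw t \<ge> 0"
  by (simp add: expw_def)

lemma expw_measurable [measurable]: "expw \<in> borel_measurable borel"
  unfolding expw_def[abs_def] by measurable

text \<open>At \<open>t = 0\<close> both sides vanish because \<open>0 powr 0 = 0\<close>; this
  matches the open half-line in \<open>expw\<close>.\<close>

lemma expw_eq: "expw t = indicator {0..} t * t powr (1 - 1) / exp t"
  by (auto simp: expw_def indicator_def exp_minus field_simps)

lemma expw_integrable: "integrable lborel expw"
  and expw_integral: "(LINT t|lborel. expw t) = 1"
  using Gamma_integrable[of 1] by (simp_all only: expw_eq[abs_def] expw_eq) simp_all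

text \<open>Substituting \<open>(1 + a) * t\<close> for the variable in the total mass 1 produces
  the damped integral with the factor \<open>1 + a\<close>.\<close>

lemma expw_laplace:
  assumes "a \<ge> 0"
  shows "(LINT t|lborel. complex_of_real (expw t * exp (- (a * t)))) = complex_of_real (1 / (1 + a))"
proof -
  have "(LINT t|lborel. complex_of_real (expw t)) = \<bar>1 + a\<bar> ^ DIM(real) *\<^sub>R (LINT t|lborel. complex_of_real (expw ((1 + a) *\<^sub>R t)))"
    by (rule lborel_scale(1)) (use assms in simp, measurable)
  also have "(\<lambda>t. expw ((1 + a) *\<^sub>R t)) = (\<lambda>t. expw t * exp (- (a * t)))"
  proof
    fix t
    have "0 < (1 + a) * t \<longleftrightarrow> 0 < t" using assms by (auto simp only: zero_less_mult_iff)
    moreover have "exp (- ((1 + a) * t)) = exp (- t) * exp (- (a * t))"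
      by (simp add: algebra_simps flip: exp_add)
    ultimately show "expw ((1 + a) *\<^sub>R t) = expw t * exp (- (a * t))"
      by (simp add: expw_def indicator_def)
  qed
  also have "(LINT t|lborel. complex_of_real (expw t)) = 1"
    by (simp only: integral_complex_of_real expw_integral of_real_1)
  finally have "complex_of_real (1 + a) * (LINT t|lborel. complex_of_real (expw t * exp (- (a * t)))) = 1"
    using assms by (simp add: scaleR_conv_of_real del: of_real_add of_real_mult)
  moreover have "complex_of_real (1 + a) \<noteq> 0" using assms by (simp only: of_real_eq_0_iff)
  ultimately show ?thesis
    unfolding of_real_divide of_real_1 by (metis nonzero_mult_div_cancel_left)
qed

lemma lborel_product_integrable:
  fixes f :: "'a::euclidean_space \<Rightarrow> complex" and g :: "'b::euclidean_space \<Rightarrow> complex"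
  assumes f: "integrable lborel f" and g: "integrable lborel g"
  shows "integrable lborel (\<lambda>p. f (fst p) * g (snd p))"
proof -
  have [measurable]: "f \<in> borel_measurable borel" "g \<in> borel_measurable borel" using f g by auto
  have "integrable (lborel \<Otimes>\<^sub>M lborel) (\<lambda>(x, y). f x * g y)"
  proof (rule lborel_pair_Fubini_integrable)
    show "integrable lborel (\<lambda>x. LINT y|lborel. norm (f x * g y))"
      using f by (simp add: norm_mult)
  qed (use g in \<open>auto simp: norm_mult\<close>)
  then show ?thesis by (simp add: lborel_prod case_prod_unfold)
qed

lemma lborel_integral_prod:
  fixes F :: "'a::euclidean_space \<times> 'b::euclidean_space \<Rightarrow> complex"
  assumes "integrable lborel F"
  shows "(LINT p|lborel. F p) = (LINT x|lborel. LINT y|lborel. F (x, y))"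
  using lborel_pair.integral_fst'[of F] assms by (simp add: lborel_prod)

section \<open>The resolvent as heat flow stopped at an exponential time\<close>

definition heat_weight :: "real \<times> (real^'n::finite) \<Rightarrow> complex" where
  "heat_weight p = complex_of_real (expw (fst p)) * complex_of_real (gauss (snd p))"

text \<open>The position at time \<open>fst p\<close> of a Brownian motion with generator \<Delta>,
  not \<Delta>/2: each coordinate has variance \<open>2 * fst p\<close>.\<close>

definition heat_shift :: "real \<times> (real^'n::finite) \<Rightarrow> real^'n" where
  "heat_shift p = sqrt (2 * fst p) *\<^sub>R snd p"

interpretation heat: averaging heat_weight heat_shift
proof
  show "integrable lborel heat_weight"
    unfolding heat_weight_def[abs_def]
    by (rule lborel_product_integrable) (use expw_integrable gauss_integrable in auto)
  show "heat_shift \<in> borel_measurable borel"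
    unfolding heat_shift_def[abs_def] by (simp add: borel_prod[symmetric])
qed

abbreviation resolvent :: "(real^'n::finite \<Rightarrow> complex) \<Rightarrow> real^'n \<Rightarrow> complex" where
  "resolvent \<equiv> avg heat_weight heat_shift"

text \<open>The Gaussian integral at time t gives exp (- t |\<xi>|^2), and the exponential time
  takes the Laplace transform of this at |\<xi>|^2.\<close>

lemma heat_multiplier:
  fixes \<xi> :: "real^'n::finite"
  shows "(LINT p|lborel. heat_weight p * exp (- (\<i> * complex_of_real (\<xi> \<bullet> heat_shift p)))) = complex_of_real (1 / (1 + (norm \<xi>)\<^sup>2))"
proof -
  let ?F = "\<lambda>p. heat_weight p * exp (- (\<i> * complex_of_real (\<xi> \<bullet> heat_shift p)))"
  have [measurable]: "heat_shift \<in> borel_measurable (borel :: (real \<times> (real^'n)) measure)" by (rule heat.Y)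
  have "integrable lborel ?F"
    by (rule Bochner_Integration.integrable_bound[OF heat.W]) (auto simp: norm_mult)
  then have "(LINT p|lborel. ?F p) = (LINT t|lborel. LINT z|lborel. ?F (t, z))" by (rule lborel_integral_prod)
  also have "\<dots> = (LINT t|lborel. complex_of_real (expw t * exp (- ((norm \<xi>)\<^sup>2 * t))))"
  proof (intro Bochner_Integration.integral_cong refl)
    fix t :: real
    show "(LINT z|lborel. ?F (t, z)) = complex_of_real (expw t * exp (- ((norm \<xi>)\<^sup>2 * t)))"
    proof (cases "t > 0")
      case True
      let ?\<eta> = "- (sqrt (2 * t) *\<^sub>R \<xi>)"
      have "?F (t, z) = complex_of_real (expw t) * (complex_of_real (gauss z) * exp (\<i> * complex_of_real (?\<eta> \<bullet> z)))" for z
        by (simp add: heat_weight_def heat_shift_def)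
      then have "(LINT z|lborel. ?F (t, z)) = complex_of_real (expw t) * complex_of_real (exp (- (norm ?\<eta>)\<^sup>2 / 2))"
        by (simp only: integral_mult_right_zero gauss_fourier)
      also have "(norm ?\<eta>)\<^sup>2 = 2 * t * (norm \<xi>)\<^sup>2" using True by (simp add: power_mult_distrib)
      finally show ?thesis by (simp add: mult_ac)
    qed (simp add: heat_weight_def expw_def)
  qed
  also have "\<dots> = complex_of_real (1 / (1 + (norm \<xi>)\<^sup>2))" by (rule expw_laplace) simp
  finally show ?thesis .
qed

text \<open>The weight is nonnegative, so its mass is its integral, which is the multiplier at
  frequency 0.\<close>

lemma heat_mass: "averaging.mass (heat_weight :: real \<times> (real^'n::finite) \<Rightarrow> complex) = 1"
proof -
  have "complex_of_real (averaging.mass (heat_weight :: real \<times> (real^'n) \<Rightarrow> complex)) = (LINT p|lborel. complex_of_real (cmod (heat_weight (p :: real \<times> (real^'n)))))"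
    unfolding heat.mass_def by simp
  also have "\<dots> = (LINT p|lborel. heat_weight (p :: real \<times> (real^'n)))"
    by (simp add: heat_weight_def norm_mult)
  also have "\<dots> = 1" using heat_multiplier[of "0 :: real^'n"] by simp
  finally show ?thesis by (simp only: of_real_eq_1_iff)
qed

lemma inverse_fourier_resolvent:
  "integrable lborel \<phi> \<Longrightarrow> inverse_fourier (resolvent \<phi>) \<xi> = complex_of_real (1 / (1 + (norm \<xi>)\<^sup>2)) * inverse_fourier \<phi> \<xi>"
  by (simp only: heat.inverse_fourier_avg heat_multiplier)

lemma resolvent_DL1: "\<phi> \<in> DL1 \<Longrightarrow> resolvent \<phi> \<in> DL1"
  by (rule heat.avg_DL1[OF DL1_bdd_smooth])

lemma iter_deriv_resolvent: "\<phi> \<in> DL1 \<Longrightarrow> iter_deriv w (resolvent \<phi>) = resolvent (iter_deriv w \<phi>)"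
  by (rule heat.avg_smooth(2)[OF DL1_bdd_smooth])

lemma L1_norm_resolvent: "integrable lborel \<phi> \<Longrightarrow> L1_norm (resolvent \<phi>) \<le> L1_norm \<phi>"
  using heat.L1_norm_avg[of \<phi>] by (simp add: heat_mass)

text \<open>The multipliers are reciprocal. It is this order of the two operators that recovers a
  functional from its smoothing.\<close>

lemma resolvent_bessel_op:
  assumes "\<phi> \<in> DL1" shows "resolvent (bessel_op \<phi>) = \<phi>"
proof (rule DL1_eqI_fourier)
  fix \<xi> :: "real^'a"
  have "1 + (norm \<xi>)\<^sup>2 \<noteq> 0" by (metis add_pos_nonneg less_irrefl zero_le_power2 zero_less_one)
  then have "complex_of_real (1 / (1 + (norm \<xi>)\<^sup>2)) * complex_of_real (1 + (norm \<xi>)\<^sup>2) = 1"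
    by (simp only: of_real_mult[symmetric]) simp
  then show "inverse_fourier (resolvent (bessel_op \<phi>)) \<xi> = inverse_fourier \<phi> \<xi>"
    by (simp only: inverse_fourier_resolvent inverse_fourier_bessel_op DL1_integrable0 bessel_op_DL1 assms mult.assoc[symmetric] mult_1_left)
qed (use assms in \<open>auto intro: resolvent_DL1 bessel_op_DL1\<close>)

section \<open>Iterates of the resolvent and the Bessel kernels of even order\<close>

lemma resolvent_iter_bessel_op:
  assumes "\<phi> \<in> DL1" shows "(resolvent ^^ m) ((bessel_op ^^ m) \<phi>) = \<phi>"
proof (induction m)
  case (Suc m)
  have "(resolvent ^^ Suc m) ((bessel_op ^^ Suc m) \<phi>) = (resolvent ^^ m) (resolvent (bessel_op ((bessel_op ^^ m) \<phi>)))"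
    by (simp add: funpow_swap1)
  then show ?case by (simp only: resolvent_bessel_op[OF bessel_op_iter(1)[OF assms]] Suc)
qed simp

lemma resolvent_iter_DL1:
  assumes "\<phi> \<in> DL1"
  shows "(resolvent ^^ m) \<phi> \<in> DL1"
    and "iter_deriv w ((resolvent ^^ m) \<phi>) = (resolvent ^^ m) (iter_deriv w \<phi>)"
    and "inverse_fourier ((resolvent ^^ m) \<phi>) \<xi> = complex_of_real (1 / (1 + (norm \<xi>)\<^sup>2) ^ m) * inverse_fourier \<phi> \<xi>"
    and "L1_norm ((resolvent ^^ m) \<phi>) \<le> L1_norm \<phi>"
proof -
  show *: "(resolvent ^^ m) \<phi> \<in> DL1" for m by (induction m) (auto simp: assms resolvent_DL1)
  show "iter_deriv w ((resolvent ^^ m) \<phi>) = (resolvent ^^ m) (iter_deriv w \<phi>)"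
    by (induction m) (simp_all add: iter_deriv_resolvent[OF *])
  show "inverse_fourier ((resolvent ^^ m) \<phi>) \<xi> = complex_of_real (1 / (1 + (norm \<xi>)\<^sup>2) ^ m) * inverse_fourier \<phi> \<xi>"
    by (induction m) (simp_all add: inverse_fourier_resolvent[OF DL1_integrable0[OF *]])
  show "L1_norm ((resolvent ^^ m) \<phi>) \<le> L1_norm \<phi>"
  proof (induction m)
    case (Suc m)
    then show ?case using L1_norm_resolvent[OF DL1_integrable0[OF *[of m]]] by simp
  qed simp
qed

lemma resolvent_iter_lincomb:
  assumes "\<phi> \<in> DL1" "\<psi> \<in> DL1"
  shows "(resolvent ^^ m) (\<lambda>x. a * \<phi> x + b * \<psi> x) = (\<lambda>x. a * (resolvent ^^ m) \<phi> x + b * (resolvent ^^ m) \<psi> x)"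
proof (rule DL1_eqI_fourier)
  show "inverse_fourier ((resolvent ^^ m) (\<lambda>x. a * \<phi> x + b * \<psi> x)) \<xi> =
    inverse_fourier (\<lambda>x. a * (resolvent ^^ m) \<phi> x + b * (resolvent ^^ m) \<psi> x) \<xi>" for \<xi>
    using assms by (simp add: resolvent_iter_DL1 DL1_lincomb inverse_fourier_lincomb DL1_integrable0 algebra_simps add_divide_distrib)
qed (use assms in \<open>auto intro!: resolvent_iter_DL1 DL1_lincomb\<close>)

text \<open>The kernel is given only through its Fourier multiplier; translation of \<phi> becomes
  the phase of the inversion formula, and for even order the multiplier is a natural power of that
  of the resolvent.\<close>

theorem bessel_kernel_eq_resolvent:
  assumes \<phi>: "\<phi> \<in> DL1"
  shows "bessel_kernel (2 * real m) (\<lambda>y. \<phi> (x + y)) = (resolvent ^^ m) \<phi> x"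
proof -
  have powr: "(1 + (norm \<xi>)\<^sup>2) powr (- (2 * real m) / 2) = 1 / (1 + (norm \<xi>)\<^sup>2) ^ m" for \<xi> :: "real^'a"
  proof -
    have pos: "1 + (norm \<xi>)\<^sup>2 > 0" by (simp add: add_pos_nonneg)
    have "- (2 * real m) / 2 = - real m" by simp
    then show ?thesis by (simp only: powr_minus powr_realpow[OF pos] inverse_eq_divide)
  qed
  have "bessel_kernel (2 * real m) (\<lambda>y. \<phi> (x + y)) =
      (LINT \<xi>|lborel. complex_of_real (1 / (1 + (norm \<xi>)\<^sup>2) ^ m) * (exp (- (\<i> * complex_of_real (\<xi> \<bullet> x))) * inverse_fourier \<phi> \<xi>))"
    unfolding bessel_kernel_def dist_inverse_fourier_def powr using DL1_shift'[OF \<phi>, of x]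
    by (simp only: if_True inverse_fourier_shift)
  also have "\<dots> = (LINT \<xi>|lborel. exp (- (\<i> * complex_of_real (\<xi> \<bullet> x))) * inverse_fourier ((resolvent ^^ m) \<phi>) \<xi>)"
    by (simp only: resolvent_iter_DL1[OF \<phi>] mult.left_commute)
  also have "\<dots> = (resolvent ^^ m) \<phi> x"
    by (rule DL1_fourier_inversion[OF resolvent_iter_DL1(1)[OF \<phi>], symmetric])
  finally show ?thesis .
qed

section \<open>The smoothing effect of the resolvent\<close>

text \<open>Moving one derivative onto the Gaussian costs the factor z_i / \<surd>(2t). Together
  with exp (- t) this leaves the integrand of \<Gamma>(1/2) in time and a first Gaussian moment in
  space, with 1 / \<surd>2 as remaining constant.\<close>

definition heat_deriv_weight :: "'n::finite \<Rightarrow> real \<times> (real^'n) \<Rightarrow> complex" where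
  "heat_deriv_weight i p = complex_of_real (indicator {0..} (fst p) * fst p powr (1/2 - 1) / exp (fst p)) *
     complex_of_real (snd p $ i * gauss (snd p)) * complex_of_real (1 / sqrt 2)"

lemma averaging_heat_deriv: "averaging (heat_deriv_weight i) heat_shift"
proof
  have "integrable lborel (\<lambda>t::real. complex_of_real (indicator {0..} t * t powr (1/2 - 1) / exp t))"
    using Gamma_integrable(1)[of "1/2"] by (intro integrable_of_real) simp
  from lborel_product_integrable[OF this gauss_moment_integrable[of i]]
  show "integrable lborel (heat_deriv_weight i)"
    unfolding heat_deriv_weight_def[abs_def] by (rule integrable_mult_left)
qed (rule heat.Y)

lemma gauss_directional_derivative:
  "((\<lambda>s. complex_of_real (gauss (z + s *\<^sub>R axis i 1))) has_vector_derivative - complex_of_real (z $ i * gauss z)) (at 0)"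
proof -
  have sq: "(norm (z + s *\<^sub>R axis i 1))\<^sup>2 = (norm z)\<^sup>2 + 2 * s * z $ i + s\<^sup>2" for s
    by (simp only: power2_norm_eq_inner) (simp add: inner_add_left inner_add_right inner_axis inner_axis' power2_eq_square algebra_simps)
  have "((\<lambda>s. (1 / sqrt (2 * pi)) ^ CARD('a) * exp (- ((norm z)\<^sup>2 + 2 * s * z $ i + s\<^sup>2) / 2)) has_real_derivative
     - (z $ i * gauss z)) (at 0)"
    by (auto intro!: derivative_eq_intros simp: gauss_def)
  then have "((\<lambda>s. gauss (z + s *\<^sub>R axis i 1)) has_real_derivative - (z $ i * gauss z)) (at 0)"
    by (simp only: gauss_def sq)
  from has_vector_derivative_of_real[OF this]
  show ?thesis by simp
qed

text \<open>The derivative in \<open>z\<close> of the product of \<open>gauss z\<close> and \<phi>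
  at \<open>x + s *\<^sub>R z\<close> integrates to 0; the chain rule produces the factor
  \<open>s\<close>.\<close>

lemma gauss_integration_by_parts:
  fixes \<phi> :: "real^'n::finite \<Rightarrow> complex"
  assumes \<phi>: "\<phi> \<in> DL1"
  shows "s * (LINT z|lborel. complex_of_real (gauss z) * iter_deriv [i] \<phi> (x + s *\<^sub>R z)) =
    (LINT z|lborel. complex_of_real (z $ i * gauss z) * \<phi> (x + s *\<^sub>R z))"
proof -
  interpret g: averaging "\<lambda>z::real^'n. complex_of_real (gauss z)" "\<lambda>z. s *\<^sub>R z"
    by unfold_locales (use gauss_integrable in auto)
  interpret m: averaging "\<lambda>z::real^'n. complex_of_real (z $ i * gauss z)" "\<lambda>z. s *\<^sub>R z"
    by unfold_locales (use gauss_moment_integrable[of i] in auto)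
  have bs: "iter_deriv w \<phi> \<in> borel_measurable borel" "bounded (range (iter_deriv w \<phi>))" for w
    using DL1_bdd_smooth[OF \<phi>] by (auto simp: bdd_smooth_def smooth_measurable)
  have int: "integrable lborel (\<lambda>z. complex_of_real (gauss z) * iter_deriv w \<phi> (x + s *\<^sub>R z))"
    "integrable lborel (\<lambda>z. complex_of_real (z $ i * gauss z) * iter_deriv w \<phi> (x + s *\<^sub>R z))" for w
    by (rule g.bounded_integrable[OF bs], rule m.bounded_integrable[OF bs])
  note int0 = int[of "[]", unfolded iter_deriv_Nil]
  let ?g' = "\<lambda>z. s * (complex_of_real (gauss z) * iter_deriv [i] \<phi> (x + s *\<^sub>R z)) - complex_of_real (z $ i * gauss z) * \<phi> (x + s *\<^sub>R z)"
  have "(LINT z|lborel. ?g' z) = 0"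
  proof (rule integral_derivative_zero[where v = "axis i 1" and g = "\<lambda>z. complex_of_real (gauss z) * \<phi> (x + s *\<^sub>R z)"])
    fix z :: "real^'n"
    have "((\<lambda>r. \<phi> ((x + s *\<^sub>R z) + r *\<^sub>R axis i 1)) has_vector_derivative iter_deriv [i] \<phi> (x + s *\<^sub>R z)) (at (s * 0))"
      using smooth_axis_derivative[OF DL1_smooth[OF \<phi>], of "[]" "x + s *\<^sub>R z" i] by simp
    moreover have "((\<lambda>r. s * r) has_vector_derivative s) (at 0)"
      by (auto intro!: derivative_eq_intros simp: has_real_derivative_iff_has_vector_derivative[symmetric])
    ultimately have "((\<lambda>r. \<phi> ((x + s *\<^sub>R z) + r *\<^sub>R axis i 1)) \<circ> (\<lambda>r. s * r) has_vector_derivative s *\<^sub>R iter_deriv [i] \<phi> (x + s *\<^sub>R z)) (at 0)"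
      by (intro vector_diff_chain_at)
    then have "((\<lambda>r. \<phi> (x + s *\<^sub>R (z + r *\<^sub>R axis i 1))) has_vector_derivative s *\<^sub>R iter_deriv [i] \<phi> (x + s *\<^sub>R z)) (at 0)"
      by (simp add: o_def scaleR_add_right add.assoc)
    from has_vector_derivative_mult[OF gauss_directional_derivative this]
    show "((\<lambda>r. complex_of_real (gauss (z + r *\<^sub>R axis i 1)) * \<phi> (x + s *\<^sub>R (z + r *\<^sub>R axis i 1))) has_vector_derivative ?g' z) (at 0)"
      by (simp add: scaleR_conv_of_real[of _ "_ :: complex"] mult_ac)
  next
    have "continuous_on UNIV (\<lambda>z. iter_deriv w \<phi> (x + s *\<^sub>R z))" for w
      by (rule continuous_on_compose2[OF smooth_continuous[OF DL1_smooth[OF \<phi>]]]) (auto intro!: continuous_intros)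
    from this[of "[i]"] this[of "[]"] show "continuous_on UNIV ?g'"
      unfolding gauss_def by (auto intro!: continuous_intros)
  next
    show "integrable lborel ?g'" using int(1)[of "[i]"] int0 by (intro Bochner_Integration.integrable_diff integrable_mult_right)
  qed (use int0 in auto)
  then have "(LINT z|lborel. s * (complex_of_real (gauss z) * iter_deriv [i] \<phi> (x + s *\<^sub>R z))) -
      (LINT z|lborel. complex_of_real (z $ i * gauss z) * \<phi> (x + s *\<^sub>R z)) = 0"
    by (subst (asm) Bochner_Integration.integral_diff) (intro integrable_mult_right int int0)+
  then show ?thesis by (simp only: integral_mult_right_zero right_minus_eq)
qed

text \<open>The derivative of R \<phi> is written as an average of \<phi> itself, whence the gain.
  The time singularity t^(-1/2) is integrable; a second integration by parts would leave
  1/t.\<close>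

lemma deriv_resolvent:
  fixes \<phi> :: "real^'n::finite \<Rightarrow> complex"
  assumes \<phi>: "\<phi> \<in> DL1"
  shows "iter_deriv [i] (resolvent \<phi>) = avg (heat_deriv_weight i) heat_shift \<phi>"
proof
  fix x :: "real^'n"
  interpret D: averaging "heat_deriv_weight i" heat_shift by (rule averaging_heat_deriv)
  have bs: "iter_deriv w \<phi> \<in> borel_measurable borel" "bounded (range (iter_deriv w \<phi>))" for w
    using DL1_bdd_smooth[OF \<phi>] by (auto simp: bdd_smooth_def smooth_measurable)
  have "iter_deriv [i] (resolvent \<phi>) x = (LINT p|lborel. heat_weight p * iter_deriv [i] \<phi> (x + heat_shift p))"
    unfolding iter_deriv_resolvent[OF \<phi>] by (simp add: avg_def)
  also have "\<dots> = (LINT t|lborel. LINT z|lborel. heat_weight (t, z) * iter_deriv [i] \<phi> (x + heat_shift (t, z)))"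
    by (rule lborel_integral_prod) (rule heat.bounded_integrable[OF bs])
  also have "\<dots> = (LINT t|lborel. LINT z|lborel. heat_deriv_weight i (t, z) * \<phi> (x + heat_shift (t, z)))"
  proof (rule Bochner_Integration.integral_cong[OF refl])
    fix t :: real
    let ?s = "sqrt (2 * t)"
    show "(LINT z|lborel. heat_weight (t, z) * iter_deriv [i] \<phi> (x + heat_shift (t, z))) =
      (LINT z|lborel. heat_deriv_weight i (t, z) * \<phi> (x + heat_shift (t, z)))"
    proof (cases "t > 0")
      case True
      let ?A = "LINT z|lborel. complex_of_real (gauss z) * iter_deriv [i] \<phi> (x + ?s *\<^sub>R z)"
      let ?B = "LINT z|lborel. complex_of_real (z $ i * gauss z) * \<phi> (x + ?s *\<^sub>R z)"
      have 1: "(LINT z|lborel. heat_weight (t, z) * iter_deriv [i] \<phi> (x + heat_shift (t, z))) = complex_of_real (exp (- t)) * ?A"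
        using True by (simp add: heat_weight_def heat_shift_def expw_def mult.assoc del: of_real_mult)
      have "(1 / 2 - 1 :: real) = - (1 / 2)" by simp
      then have q: "t powr (1/2 - 1) = 1 / sqrt t"
        by (simp only: powr_minus powr_half_sqrt[OF less_imp_le[OF True]] inverse_eq_divide)
      have w: "indicator {0..} t * t powr (1/2 - 1) / exp t * (1 / sqrt 2) = exp (- t) / ?s"
        unfolding q using True by (simp add: real_sqrt_mult exp_minus inverse_eq_divide)
      have 2: "heat_deriv_weight i (t, z) = complex_of_real (exp (- t) / ?s) * complex_of_real (z $ i * gauss z)" for z
        unfolding heat_deriv_weight_def fst_conv snd_conv w[symmetric] of_real_mult[of _ "1 / sqrt 2"] by (simp only: mult_ac)
      have 3: "(LINT z|lborel. heat_deriv_weight i (t, z) * \<phi> (x + heat_shift (t, z))) = complex_of_real (exp (- t) / ?s) * ?B"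
        unfolding 2 heat_shift_def fst_conv snd_conv mult.assoc by (rule integral_mult_right_zero)
      show ?thesis
        unfolding 1 3 gauss_integration_by_parts[OF \<phi>, symmetric] using True by simp
    \<comment> \<open>For nonpositive times both integrands vanish; at 0 the first does so because
      \<open>expw\<close> is supported in the open half-line, the second because
      \<open>0 powr a = 0\<close>.\<close>
    qed (auto simp: heat_weight_def expw_def heat_deriv_weight_def indicator_def)
  qed
  also have "\<dots> = (LINT p|lborel. heat_deriv_weight i p * \<phi> (x + heat_shift p))"
    by (rule lborel_integral_prod[symmetric]) (rule D.bounded_integrable[OF bs[of "[]", simplified]])
  finally show "iter_deriv [i] (resolvent \<phi>) x = avg (heat_deriv_weight i) heat_shift \<phi> x"
    by (simp add: avg_def)
qed

lemma resolvent_gain: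
  obtains c where "c \<ge> 1" "\<And>i \<phi>. \<phi> \<in> DL1 \<Longrightarrow> L1_norm (iter_deriv [i] (resolvent (\<phi> :: real^'n::finite \<Rightarrow> complex))) \<le> c * L1_norm \<phi>"
proof -
  let ?m = "\<lambda>i::'n. averaging.mass (heat_deriv_weight i)"
  have m0: "?m i \<ge> 0" for i by (rule averaging.mass_nonneg[OF averaging_heat_deriv])
  \<comment> \<open>The sum serves all directions at once; the added 1 gives
    \<open>c \<ge> 1\<close>, so that a power of \<open>c\<close> also covers words shorter than the
    number of resolvents.\<close>
  show ?thesis
  proof (rule that[of "1 + (\<Sum>i\<in>UNIV. ?m i)"])
    fix i and \<phi> :: "real^'n \<Rightarrow> complex" assume \<phi>: "\<phi> \<in> DL1"
    have "L1_norm (iter_deriv [i] (resolvent \<phi>)) \<le> ?m i * L1_norm \<phi>"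
      unfolding deriv_resolvent[OF \<phi>] by (rule averaging.L1_norm_avg[OF averaging_heat_deriv DL1_integrable0[OF \<phi>]])
    also have "?m i \<le> (\<Sum>i\<in>UNIV. ?m i)" by (rule member_le_sum) (use m0 in auto)
    finally show "L1_norm (iter_deriv [i] (resolvent \<phi>)) \<le> (1 + (\<Sum>i\<in>UNIV. ?m i)) * L1_norm \<phi>"
      using L1_norm_nonneg[of \<phi>] by (simp add: distrib_right mult_right_mono add_increasing)
  qed (simp add: sum_nonneg m0)
qed

text \<open>Each resolvent absorbs one letter of the word: derivatives commute with the resolvents,
  so the outermost letter meets the outermost resolvent and \<open>resolvent_gain\<close>
  applies.\<close>

lemma resolvent_smoothing:
  obtains c where "c > 0" "\<And>\<phi> :: real^'n::finite \<Rightarrow> complex. \<phi> \<in> DL1 \<Longrightarrow> DL1_norm m ((resolvent ^^ m) \<phi>) \<le> c * L1_norm \<phi>"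
proof -
  obtain c where c: "c \<ge> 1" "\<And>i \<phi>. \<phi> \<in> DL1 \<Longrightarrow> L1_norm (iter_deriv [i] (resolvent (\<phi> :: real^'n \<Rightarrow> complex))) \<le> c * L1_norm \<phi>"
    using resolvent_gain by metis
  have *: "length w \<le> m \<Longrightarrow> L1_norm (iter_deriv w ((resolvent ^^ m) \<phi>)) \<le> c ^ m * L1_norm \<phi>"
    if \<phi>: "\<phi> \<in> DL1" for w and \<phi> :: "real^'n \<Rightarrow> complex" and m
  proof (induction m arbitrary: w)
    case (Suc m)
    show ?case
    proof (cases w)
      case Nil
      have "1 * L1_norm \<phi> \<le> c ^ Suc m * L1_norm \<phi>" using c(1) by (intro mult_right_mono one_le_power) auto
      then show ?thesis using Nil resolvent_iter_DL1(4)[OF \<phi>, of "Suc m"] by (simp del: funpow.simps)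
    next
      case (Cons i v)
      let ?\<psi> = "(resolvent ^^ m) \<phi>"
      have \<psi>: "?\<psi> \<in> DL1" by (rule resolvent_iter_DL1(1)[OF \<phi>])
      have "iter_deriv w ((resolvent ^^ Suc m) \<phi>) = iter_deriv [i] (resolvent (iter_deriv v ?\<psi>))"
        using iter_deriv_append[of "[i]" v] by (simp add: Cons iter_deriv_resolvent \<psi> DL1_iter_deriv)
      then have "L1_norm (iter_deriv w ((resolvent ^^ Suc m) \<phi>)) \<le> c * L1_norm (iter_deriv v ?\<psi>)"
        using c(2)[OF DL1_iter_deriv[OF \<psi>]] by simp
      also have "\<dots> \<le> c * (c ^ m * L1_norm \<phi>)" using Suc Cons c(1) by (intro mult_left_mono) auto
      finally show ?thesis by (simp add: mult_ac)
    qed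
  qed simp
  have "DL1_norm m ((resolvent ^^ m) \<phi>) \<le> c ^ m * L1_norm \<phi>" if "\<phi> \<in> DL1" for \<phi> :: "real^'n \<Rightarrow> complex"
    by (rule DL1_norm_least) (rule *[OF that])
  moreover have "c ^ m > 0" using c(1) by simp
  ultimately show ?thesis using that by blast
qed

section \<open>A smooth bump function\<close>

text \<open>The powers of 1/s are included because differentiating exp (- 1/s) creates them: the
  span of this family is closed under differentiation.\<close>

definition cutoff :: "nat \<Rightarrow> real \<Rightarrow> real" where
  "cutoff k s = (if s > 0 then (1 / s) ^ k * exp (- (1 / s)) else 0)"

lemma cutoff_tendsto_0: "(cutoff k \<longlongrightarrow> 0) (at 0)"
proof (rule filterlim_split_at)
  have "\<forall>\<^sub>F s in at_left 0. cutoff k s = 0"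
    unfolding eventually_at_filter by (auto simp: cutoff_def)
  then show "(cutoff k \<longlongrightarrow> 0) (at_left 0)" by (rule tendsto_eventually)
  have "((\<lambda>u::real. u ^ k / exp u) \<longlongrightarrow> 0) at_top" by (rule tendsto_power_div_exp_0)
  then have "((\<lambda>s::real. inverse s ^ k / exp (inverse s)) \<longlongrightarrow> 0) (at_right 0)"
    by (rule filterlim_compose[OF _ filterlim_inverse_at_top_right])
  moreover have "\<forall>\<^sub>F s in at_right (0::real). inverse s ^ k / exp (inverse s) = cutoff k s"
    unfolding eventually_at_filter
    by (auto simp: cutoff_def exp_minus inverse_eq_divide)
  ultimately show "(cutoff k \<longlongrightarrow> 0) (at_right 0)" by (rule Lim_transform_eventually)
qed

lemma cutoff_deriv: "(cutoff k has_real_derivative - real k * cutoff (k + 1) s + cutoff (k + 2) s) (at s)"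
proof (cases s "0::real" rule: linorder_cases)
  case less
  have "((\<lambda>s. 0) has_real_derivative 0) (at s)" by simp
  then have "(cutoff k has_real_derivative 0) (at s)"
    by (rule has_field_derivative_transform_within_open[where S = "{..<0}"]) (use less in \<open>auto simp: cutoff_def\<close>)
  then show ?thesis using less by (simp add: cutoff_def)
next
  case equal
  \<comment> \<open>At 0 the difference quotient is the next member of the family, whose limit is
    already known to be 0.\<close>
  have "cutoff k h / h = cutoff (k + 1) h" for h by (simp add: cutoff_def)
  then have "((\<lambda>h. (cutoff k (0 + h) - cutoff k 0) / h) \<longlongrightarrow> 0) (at 0)"
    using cutoff_tendsto_0[of "k + 1"] by (simp add: cutoff_def[of k 0])
  then have "(cutoff k has_real_derivative 0) (at 0)" by (simp only: DERIV_def)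
  then show ?thesis using equal by (simp add: cutoff_def)
next
  case greater
  have "((\<lambda>s. (1 / s) ^ k * exp (- (1 / s))) has_real_derivative - real k * cutoff (k + 1) s + cutoff (k + 2) s) (at s)"
  proof (cases k)
    case 0
    then show ?thesis using greater
      by (auto intro!: derivative_eq_intros simp: cutoff_def power2_eq_square divide_simps)
  next
    case (Suc l)
    then show ?thesis using greater
      by (auto intro!: derivative_eq_intros simp: cutoff_def power2_eq_square divide_simps)
         (cases l; simp add: algebra_simps)
  qed
  then show ?thesis
    by (rule has_field_derivative_transform_within_open[where S = "{0<..}"]) (use greater in \<open>auto simp: cutoff_def\<close>)
qed

text \<open>A class that contains the radial cutoffs and is closed under whatever the chain and
  product rules produce. Smoothness then follows by showing that partial derivatives stay in the
  class, with no formula for higher derivatives.\<close>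

inductive_set bumps :: "real \<Rightarrow> (real^'n::finite \<Rightarrow> complex) set" for r where
  base: "(\<lambda>x. complex_of_real (cutoff k (r\<^sup>2 - (norm x)\<^sup>2))) \<in> bumps r"
| coord: "f \<in> bumps r \<Longrightarrow> (\<lambda>x. complex_of_real (x $ i) * f x) \<in> bumps r"
| scale: "f \<in> bumps r \<Longrightarrow> (\<lambda>x. a * f x) \<in> bumps r"
| add: "f \<in> bumps r \<Longrightarrow> g \<in> bumps r \<Longrightarrow> (\<lambda>x. f x + g x) \<in> bumps r"

lemma bumps_has_derivative:
  assumes "(f :: real^'n::finite \<Rightarrow> complex) \<in> bumps r"
  shows "\<exists>D. (\<forall>i. D i \<in> bumps r) \<and> (\<forall>x. (f has_derivative (\<lambda>h. \<Sum>i\<in>UNIV. (h $ i) *\<^sub>R D i x)) (at x))"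
  using assms
proof (induction rule: bumps.induct)
  case (base k)
  let ?q = "\<lambda>x::real^'n. r\<^sup>2 - (norm x)\<^sup>2"
  let ?d = "\<lambda>x. - complex_of_real (real k) * complex_of_real (cutoff (k + 1) (?q x)) + complex_of_real (cutoff (k + 2) (?q x))"
  define D where "D i = (\<lambda>x. (- 2) * (complex_of_real (x $ i) * ?d x))" for i
  have "D i \<in> bumps r" for i
    unfolding D_def by (intro bumps.intros)
  moreover have "((\<lambda>x. complex_of_real (cutoff k (?q x))) has_derivative (\<lambda>h. \<Sum>i\<in>UNIV. (h $ i) *\<^sub>R D i x)) (at x)" for x
  proof -
    have "(?q has_derivative (\<lambda>h. - (2 * (x \<bullet> h)))) (at x)"
      unfolding power2_norm_eq_inner by (auto intro!: derivative_eq_intros simp: inner_commute)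
    from has_derivative_compose[OF this cutoff_deriv[of k "?q x", unfolded has_field_derivative_def]]
    have "((\<lambda>x. complex_of_real (cutoff k (?q x))) has_derivative
        (\<lambda>h. complex_of_real ((- real k * cutoff (k + 1) (?q x) + cutoff (k + 2) (?q x)) * - (2 * (x \<bullet> h))))) (at x)"
      by (rule has_derivative_of_real)
    moreover have "(\<Sum>i\<in>UNIV. (h $ i) *\<^sub>R D i x) = complex_of_real ((- real k * cutoff (k + 1) (?q x) + cutoff (k + 2) (?q x)) * - (2 * (x \<bullet> h)))" for h
    proof -
      have "(\<Sum>i\<in>UNIV. (h $ i) *\<^sub>R D i x) = (\<Sum>i\<in>UNIV. (- 2 * ?d x) * complex_of_real (x $ i * h $ i))"
        unfolding D_def by (intro sum.cong refl) (simp add: scaleR_conv_of_real[of _ "_ :: complex"] algebra_simps)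
      also have "\<dots> = (- 2 * ?d x) * complex_of_real (x \<bullet> h)"
        by (simp only: inner_vec_def inner_real_def of_real_sum sum_distrib_left)
      also have "?d x = complex_of_real (- real k * cutoff (k + 1) (?q x) + cutoff (k + 2) (?q x))" by simp
      finally show ?thesis by (simp only: of_real_mult of_real_minus of_real_numeral mult_minus_left mult_minus_right mult_ac)
    qed
    ultimately show ?thesis by simp
  qed
  ultimately show ?case by blast
next
  case (coord f j)
  then obtain D where D: "\<And>i. D i \<in> bumps r" "\<And>x. (f has_derivative (\<lambda>h. \<Sum>i\<in>UNIV. (h $ i) *\<^sub>R D i x)) (at x)" by blast
  define E where "E i = (\<lambda>x. (if i = j then 1 else 0) * f x + complex_of_real (x $ j) * D i x)" for i
  have "E i \<in> bumps r" for i unfolding E_def by (intro bumps.intros coord D)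
  moreover have "((\<lambda>x. complex_of_real (x $ j) * f x) has_derivative (\<lambda>h. \<Sum>i\<in>UNIV. (h $ i) *\<^sub>R E i x)) (at x)" for x
  proof -
    have "((\<lambda>x. complex_of_real (x $ j)) has_derivative (\<lambda>h. complex_of_real (h $ j))) (at x)"
      by (intro has_derivative_of_real bounded_linear_imp_has_derivative bounded_linear_vec_nth)
    from has_derivative_mult[OF this D(2)]
    have "((\<lambda>x. complex_of_real (x $ j) * f x) has_derivative
      (\<lambda>h. complex_of_real (x $ j) * (\<Sum>i\<in>UNIV. (h $ i) *\<^sub>R D i x) + complex_of_real (h $ j) * f x)) (at x)" .
    moreover have "(\<Sum>i\<in>UNIV. (h $ i) *\<^sub>R E i x) = complex_of_real (x $ j) * (\<Sum>i\<in>UNIV. (h $ i) *\<^sub>R D i x) + complex_of_real (h $ j) * f x" for h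
    proof -
      have "(\<Sum>i\<in>UNIV. (h $ i) *\<^sub>R E i x) = (\<Sum>i\<in>UNIV. (if i = j then complex_of_real (h $ i) * f x else 0) + complex_of_real (x $ j) * ((h $ i) *\<^sub>R D i x))"
        unfolding E_def by (intro sum.cong refl) (simp add: scaleR_add_right scaleR_conv_of_real[of _ "_ :: complex"] algebra_simps)
      then show ?thesis by (simp add: sum.distrib sum_distrib_left)
    qed
    ultimately show ?thesis by simp
  qed
  ultimately show ?case by blast
next
  case (scale f a)
  then obtain D where D: "\<And>i. D i \<in> bumps r" "\<And>x. (f has_derivative (\<lambda>h. \<Sum>i\<in>UNIV. (h $ i) *\<^sub>R D i x)) (at x)" by blast
  have "((\<lambda>x. a * f x) has_derivative (\<lambda>h. \<Sum>i\<in>UNIV. (h $ i) *\<^sub>R (a * D i x))) (at x)" for x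
    using has_derivative_mult_right[OF D(2), of a x] by (simp add: sum_distrib_left)
  then show ?case using D(1) by (intro exI[of _ "\<lambda>i x. a * D i x"]) (auto intro: bumps.intros)
next
  case (add f g)
  then obtain D where D: "\<And>i. D i \<in> bumps r" "\<And>x. (f has_derivative (\<lambda>h. \<Sum>i\<in>UNIV. (h $ i) *\<^sub>R D i x)) (at x)" by blast
  from add obtain E where E: "\<And>i. E i \<in> bumps r" "\<And>x. (g has_derivative (\<lambda>h. \<Sum>i\<in>UNIV. (h $ i) *\<^sub>R E i x)) (at x)" by blast
  have "((\<lambda>x. f x + g x) has_derivative (\<lambda>h. \<Sum>i\<in>UNIV. (h $ i) *\<^sub>R (D i x + E i x))) (at x)" for x
    using has_derivative_add[OF D(2) E(2), of x] by (simp add: scaleR_add_right sum.distrib)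
  then show ?case using D(1) E(1) by (intro exI[of _ "\<lambda>i x. D i x + E i x"]) (auto intro: bumps.intros)
qed

lemma bumps_smooth:
  assumes "f \<in> bumps r"
  shows "iter_deriv w f \<in> bumps r" and "smooth f"
proof -
  show *: "iter_deriv w f \<in> bumps r" for w
  proof (induction w)
    case (Cons i w)
    obtain D where D: "\<And>i. D i \<in> bumps r" "\<And>x. (iter_deriv w f has_derivative (\<lambda>h. \<Sum>i\<in>UNIV. (h $ i) *\<^sub>R D i x)) (at x)"
      using bumps_has_derivative[OF Cons] by blast
    have "partial_deriv i (iter_deriv w f) = D i" using partial_deriv_unique[OF D(2)] by blast
    then show ?case using D(1) by (simp add: iter_deriv_Cons)
  qed (simp add: assms)
  show "smooth f"
    unfolding smooth_def differentiable_on_def differentiable_def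
    using bumps_has_derivative[OF *] by (meson has_derivative_at_withinI)
qed

lemma bumps_support:
  assumes "f \<in> bumps r" "norm x \<ge> \<bar>r\<bar>" shows "f x = 0"
  using assms
proof (induction rule: bumps.induct)
  case (base k)
  then have "r\<^sup>2 \<le> (norm x)\<^sup>2" using abs_le_square_iff[of r "norm x"] by simp
  then show ?case by (simp add: cutoff_def)
qed auto

lemma integrable_compact_support:
  fixes f :: "real^'n::finite \<Rightarrow> complex"
  assumes "continuous_on UNIV f" "compact K" "\<And>x. x \<notin> K \<Longrightarrow> f x = 0"
  shows "integrable lborel f"
proof -
  have "integrable lborel (\<lambda>x. indicator K x *\<^sub>R f x)"
    by (rule borel_integrable_compact) (use assms(2) continuous_on_subset[OF assms(1)] in auto)
  also have "(\<lambda>x. indicator K x *\<^sub>R f x) = f" using assms(3) by (auto simp: indicator_def)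
  finally show ?thesis .
qed

lemma bumps_DL1:
  assumes f: "f \<in> bumps r" shows "f \<in> DL1"
proof -
  have "iter_deriv w f x = 0" if "x \<notin> cball 0 \<bar>r\<bar>" for w x
    using bumps_support[OF bumps_smooth(1)[OF f]] that by simp
  then have "integrable lborel (iter_deriv w f)" for w
    by (rule integrable_compact_support[OF smooth_continuous[OF bumps_smooth(2)[OF f]] compact_cball])
  then show ?thesis by (simp add: DL1_def bumps_smooth(2)[OF f])
qed

lemma iter_deriv_vanishes_open:
  fixes f :: "real^'n::finite \<Rightarrow> complex"
  assumes "open U" "\<And>x. x \<in> U \<Longrightarrow> f x = 0" "x \<in> U"
  shows "iter_deriv w f x = 0"
  using assms(3)
proof (induction w arbitrary: x)
  case (Cons i w)
  have "((\<lambda>x. 0) has_derivative (\<lambda>h. 0)) (at x)" by simp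
  then have "(iter_deriv w f has_derivative (\<lambda>h. 0)) (at x)"
    by (rule has_derivative_transform_within_open[OF _ assms(1) Cons.prems]) (use Cons.IH in simp)
  then have "frechet_derivative (iter_deriv w f) (at x) = (\<lambda>h. 0)" by (rule frechet_derivative_at[symmetric])
  then show ?case by (simp add: iter_deriv_Cons partial_deriv_def)
qed (use assms(2) in simp)

lemma test_functions_DL1:
  assumes \<phi>: "\<phi> \<in> test_functions" shows "\<phi> \<in> DL1"
proof -
  define K where "K = closure {x. \<phi> x \<noteq> 0}"
  have s: "smooth \<phi>" and K: "compact K" using \<phi> by (auto simp: test_functions_def K_def)
  have z: "\<phi> x = 0" if "x \<in> - K" for x
    using that closure_subset[of "{x. \<phi> x \<noteq> 0}"] unfolding K_def by blast
  have "iter_deriv w \<phi> x = 0" if "x \<notin> K" for w x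
    by (rule iter_deriv_vanishes_open[of "- K" \<phi>]) (use z that compact_imp_closed[OF K] in auto)
  then have "integrable lborel (iter_deriv w \<phi>)" for w
    by (rule integrable_compact_support[OF smooth_continuous[OF s] K])
  then show ?thesis using s by (simp add: DL1_def)
qed

definition bump :: "real \<Rightarrow> real^'n::finite \<Rightarrow> complex" where
  "bump r x = complex_of_real (1 / (LINT y::real^'n|lborel. cutoff 0 (r\<^sup>2 - (norm y)\<^sup>2))) * complex_of_real (cutoff 0 (r\<^sup>2 - (norm x)\<^sup>2))"

lemma bump_bumps: "bump r \<in> bumps r"
  unfolding bump_def[abs_def] by (intro bumps.intros)

lemma bump_DL1: "bump r \<in> DL1"
  by (rule bumps_DL1[OF bump_bumps])

lemma bump_measurable [measurable]: "bump r \<in> borel_measurable borel"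
  using borel_measurable_integrable[OF DL1_integrable0[OF bump_DL1[of r]]] by simp

lemma bump_support: "r > 0 \<Longrightarrow> norm x \<ge> r \<Longrightarrow> bump r x = 0"
  using bumps_support[OF bump_bumps, of r x] by simp

lemma bump_uminus [simp]: "bump r (- x) = bump r x"
  by (simp add: bump_def)

text \<open>The normalising integral is nonzero since the cutoff is positive on the open ball, which
  is not negligible.\<close>

lemma bump_integral:
  assumes r: "r > 0"
  shows "(LINT x::real^'n::finite|lborel. bump r x) = 1" and "L1_norm (bump r :: real^'n \<Rightarrow> complex) = 1"
proof -
  let ?f = "\<lambda>x::real^'n. cutoff 0 (r\<^sup>2 - (norm x)\<^sup>2)"
  have nn: "?f x \<ge> 0" for x by (simp add: cutoff_def)
  have "integrable lborel (\<lambda>x. complex_of_real (?f x))" by (intro DL1_integrable0 bumps_DL1[of _ r] bumps.base)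
  from integrable_Re[OF this] have int: "integrable lborel ?f" by simp
  let ?c = "LINT x|lborel. ?f x"
  have "?c \<noteq> 0"
  proof
    assume "?c = 0"
    then have "AE x in lborel. ?f x = 0" using integral_nonneg_eq_0_iff_AE[OF int] nn by simp
    then have "AE x in lborel. x \<notin> ball (0::real^'n) r"
    proof eventually_elim
      case (elim x)
      show ?case
      proof
        assume "x \<in> ball 0 r"
        then have "(norm x)\<^sup>2 < r\<^sup>2" by (intro power_strict_mono) auto
        with elim show False by (simp add: cutoff_def)
      qed
    qed
    then have "ball (0::real^'n) r \<in> null_sets lborel"
      by (subst AE_iff_null_sets) auto
    then have "negligible (ball (0::real^'n) r)"
      by (simp add: negligible_iff_null_sets null_sets_completionI)
    then show False using open_not_negligible[of "ball (0::real^'n) r"] r by auto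
  qed
  then have c: "?c > 0" using integral_nonneg_AE[of ?f lborel] nn by (simp add: less_le)
  show "(LINT x::real^'n|lborel. bump r x) = 1"
    unfolding bump_def integral_mult_right_zero integral_complex_of_real using c by (simp flip: of_real_mult)
  have "L1_norm (bump r :: real^'n \<Rightarrow> complex) = (LINT x|lborel. (1 / ?c) * ?f x)"
    unfolding L1_norm_def bump_def norm_mult norm_of_real using c nn by simp
  then show "L1_norm (bump r :: real^'n \<Rightarrow> complex) = 1" using c by simp
qed

section \<open>Mollification\<close>

text \<open>The convolution with \<psi> as weight and the bump as averaged function. In this form
  all derivatives fall on the bump, so an integrable \<psi> is mapped into \<open>DL1\<close> with
  bounds by its L^1 norm alone. \<open>mollify_eq\<close> gives the form with the roles
  exchanged.\<close>

definition mollify :: "real \<Rightarrow> (real^'n::finite \<Rightarrow> complex) \<Rightarrow> real^'n \<Rightarrow> complex" where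
  "mollify r \<psi> = avg \<psi> uminus (bump r)"

lemma averaging_uminus: "integrable lborel \<psi> \<Longrightarrow> averaging \<psi> uminus"
  by unfold_locales auto

lemma mollify_DL1: "integrable lborel \<psi> \<Longrightarrow> mollify r \<psi> \<in> DL1"
  unfolding mollify_def
  by (rule averaging.avg_DL1[OF averaging_uminus DL1_bdd_smooth[OF bump_DL1] bump_DL1])

lemma DL1_norm_mollify:
  fixes \<psi> :: "real^'n::finite \<Rightarrow> complex"
  assumes "integrable lborel \<psi>"
  shows "DL1_norm m (mollify r \<psi>) \<le> L1_norm \<psi> * DL1_norm m (bump r :: real^'n \<Rightarrow> complex)"
proof -
  interpret averaging \<psi> "uminus :: real^'n \<Rightarrow> real^'n" by (rule averaging_uminus[OF assms])
  show ?thesis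
    using DL1_norm_avg[OF DL1_bdd_smooth[OF bump_DL1] bump_DL1] by (simp add: mollify_def mass_def L1_norm_def)
qed

lemma averaging_bump: "averaging (bump r :: real^'n::finite \<Rightarrow> complex) (\<lambda>z. z)"
  by unfold_locales (use DL1_integrable0[OF bump_DL1] in auto)

text \<open>A change of variable together with the evenness of the bump. As an average with the bump
  as weight, mollification can be compared with the identity.\<close>

lemma mollify_eq:
  fixes \<psi> :: "real^'n::finite \<Rightarrow> complex"
  assumes "\<psi> \<in> borel_measurable borel"
  shows "mollify r \<psi> = avg (bump r) (\<lambda>z. z) \<psi>"
proof
  fix x :: "real^'n"
  have "mollify r \<psi> x = (LINT y|lborel. (\<lambda>z. bump r z * \<psi> (x + z)) (y + (- x)))"
    using bump_uminus[of r "x - _"] by (simp add: mollify_def avg_def mult.commute)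
  also have "\<dots> = (LINT z|lborel. bump r z * \<psi> (x + z))" by (rule lborel_translation(1))
  also have "\<dots> = avg (bump r) (\<lambda>z. z) \<psi> x" by (simp add: avg_def)
  finally show "mollify r \<psi> x = avg (bump r) (\<lambda>z. z) \<psi> x" .
qed

text \<open>The bump has mass 1 and vanishes for shifts of length at least \<open>r\<close>, so the
  error averages translation differences by less than \<open>r\<close>. Each of these costs one
  derivative, hence \<open>Suc m\<close>.\<close>

lemma mollify_approx:
  fixes \<psi> :: "real^'n::finite \<Rightarrow> complex"
  assumes \<psi>: "\<psi> \<in> DL1" and r: "r > 0"
  shows "DL1_norm m (\<lambda>x. mollify r \<psi> x - \<psi> x) \<le> real CARD('n) * r * DL1_norm (Suc m) \<psi>"
proof (rule DL1_norm_least)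
  fix w :: "'n list" assume w: "length w \<le> m"
  interpret averaging "bump r :: real^'n \<Rightarrow> complex" "\<lambda>z. z" by (rule averaging_bump)
  let ?f = "iter_deriv w \<psi>"
  let ?b = "bump r :: real^'n \<Rightarrow> complex"
  have bs: "bdd_smooth \<psi>" by (rule DL1_bdd_smooth[OF \<psi>])
  have M: "mollify r \<psi> = avg ?b (\<lambda>z. z) \<psi>" using DL1_integrable0[OF \<psi>] by (intro mollify_eq) auto
  have f: "?f \<in> borel_measurable borel" "bounded (range ?f)" "integrable lborel ?f"
    using bs DL1_integrable[OF \<psi>] by (auto simp: bdd_smooth_def smooth_measurable)
  have b: "integrable lborel ?b" by (rule DL1_integrable0[OF bump_DL1])
  have "iter_deriv w (\<lambda>x. mollify r \<psi> x - \<psi> x) = (\<lambda>x. avg ?b (\<lambda>z. z) ?f x - ?f x)"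
    unfolding M using avg_smooth[OF bs] DL1_smooth[OF \<psi>] by (simp add: iter_deriv_diff bdd_smooth_def)
  also have "\<dots> = (\<lambda>x. LINT z|lborel. ?b z * (?f (x + z) - ?f x))"
  proof
    fix x
    have "(LINT z|lborel. ?b z * (?f (x + z) - ?f x)) = (LINT z|lborel. ?b z * ?f (x + z) - ?b z * ?f x)"
      by (simp add: right_diff_distrib)
    also have "\<dots> = avg ?b (\<lambda>z. z) ?f x - (LINT z|lborel. ?b z * ?f x)"
      unfolding avg_def by (rule Bochner_Integration.integral_diff) (use bounded_integrable[OF f(1,2)] b in auto)
    finally show "avg ?b (\<lambda>z. z) ?f x - ?f x = (LINT z|lborel. ?b z * (?f (x + z) - ?f x))"
      using bump_integral(1)[OF r, where 'n='n] by simp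
  qed
  finally have eq: "iter_deriv w (\<lambda>x. mollify r \<psi> x - \<psi> x) = (\<lambda>x. LINT z|lborel. ?b z * (?f (x + z) - ?f x))" .
  \<comment> \<open>The product of the bump and \<open>?f\<close> is the instance of
    \<open>pair_integrable\<close> with shift constantly 0.\<close>
  have int2: "integrable (lborel \<Otimes>\<^sub>M lborel) (\<lambda>(z, x). ?b z * ?f x)"
    using averaging.pair_integrable[of ?b "\<lambda>_. 0", OF _ f(3)] b by (simp add: averaging_def)
  have int: "integrable (lborel \<Otimes>\<^sub>M lborel) (\<lambda>(z, x). ?b z * (?f (x + z) - ?f x))"
    using Bochner_Integration.integrable_diff[OF pair_integrable[OF f(3)] int2]
    by (simp add: case_prod_unfold right_diff_distrib)
  have "L1_norm (\<lambda>x. LINT z|lborel. ?b z * (?f (x + z) - ?f x)) \<le> (LINT z|lborel. L1_norm (\<lambda>x. ?b z * (?f (x + z) - ?f x)))"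
    by (rule L1_norm_integral_le[OF int])
  also have "\<dots> \<le> (LINT z|lborel. cmod (?b z) * (real CARD('n) * r * DL1_norm (Suc m) \<psi>))"
  proof (rule integral_mono_AE')
    show "integrable lborel (\<lambda>z. cmod (?b z) * (real CARD('n) * r * DL1_norm (Suc m) \<psi>))" using b by simp
    have "L1_norm (\<lambda>x. ?b z * (?f (x + z) - ?f x)) \<le> cmod (?b z) * (real CARD('n) * r * DL1_norm (Suc m) \<psi>)" for z
    proof (cases "norm z \<ge> r")
      case True
      then have "?b z = 0" by (rule bump_support[OF r])
      then show ?thesis by (simp add: L1_norm_def)
    next
      case False
      have "L1_norm (\<lambda>x. ?f (x + z) - ?f x) \<le> real CARD('n) * norm z * DL1_norm (Suc (length w)) \<psi>"
        by (rule DL1_translate_le[OF \<psi>])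
      also have "\<dots> \<le> real CARD('n) * r * DL1_norm (Suc m) \<psi>"
        using False w r by (intro mult_mono DL1_norm_mono) auto
      finally show ?thesis unfolding L1_norm_scale by (rule mult_left_mono) simp
    qed
    then show "AE z in lborel. L1_norm (\<lambda>x. ?b z * (?f (x + z) - ?f x)) \<le> cmod (?b z) * (real CARD('n) * r * DL1_norm (Suc m) \<psi>)"
      by simp
  qed (use r in auto)
  also have "\<dots> = real CARD('n) * r * DL1_norm (Suc m) \<psi>"
    using bump_integral(2)[OF r, where 'n='n] by (simp add: L1_norm_def)
  finally show "L1_norm (iter_deriv w (\<lambda>x. mollify r \<psi> x - \<psi> x)) \<le> real CARD('n) * r * DL1_norm (Suc m) \<psi>"
    unfolding eq .
qed

section \<open>Functionals and averages\<close>

lemma iter_deriv_shift: "\<phi> \<in> DL1 \<Longrightarrow> iter_deriv w (\<lambda>x. \<phi> (x + a)) = (\<lambda>x. iter_deriv w \<phi> (x + a))"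
  by (rule smooth_shift(2)[OF DL1_smooth])

lemma DL1_norm_shift: "\<phi> \<in> DL1 \<Longrightarrow> DL1_norm m (\<lambda>x. \<phi> (x + a)) \<le> DL1_norm m \<phi>"
  by (rule DL1_norm_least) (simp add: iter_deriv_shift L1_norm_le_DL1_norm)

lemma L1_norm_shift_diff:
  fixes \<phi> :: "real^'n::finite \<Rightarrow> complex"
  assumes \<phi>: "\<phi> \<in> DL1"
  shows "L1_norm (\<lambda>x. iter_deriv w \<phi> (x + u) - iter_deriv w \<phi> (x + v)) \<le> real CARD('n) * norm (u - v) * DL1_norm (Suc (length w)) \<phi>"
proof -
  have "L1_norm (\<lambda>x. iter_deriv w \<phi> (x + u) - iter_deriv w \<phi> (x + v)) = L1_norm (\<lambda>x. (\<lambda>x. iter_deriv w \<phi> (x + (u - v)) - iter_deriv w \<phi> x) (x + v))"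
    by (simp add: algebra_simps)
  also have "\<dots> = L1_norm (\<lambda>x. iter_deriv w \<phi> (x + (u - v)) - iter_deriv w \<phi> x)" by (rule L1_norm_shift)
  finally show ?thesis using DL1_translate_le[OF \<phi>, of w "u - v"] by simp
qed

lemma DL1_norm_shift_diff:
  fixes \<phi> :: "real^'n::finite \<Rightarrow> complex"
  assumes \<phi>: "\<phi> \<in> DL1"
  shows "DL1_norm m (\<lambda>x. \<phi> (x + u) - \<phi> (x + v)) \<le> real CARD('n) * norm (u - v) * DL1_norm (Suc m) \<phi>"
proof (rule DL1_norm_least)
  fix w :: "'n list" assume w: "length w \<le> m"
  have "L1_norm (iter_deriv w (\<lambda>x. \<phi> (x + u) - \<phi> (x + v))) \<le> real CARD('n) * norm (u - v) * DL1_norm (Suc (length w)) \<phi>"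
    using L1_norm_shift_diff[OF \<phi>, of w u v] \<phi>
    by (simp add: iter_deriv_diff iter_deriv_shift DL1_smooth DL1_shift)
  also have "\<dots> \<le> real CARD('n) * norm (u - v) * DL1_norm (Suc m) \<phi>"
    using w by (intro mult_left_mono DL1_norm_mono) auto
  finally show "L1_norm (iter_deriv w (\<lambda>x. \<phi> (x + u) - \<phi> (x + v))) \<le> real CARD('n) * norm (u - v) * DL1_norm (Suc m) \<phi>" .
qed

text \<open>If the functional has order \<open>m\<close>, its values along translates are even
  Lipschitz, the constant involving one more derivative of \<phi>.\<close>

lemma dual_translate_continuous:
  fixes \<phi> :: "real^'n::finite \<Rightarrow> complex"
  assumes S: "S \<in> DL1_dual" and \<phi>: "\<phi> \<in> DL1"
  shows "continuous_on UNIV (\<lambda>v. S (\<lambda>x. \<phi> (x + v)))" and "bounded (range (\<lambda>v. S (\<lambda>x. \<phi> (x + v))))"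
proof -
  obtain c m where c: "c > 0" "\<And>\<phi>. \<phi> \<in> DL1 \<Longrightarrow> cmod (S \<phi>) \<le> c * DL1_norm m \<phi>"
    using DL1_dual_bound[OF S] by metis
  have "cmod (S (\<lambda>x. \<phi> (x + v))) \<le> c * DL1_norm m \<phi>" for v
    using c(2)[OF DL1_shift[OF \<phi>], of v] mult_left_mono[OF DL1_norm_shift[OF \<phi>], of c m v] c(1) by linarith
  then show "bounded (range (\<lambda>v. S (\<lambda>x. \<phi> (x + v))))" by (auto simp: bounded_iff)
  define L where "L = c * (real CARD('n) * DL1_norm (Suc m) \<phi>)"
  have L: "dist (S (\<lambda>x. \<phi> (x + u))) (S (\<lambda>x. \<phi> (x + v))) \<le> L * dist u v" for u v
  proof -
    have "S (\<lambda>x. \<phi> (x + u)) - S (\<lambda>x. \<phi> (x + v)) = S (\<lambda>x. \<phi> (x + u) - \<phi> (x + v))"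
      by (rule DL1_dual_diff[OF S DL1_shift[OF \<phi>] DL1_shift[OF \<phi>], symmetric])
    then have "dist (S (\<lambda>x. \<phi> (x + u))) (S (\<lambda>x. \<phi> (x + v))) \<le> c * DL1_norm m (\<lambda>x. \<phi> (x + u) - \<phi> (x + v))"
      using c(2)[OF DL1_diff[OF DL1_shift[OF \<phi>] DL1_shift[OF \<phi>]]] by (simp add: dist_norm)
    also have "\<dots> \<le> c * (real CARD('n) * norm (u - v) * DL1_norm (Suc m) \<phi>)"
      using c(1) by (intro mult_left_mono DL1_norm_shift_diff \<phi>) auto
    finally show ?thesis by (simp add: L_def dist_norm mult_ac)
  qed
  have "L-lipschitz_on UNIV (\<lambda>v. S (\<lambda>x. \<phi> (x + v)))"
    using L c(1) by (intro lipschitz_onI) (auto simp: L_def)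
  then show "continuous_on UNIV (\<lambda>v. S (\<lambda>x. \<phi> (x + v)))" by (rule lipschitz_on_continuous_on)
qed

section \<open>Exchanging a functional with an average\<close>

context averaging
begin

lemma simple_integral_sum:
  assumes T: "simple_function lborel T"
  shows "(LINT \<omega>|lborel. W \<omega> * h (T \<omega>)) = (\<Sum>v\<in>range T. (LINT \<omega>|lborel. indicator (T -` {v}) \<omega> *\<^sub>R W \<omega>) * h v)"
proof -
  have fin: "finite (range T)" and m: "T -` {v} \<in> sets lborel" for v
    using simple_functionD[OF T] by auto
  have int: "integrable lborel (\<lambda>\<omega>. indicator (T -` {v}) \<omega> *\<^sub>R W \<omega>)" for v
    using integrable_mult_indicator[OF m W] .
  have "W \<omega> * h (T \<omega>) = (\<Sum>v\<in>range T. (indicator (T -` {v}) \<omega> *\<^sub>R W \<omega>) * h v)" for \<omega>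
  proof -
    have "(\<Sum>v\<in>range T. (indicator (T -` {v}) \<omega> *\<^sub>R W \<omega>) * h v) = (\<Sum>v\<in>range T. if v = T \<omega> then W \<omega> * h v else 0)"
      by (intro sum.cong refl) (auto simp: indicator_def)
    then show ?thesis using fin by simp
  qed
  then have "(LINT \<omega>|lborel. W \<omega> * h (T \<omega>)) = (\<Sum>v\<in>range T. LINT \<omega>|lborel. (indicator (T -` {v}) \<omega> *\<^sub>R W \<omega>) * h v)"
    using int by (simp only:) (rule Bochner_Integration.integral_sum, rule integrable_mult_left)
  then show ?thesis by (simp only: integral_mult_left_zero)
qed

lemma dual_avg_simple:
  assumes S: "S \<in> DL1_dual" and \<phi>: "\<phi> \<in> DL1" and T: "simple_function lborel T"
  shows "S (avg W T \<phi>) = (LINT \<omega>|lborel. W \<omega> * S (\<lambda>x. \<phi> (x + T \<omega>)))"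
proof -
  let ?c = "\<lambda>v. LINT \<omega>|lborel. indicator (T -` {v}) \<omega> *\<^sub>R W \<omega>"
  have fin: "finite (range T)" using simple_functionD[OF T] by auto
  have "avg W T \<phi> = (\<lambda>x. \<Sum>v\<in>range T. ?c v * \<phi> (x + v))"
    unfolding avg_def by (intro ext simple_integral_sum[OF T])
  then have "S (avg W T \<phi>) = (\<Sum>v\<in>range T. S (\<lambda>x. ?c v * \<phi> (x + v)))"
    using DL1_dual_sum[OF S fin] DL1_scale[OF DL1_shift[OF \<phi>]] by simp
  also have "\<dots> = (\<Sum>v\<in>range T. ?c v * S (\<lambda>x. \<phi> (x + v)))"
    by (intro sum.cong refl DL1_dual_scale[OF S] DL1_shift[OF \<phi>])
  also have "\<dots> = (LINT \<omega>|lborel. W \<omega> * S (\<lambda>x. \<phi> (x + T \<omega>)))"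
    using simple_integral_sum[OF T, of "\<lambda>v. S (\<lambda>x. \<phi> (x + v))"] by simp
  finally show ?thesis .
qed

text \<open>For a shift with finitely many values this is linearity. In general the shift is
  approximated pointwise by simple functions; the averages then converge in the one seminorm that
  bounds \<open>S\<close>, and no integral with values in \<open>DL1\<close> has to be
  defined.\<close>

theorem dual_avg:
  assumes S: "S \<in> DL1_dual" and \<phi>: "\<phi> \<in> DL1"
  shows "S (avg W Y \<phi>) = (LINT \<omega>|lborel. W \<omega> * S (\<lambda>x. \<phi> (x + Y \<omega>)))"
proof -
  let ?h = "\<lambda>v. S (\<lambda>x. \<phi> (x + v))"
  note bs = DL1_bdd_smooth[OF \<phi>]
  obtain c m where c: "c > 0" "\<And>\<phi>. \<phi> \<in> DL1 \<Longrightarrow> cmod (S \<phi>) \<le> c * DL1_norm m \<phi>"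
    using DL1_dual_bound[OF S] by metis
  obtain b where b: "\<And>v. cmod (?h v) \<le> b"
    using dual_translate_continuous(2)[OF S \<phi>] by (auto simp: bounded_iff)
  have hc: "continuous_on UNIV ?h" by (rule dual_translate_continuous(1)[OF S \<phi>])
  have [measurable]: "?h \<in> borel_measurable borel" by (rule borel_measurable_continuous_onI[OF hc])
  have "Y \<in> borel_measurable lborel" by simp
  from borel_measurable_implies_sequence_metric[OF this, of 0] obtain T where
    T: "\<And>j. simple_function lborel (T j)" "\<And>\<omega>. (\<lambda>j. T j \<omega>) \<longlonglongrightarrow> Y \<omega>" by auto
  have [measurable]: "T j \<in> borel_measurable borel" for j using borel_measurable_simple_function[OF T(1)] by simp
  have AT: "averaging W (T j)" for j by unfold_locales (use W in auto)
  define D where "D = real CARD('n) * DL1_norm (Suc m) \<phi>"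
  \<comment> \<open>The first entry of the minimum gives pointwise convergence to 0, the second an
    integrable majorant that is uniform in \<open>j\<close>.\<close>
  define d where "d j \<omega> = cmod (W \<omega>) * min (D * norm (T j \<omega> - Y \<omega>)) (2 * DL1_norm m \<phi>)" for j \<omega>
  have D0: "D \<ge> 0" by (simp add: D_def)
  have lim1: "(\<lambda>j. LINT \<omega>|lborel. W \<omega> * ?h (T j \<omega>)) \<longlonglongrightarrow> (LINT \<omega>|lborel. W \<omega> * ?h (Y \<omega>))"
  proof (rule integral_dominated_convergence[where w = "\<lambda>\<omega>. cmod (W \<omega>) * b"])
    show "AE \<omega> in lborel. (\<lambda>j. W \<omega> * ?h (T j \<omega>)) \<longlonglongrightarrow> W \<omega> * ?h (Y \<omega>)"
      by (intro AE_I2 tendsto_mult tendsto_const continuous_on_tendsto_compose[OF hc T(2)]) auto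
    show "AE \<omega> in lborel. norm (W \<omega> * ?h (T j \<omega>)) \<le> cmod (W \<omega>) * b" for j
      using b by (intro AE_I2) (simp add: norm_mult mult_left_mono)
    show "(\<lambda>\<omega>. W \<omega> * ?h (Y \<omega>)) \<in> borel_measurable lborel"
      using measurable_compose[OF Y, of ?h borel] by measurable
    show "(\<lambda>\<omega>. W \<omega> * ?h (T j \<omega>)) \<in> borel_measurable lborel" for j
      using measurable_compose[of "T j" borel borel ?h borel] by measurable
  qed (use W in simp)
  have d_le: "norm (d j \<omega>) \<le> cmod (W \<omega>) * (2 * DL1_norm m \<phi>)" for j \<omega>
    using D0 unfolding d_def by (auto simp: abs_mult abs_of_nonneg intro!: mult_left_mono)
  have d_int: "integrable lborel (d j)" for j
  proof (rule Bochner_Integration.integrable_bound)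
    show "integrable lborel (\<lambda>\<omega>. cmod (W \<omega>) * (2 * DL1_norm m \<phi>))" using W by simp
    show "AE \<omega> in lborel. norm (d j \<omega>) \<le> norm (cmod (W \<omega>) * (2 * DL1_norm m \<phi>))"
      unfolding real_norm_def[of "_ * _"] by (intro AE_I2 order_trans[OF d_le] abs_ge_self)
    show "d j \<in> borel_measurable lborel" unfolding d_def[abs_def] by measurable
  qed
  have lim2: "(\<lambda>j. LINT \<omega>|lborel. d j \<omega>) \<longlonglongrightarrow> (LINT \<omega>::'a|lborel. 0)"
  proof (rule integral_dominated_convergence[where w = "\<lambda>\<omega>. cmod (W \<omega>) * (2 * DL1_norm m \<phi>)"])
    show "AE \<omega> in lborel. (\<lambda>j. d j \<omega>) \<longlonglongrightarrow> 0"
    proof (intro AE_I2)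
      fix \<omega>
      have "(\<lambda>j. d j \<omega>) \<longlonglongrightarrow> cmod (W \<omega>) * min (D * norm (Y \<omega> - Y \<omega>)) (2 * DL1_norm m \<phi>)"
        unfolding d_def by (intro tendsto_intros T(2))
      then show "(\<lambda>j. d j \<omega>) \<longlonglongrightarrow> 0" by simp
    qed
    show "AE \<omega> in lborel. norm (d j \<omega>) \<le> cmod (W \<omega>) * (2 * DL1_norm m \<phi>)" for j using d_le by simp
  qed (use W d_int in auto)
  have est: "DL1_norm m (\<lambda>x. avg W (T j) \<phi> x - avg W Y \<phi> x) \<le> (LINT \<omega>|lborel. d j \<omega>)" for j
  proof (rule DL1_norm_least)
    fix w :: "'n list" assume w: "length w \<le> m"
    interpret T: averaging W "T j" by (rule AT)
    let ?f = "iter_deriv w \<phi>"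
    have f: "?f \<in> borel_measurable borel" "bounded (range ?f)" "integrable lborel ?f"
      using bs DL1_integrable[OF \<phi>] by (auto simp: bdd_smooth_def smooth_measurable)
    have "iter_deriv w (\<lambda>x. avg W (T j) \<phi> x - avg W Y \<phi> x) = (\<lambda>x. avg W (T j) ?f x - avg W Y ?f x)"
      using avg_smooth[OF bs] T.avg_smooth[OF bs] by (simp add: iter_deriv_diff bdd_smooth_def)
    also have "\<dots> = (\<lambda>x. LINT \<omega>|lborel. W \<omega> * (?f (x + T j \<omega>) - ?f (x + Y \<omega>)))"
      unfolding avg_def right_diff_distrib
      by (intro ext Bochner_Integration.integral_diff[symmetric] bounded_integrable T.bounded_integrable f)
    finally have eq: "iter_deriv w (\<lambda>x. avg W (T j) \<phi> x - avg W Y \<phi> x) = (\<lambda>x. LINT \<omega>|lborel. W \<omega> * (?f (x + T j \<omega>) - ?f (x + Y \<omega>)))" .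
    have int: "integrable (lborel \<Otimes>\<^sub>M lborel) (\<lambda>(\<omega>, x). W \<omega> * (?f (x + T j \<omega>) - ?f (x + Y \<omega>)))"
      using Bochner_Integration.integrable_diff[OF T.pair_integrable[OF f(3)] pair_integrable[OF f(3)]]
      by (simp add: case_prod_unfold right_diff_distrib)
    have "L1_norm (\<lambda>x. LINT \<omega>|lborel. W \<omega> * (?f (x + T j \<omega>) - ?f (x + Y \<omega>))) \<le>
        (LINT \<omega>|lborel. L1_norm (\<lambda>x. W \<omega> * (?f (x + T j \<omega>) - ?f (x + Y \<omega>))))"
      by (rule L1_norm_integral_le[OF int])
    also have "\<dots> \<le> (LINT \<omega>|lborel. d j \<omega>)"
    proof (rule integral_mono_AE'[OF d_int])
      have "L1_norm (\<lambda>x. W \<omega> * (?f (x + T j \<omega>) - ?f (x + Y \<omega>))) \<le> d j \<omega>" for \<omega>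
      proof -
        have "L1_norm (\<lambda>x. ?f (x + T j \<omega>) - ?f (x + Y \<omega>)) \<le> real CARD('n) * norm (T j \<omega> - Y \<omega>) * DL1_norm (Suc (length w)) \<phi>"
          by (rule L1_norm_shift_diff[OF \<phi>])
        also have "\<dots> \<le> real CARD('n) * norm (T j \<omega> - Y \<omega>) * DL1_norm (Suc m) \<phi>"
          using w by (intro mult_left_mono DL1_norm_mono) auto
        finally have 1: "L1_norm (\<lambda>x. ?f (x + T j \<omega>) - ?f (x + Y \<omega>)) \<le> D * norm (T j \<omega> - Y \<omega>)"
          by (simp add: D_def mult_ac)
        have "L1_norm (\<lambda>x. ?f (x + T j \<omega>) - ?f (x + Y \<omega>)) \<le> L1_norm (\<lambda>x. ?f (x + T j \<omega>)) + L1_norm (\<lambda>x. ?f (x + Y \<omega>))"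
          by (intro L1_norm_diff_le lborel_translation(2) f(3))
        also have "\<dots> \<le> 2 * DL1_norm m \<phi>" using L1_norm_le_DL1_norm[OF w, of \<phi>] by simp
        finally show ?thesis using 1 unfolding L1_norm_scale d_def by (intro mult_left_mono) auto
      qed
      then show "AE \<omega> in lborel. L1_norm (\<lambda>x. W \<omega> * (?f (x + T j \<omega>) - ?f (x + Y \<omega>))) \<le> d j \<omega>" by simp
    qed (use D0 in \<open>auto simp: d_def\<close>)
    finally show "L1_norm (iter_deriv w (\<lambda>x. avg W (T j) \<phi> x - avg W Y \<phi> x)) \<le> (LINT \<omega>|lborel. d j \<omega>)"
      unfolding eq .
  qed
  have "(\<lambda>j. S (avg W (T j) \<phi>) - S (avg W Y \<phi>)) \<longlonglongrightarrow> 0"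
  proof (rule Lim_null_comparison)
    show "(\<lambda>j. c * (LINT \<omega>|lborel. d j \<omega>)) \<longlonglongrightarrow> 0" using tendsto_mult_right_zero[of _ sequentially c] lim2 by simp
    have "norm (S (avg W (T j) \<phi>) - S (avg W Y \<phi>)) \<le> c * (LINT \<omega>|lborel. d j \<omega>)" for j
    proof -
      have A: "avg W (T j) \<phi> \<in> DL1" "avg W Y \<phi> \<in> DL1"
        by (rule averaging.avg_DL1[OF AT bs \<phi>], rule avg_DL1[OF bs \<phi>])
      have "norm (S (avg W (T j) \<phi>) - S (avg W Y \<phi>)) \<le> c * DL1_norm m (\<lambda>x. avg W (T j) \<phi> x - avg W Y \<phi> x)"
        using c(2)[OF DL1_diff[OF A]] by (simp add: DL1_dual_diff[OF S A])
      also have "\<dots> \<le> c * (LINT \<omega>|lborel. d j \<omega>)" using c(1) est by (intro mult_left_mono) auto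
      finally show ?thesis .
    qed
    then show "\<forall>\<^sub>F j in sequentially. norm (S (avg W (T j) \<phi>) - S (avg W Y \<phi>)) \<le> c * (LINT \<omega>|lborel. d j \<omega>)"
      by (intro always_eventually allI)
  qed
  then have "(\<lambda>j. S (avg W (T j) \<phi>)) \<longlonglongrightarrow> S (avg W Y \<phi>)" by (simp add: LIM_zero_iff)
  with lim1 show ?thesis
    unfolding dual_avg_simple[OF S \<phi> T(1)] by (rule LIMSEQ_unique[rotated])
qed

end

lemma dual_mollify:
  assumes "S \<in> DL1_dual" "integrable lborel \<psi>"
  shows "S (mollify r \<psi>) = (LINT y|lborel. \<psi> y * S (\<lambda>x. bump r (x - y)))"
  using averaging.dual_avg[OF averaging_uminus[OF assms(2)] assms(1) bump_DL1] by (simp add: mollify_def)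

section \<open>Compactly supported functionals\<close>

lemma bump_shift_support:
  assumes "r > 0" shows "closure {x. bump r (x - y) \<noteq> 0} \<subseteq> cball y r"
proof (rule closure_minimal)
  show "{x. bump r (x - y) \<noteq> 0} \<subseteq> cball y r"
    using bump_support[OF assms] by (force simp: dist_norm norm_minus_commute)
qed simp

lemma bump_shift_DL1: "(\<lambda>x. bump r (x - y)) \<in> DL1"
  using DL1_shift[OF bump_DL1, of r "- y"] by simp

lemma bump_shift_test_function: "r > 0 \<Longrightarrow> (\<lambda>x. bump r (x - y)) \<in> test_functions"
  using DL1_smooth[OF bump_shift_DL1[of r y]] compact_closure bounded_subset[OF bounded_cball bump_shift_support[of r y]]
  by (auto simp: test_functions_def intro: bounded_subset[OF _ closure_subset])

text \<open>Mollification replaces the usual partition of unity: by the Lebesgue number lemma the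
  translates of a small bump that occur in the mollified function have their supports in the
  sets of the cover.\<close>

lemma dual_vanishes_off_support:
  fixes \<phi> :: "real^'n::finite \<Rightarrow> complex"
  assumes S: "S \<in> DL1_dual" and \<phi>: "\<phi> \<in> test_functions"
    and disj: "closure {x. \<phi> x \<noteq> 0} \<inter> dist_support S = {}"
  shows "S \<phi> = 0"
proof -
  let ?K = "closure {x. \<phi> x \<noteq> 0}"
  have K: "compact ?K" using \<phi> by (auto simp: test_functions_def)
  have \<phi>D: "\<phi> \<in> DL1" by (rule test_functions_DL1[OF \<phi>])
  have cov: "?K \<subseteq> \<Union>{U. open U \<and> vanishes_on S U}" using disj by (auto simp: dist_support_def)
  obtain e where e: "e > 0" "\<And>x. x \<in> ?K \<Longrightarrow> \<exists>U\<in>{U. open U \<and> vanishes_on S U}. ball x e \<subseteq> U"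
    by (rule Heine_Borel_lemma[OF K cov]) auto
  obtain c m where c: "c > 0" "\<And>\<phi>. \<phi> \<in> DL1 \<Longrightarrow> cmod (S \<phi>) \<le> c * DL1_norm m \<phi>"
    using DL1_dual_bound[OF S] by metis
  define L where "L = c * (real CARD('n) * DL1_norm (Suc m) \<phi>)"
  have L0: "L \<ge> 0" using c(1) by (simp add: L_def)
  have bound: "cmod (S \<phi>) \<le> L * r" if r: "0 < r" "r < e" for r
  proof -
    have z: "\<phi> y * S (\<lambda>x. bump r (x - y)) = 0" for y
    proof (cases "y \<in> ?K")
      case True
      then obtain U where U: "vanishes_on S U" "ball y e \<subseteq> U" using e(2) by blast
      have "closure {x. bump r (x - y) \<noteq> 0} \<subseteq> U"
        using bump_shift_support[OF r(1), of y] U(2) r(2) by (force simp: subset_iff)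
      then show ?thesis using U(1) bump_shift_test_function[OF r(1), of y] by (simp add: vanishes_on_def)
    next
      case False
      then have "\<phi> y = 0" using closure_subset[of "{x. \<phi> x \<noteq> 0}"] by blast
      then show ?thesis by simp
    qed
    have M: "mollify r \<phi> \<in> DL1" by (rule mollify_DL1[OF DL1_integrable0[OF \<phi>D]])
    have "S (mollify r \<phi>) = 0"
      unfolding dual_mollify[OF S DL1_integrable0[OF \<phi>D]] z by simp
    then have "S (\<lambda>x. mollify r \<phi> x - \<phi> x) = - S \<phi>" by (simp add: DL1_dual_diff[OF S M \<phi>D])
    then have "cmod (S \<phi>) \<le> c * DL1_norm m (\<lambda>x. mollify r \<phi> x - \<phi> x)"
      using c(2)[OF DL1_diff[OF M \<phi>D]] by simp
    also have "\<dots> \<le> c * (real CARD('n) * r * DL1_norm (Suc m) \<phi>)"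
      using c(1) by (intro mult_left_mono mollify_approx[OF \<phi>D r(1)]) auto
    finally show ?thesis by (simp add: L_def mult_ac)
  qed
  have "cmod (S \<phi>) \<le> 0"
  proof (rule field_le_epsilon)
    fix d :: real assume d: "d > 0"
    \<comment> \<open>The bound \<open>e / 2\<close> keeps the bumps inside sets of the cover;
      \<open>d / (L + 1)\<close> makes the error at most \<open>d\<close>, with the added 1 for the
      case \<open>L = 0\<close>.\<close>
    let ?r = "min (e / 2) (d / (L + 1))"
    have "cmod (S \<phi>) \<le> L * ?r" using d e(1) L0 by (intro bound) (auto simp: min_less_iff_disj)
    also have "\<dots> \<le> L * (d / (L + 1))" using L0 by (intro mult_left_mono) auto
    also have "\<dots> \<le> d" using L0 d by (simp add: field_simps)
    finally show "cmod (S \<phi>) \<le> 0 + d" by simp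
  qed
  then show ?thesis by simp
qed

section \<open>Continuous functions vanishing at infinity\<close>

text \<open>Stated for bare functions so that \<open>avg\<close> can act on them;
  \<open>C0_iff\<close> and \<open>c0_obtain\<close> pass to and from the type of bounded continuous
  functions that carries the sup norm.\<close>

definition c0 :: "(real^'n::finite \<Rightarrow> complex) \<Rightarrow> bool" where
  "c0 f \<longleftrightarrow> continuous_on UNIV f \<and> (f \<longlongrightarrow> 0) at_infinity"

lemma c0_measurable: "c0 f \<Longrightarrow> f \<in> borel_measurable borel"
  by (auto simp: c0_def intro: borel_measurable_continuous_onI)

lemma c0_bounded: assumes "c0 f" shows "bounded (range f)"
proof -
  obtain b where b: "\<And>x. norm x \<ge> b \<Longrightarrow> dist (f x) 0 < 1"
    using assms unfolding c0_def Lim_at_infinity by (metis zero_less_one)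
  have "continuous_on (cball 0 b) f" using assms by (auto simp: c0_def intro: continuous_on_subset)
  then have "bounded (f ` cball 0 b)" by (intro compact_imp_bounded compact_continuous_image) auto
  then have "bounded (f ` cball 0 b \<union> cball 0 1)" by simp
  moreover have "range f \<subseteq> f ` cball 0 b \<union> cball 0 1"
  proof
    fix y assume "y \<in> range f"
    then obtain x where x: "y = f x" by auto
    show "y \<in> f ` cball 0 b \<union> cball 0 1"
    proof (cases "norm x \<le> b")
      case False
      then show ?thesis using b[of x] x by simp
    qed (use x in auto)
  qed
  ultimately show ?thesis by (rule bounded_subset)
qed

lemma c0_compact_support:
  fixes f :: "real^'n::finite \<Rightarrow> complex"
  assumes "continuous_on UNIV f" "\<And>x. norm x > b \<Longrightarrow> f x = 0"
  shows "c0 f"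
  unfolding c0_def Lim_at_infinity
proof (intro conjI allI impI exI[of _ "b + 1"])
  fix e :: real and x :: "real^'n" assume "e > 0" "b + 1 \<le> norm x"
  then show "dist (f x) 0 < e" using assms(2)[of x] by simp
qed (rule assms(1))

section \<open>Averages of functions vanishing at infinity\<close>

context averaging
begin

text \<open>Dominated convergence along a sequence of base points. It serves twice: for convergent
  base points it yields continuity, and for base points escaping to infinity, with limit 0,
  decay.\<close>

lemma avg_tendsto:
  assumes f: "c0 f" and lim: "\<And>\<omega>. (\<lambda>j. f (X j + Y \<omega>)) \<longlonglongrightarrow> g \<omega>" and g: "g \<in> borel_measurable borel"
  shows "(\<lambda>j. avg W Y f (X j)) \<longlonglongrightarrow> (LINT \<omega>|lborel. W \<omega> * g \<omega>)"
  unfolding avg_def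
proof -
  obtain b where b: "\<And>x. cmod (f x) \<le> b" using c0_bounded[OF f] by (auto simp: bounded_iff)
  have [measurable]: "f \<in> borel_measurable borel" by (rule c0_measurable[OF f])
  show "(\<lambda>j. LINT \<omega>|lborel. W \<omega> * f (X j + Y \<omega>)) \<longlonglongrightarrow> (LINT \<omega>|lborel. W \<omega> * g \<omega>)"
  proof (rule integral_dominated_convergence[where w = "\<lambda>\<omega>. cmod (W \<omega>) * b"])
    show "AE \<omega> in lborel. (\<lambda>j. W \<omega> * f (X j + Y \<omega>)) \<longlonglongrightarrow> W \<omega> * g \<omega>"
      by (intro AE_I2 tendsto_mult tendsto_const lim)
    show "AE \<omega> in lborel. norm (W \<omega> * f (X j + Y \<omega>)) \<le> cmod (W \<omega>) * b" for j
      by (intro AE_I2) (simp add: norm_mult mult_left_mono b)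
    show "(\<lambda>\<omega>. W \<omega> * g \<omega>) \<in> borel_measurable lborel" using g by measurable
  qed (use W in auto)
qed

lemma avg_c0:
  assumes f: "c0 f" shows "c0 (avg W Y f)"
proof -
  have fc: "continuous_on UNIV f" and f0: "(f \<longlongrightarrow> 0) at_infinity" using f by (auto simp: c0_def)
  have [measurable]: "f \<in> borel_measurable borel" by (rule c0_measurable[OF f])
  have "continuous_on UNIV (avg W Y f)"
    unfolding continuous_on_sequentially o_def
  proof (intro allI ballI impI)
    fix X and a :: "real^'n" assume "(\<forall>n. X n \<in> UNIV) \<and> X \<longlonglongrightarrow> a"
    then have "(\<lambda>j. f (X j + Y \<omega>)) \<longlonglongrightarrow> f (a + Y \<omega>)" for \<omega>
      by (intro continuous_on_tendsto_compose[OF fc] tendsto_add tendsto_const) auto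
    from avg_tendsto[OF f this] show "(\<lambda>j. avg W Y f (X j)) \<longlonglongrightarrow> avg W Y f a"
      by (simp add: avg_def)
  qed
  moreover have "(avg W Y f \<longlongrightarrow> 0) at_infinity"
  proof (rule ccontr)
    \<comment> \<open>Dominated convergence is sequential, so failure of decay is first turned into
      a sequence of points with norms tending to infinity.\<close>
    assume "\<not> ?thesis"
    then obtain e where e: "e > 0" "\<And>b. \<exists>x. norm x \<ge> b \<and> \<not> dist (avg W Y f x) 0 < e"
      unfolding Lim_at_infinity by blast
    have "\<forall>j::nat. \<exists>x. norm x \<ge> real j \<and> \<not> dist (avg W Y f x) 0 < e" using e(2) by (rule allI)
    from choice[OF this] obtain X where X: "\<And>j::nat. norm (X j) \<ge> real j" "\<And>j. \<not> dist (avg W Y f (X j)) 0 < e" by blast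
    have "(\<lambda>j. f (X j + Y \<omega>)) \<longlonglongrightarrow> 0" for \<omega>
    proof (rule filterlim_compose[OF f0])
      have "filterlim (\<lambda>j. - norm (Y \<omega>) + real j) at_top sequentially"
        by (rule filterlim_tendsto_add_at_top[OF tendsto_const filterlim_real_sequentially])
      then have "filterlim (\<lambda>j. norm (X j + Y \<omega>)) at_top sequentially"
      proof (rule filterlim_at_top_mono)
        have "- norm (Y \<omega>) + real j \<le> norm (X j + Y \<omega>)" for j
          using X(1)[of j] norm_triangle_ineq4[of "X j + Y \<omega>" "Y \<omega>"] by simp
        then show "\<forall>\<^sub>F j in sequentially. - norm (Y \<omega>) + real j \<le> norm (X j + Y \<omega>)" by simp
      qed
      then show "filterlim (\<lambda>j. X j + Y \<omega>) at_infinity sequentially"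
        by (simp add: filterlim_at_infinity_conv_norm_at_top)
    qed
    from avg_tendsto[OF f this] have "(\<lambda>j. avg W Y f (X j)) \<longlonglongrightarrow> 0" by simp
    then have "\<forall>\<^sub>F j in sequentially. dist (avg W Y f (X j)) 0 < e" using e(1) by (rule tendstoD)
    then show False using X(2) by (auto simp: eventually_sequentially)
  qed
  ultimately show ?thesis by (simp add: c0_def)
qed

text \<open>Fubini and translation invariance put the shift on the other factor with the opposite
  sign.\<close>

lemma avg_adjoint:
  assumes \<phi>: "integrable lborel \<phi>" and g: "c0 g"
  shows "(LINT x|lborel. avg W Y \<phi> x * g x) = (LINT x|lborel. \<phi> x * avg W (\<lambda>\<omega>. - Y \<omega>) g x)"
proof -
  have [measurable]: "g \<in> borel_measurable borel" "\<phi> \<in> borel_measurable borel"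
    using c0_measurable[OF g] \<phi> by auto
  obtain b where b: "\<And>x. cmod (g x) \<le> b" using c0_bounded[OF g] by (auto simp: bounded_iff)
  then have b': "cmod (g x) \<le> cmod (complex_of_real b)" for x by (metis norm_of_real abs_ge_self order_trans)
  have i1: "integrable (lborel \<Otimes>\<^sub>M lborel) (\<lambda>(\<omega>, x). (W \<omega> * \<phi> (x + Y \<omega>)) * g x)"
  proof (rule Bochner_Integration.integrable_bound)
    show "integrable (lborel \<Otimes>\<^sub>M lborel) (\<lambda>p. (case p of (\<omega>, x) \<Rightarrow> W \<omega> * \<phi> (x + Y \<omega>)) * complex_of_real b)"
      using pair_integrable[OF \<phi>] by (rule integrable_mult_left)
    show "AE p in lborel \<Otimes>\<^sub>M lborel. norm (case p of (\<omega>, x) \<Rightarrow> (W \<omega> * \<phi> (x + Y \<omega>)) * g x) \<le> norm ((case p of (\<omega>, x) \<Rightarrow> W \<omega> * \<phi> (x + Y \<omega>)) * complex_of_real b)"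
      by (intro AE_I2) (auto simp: norm_mult[of "_ * _"] simp del: norm_of_real intro!: mult_left_mono b')
  qed measurable
  have int0: "integrable lborel (\<lambda>x. \<phi> x * h x)" if h: "\<And>x. cmod (h x) \<le> b" and [measurable]: "h \<in> borel_measurable borel" for h
  proof (rule Bochner_Integration.integrable_bound)
    show "integrable lborel (\<lambda>x. \<phi> x * complex_of_real b)" using \<phi> by simp
    have "cmod (h x) \<le> cmod (complex_of_real b)" for x using h by (metis norm_of_real abs_ge_self order_trans)
    then show "AE x in lborel. norm (\<phi> x * h x) \<le> norm (\<phi> x * complex_of_real b)"
      unfolding norm_mult by (intro AE_I2 mult_left_mono) auto
  qed measurable
  have i2: "integrable (lborel \<Otimes>\<^sub>M lborel) (\<lambda>(\<omega>, x). \<phi> x * (W \<omega> * g (x + - Y \<omega>)))"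
  proof (rule lborel_pair_Fubini_integrable)
    show "integrable lborel (\<lambda>x. \<phi> x * (W \<omega> * g (x + - Y \<omega>)))" for \<omega>
      using integrable_mult_right[OF int0[of "\<lambda>x. g (x + - Y \<omega>)"], of "W \<omega>"] b by (simp add: mult_ac)
    show "integrable lborel (\<lambda>\<omega>. LINT x|lborel. norm (\<phi> x * (W \<omega> * g (x + - Y \<omega>))))"
    proof (rule Bochner_Integration.integrable_bound)
      show "integrable lborel (\<lambda>\<omega>. cmod (W \<omega>) * (b * L1_norm \<phi>))" using W by simp
      have "(LINT x|lborel. norm (\<phi> x * (W \<omega> * g (x + - Y \<omega>)))) \<le> (LINT x|lborel. cmod (W \<omega>) * b * cmod (\<phi> x))" for \<omega>
      proof (rule integral_mono_AE')
        show "integrable lborel (\<lambda>x. cmod (W \<omega>) * b * cmod (\<phi> x))" using \<phi> by simp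
        have "norm (\<phi> x * (W \<omega> * g (x + - Y \<omega>))) \<le> cmod (\<phi> x) * (cmod (W \<omega>) * b)" for x
          unfolding norm_mult by (intro mult_left_mono b) auto
        then show "AE x in lborel. norm (\<phi> x * (W \<omega> * g (x + - Y \<omega>))) \<le> cmod (W \<omega>) * b * cmod (\<phi> x)"
          by (intro AE_I2) (simp add: mult_ac)
        show "AE x in lborel. 0 \<le> cmod (W \<omega>) * b * cmod (\<phi> x)"
          using order_trans[OF norm_ge_zero b] by (intro AE_I2 mult_nonneg_nonneg) auto
      qed
      then show "AE \<omega> in lborel. norm (LINT x|lborel. norm (\<phi> x * (W \<omega> * g (x + - Y \<omega>)))) \<le> norm (cmod (W \<omega>) * (b * L1_norm \<phi>))"
        by (intro AE_I2) (auto simp: L1_norm_def mult_ac intro: order_trans[OF _ abs_ge_self])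
    qed measurable
  qed measurable
  have "(LINT x|lborel. avg W Y \<phi> x * g x) = (LINT x|lborel. LINT \<omega>|lborel. (W \<omega> * \<phi> (x + Y \<omega>)) * g x)"
    by (simp add: avg_def)
  also have "\<dots> = (LINT \<omega>|lborel. LINT x|lborel. (W \<omega> * \<phi> (x + Y \<omega>)) * g x)"
    by (rule lborel_pair.Fubini_integral[OF i1])
  also have "\<dots> = (LINT \<omega>|lborel. LINT x|lborel. \<phi> x * (W \<omega> * g (x + - Y \<omega>)))"
  proof (rule Bochner_Integration.integral_cong[OF refl])
    fix \<omega> :: 'a
    have "(LINT x|lborel. (W \<omega> * \<phi> (x + Y \<omega>)) * g x) = (LINT x|lborel. (\<lambda>x. \<phi> x * (W \<omega> * g (x + - Y \<omega>))) (x + Y \<omega>))"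
      by (simp add: mult_ac)
    also have "\<dots> = (LINT x|lborel. \<phi> x * (W \<omega> * g (x + - Y \<omega>)))" by (rule lborel_translation(1))
    finally show "(LINT x|lborel. (W \<omega> * \<phi> (x + Y \<omega>)) * g x) = (LINT x|lborel. \<phi> x * (W \<omega> * g (x + - Y \<omega>)))" .
  qed
  also have "\<dots> = (LINT x|lborel. LINT \<omega>|lborel. \<phi> x * (W \<omega> * g (x + - Y \<omega>)))"
    by (rule lborel_pair.Fubini_integral[OF i2, symmetric])
  finally show ?thesis by (simp add: avg_def)
qed

end

text \<open>The Gaussian is even, so the heat shift and its negative give the same average. Hence
  the resolvent is symmetric and can be moved across the pairing.\<close>

lemma heat_shift_reflect:
  assumes g: "c0 g"
  shows "avg heat_weight (\<lambda>p. - heat_shift p) g = resolvent g"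
proof
  fix x
  have [measurable]: "g \<in> borel_measurable borel" by (rule c0_measurable[OF g])
  interpret r: averaging heat_weight "\<lambda>p. - heat_shift p"
    by unfold_locales (use heat.W heat.Y in auto)
  note bs = c0_measurable[OF g] c0_bounded[OF g]
  have "avg heat_weight (\<lambda>p. - heat_shift p) g x = (LINT t|lborel. LINT z|lborel. heat_weight (t, z) * g (x + - heat_shift (t, z)))"
    unfolding avg_def by (rule lborel_integral_prod) (rule r.bounded_integrable[OF bs])
  also have "\<dots> = (LINT t|lborel. LINT z|lborel. heat_weight (t, z) * g (x + heat_shift (t, z)))"
  proof (rule Bochner_Integration.integral_cong[OF refl])
    fix t :: real
    have "(LINT z|lborel. (\<lambda>z. heat_weight (t, z) * g (x + heat_shift (t, z))) (- z)) = (LINT z|lborel. heat_weight (t, z) * g (x + heat_shift (t, z)))"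
      by (rule lborel_uminus(1)) (simp add: heat_weight_def heat_shift_def)
    then show "(LINT z|lborel. heat_weight (t, z) * g (x + - heat_shift (t, z))) = (LINT z|lborel. heat_weight (t, z) * g (x + heat_shift (t, z)))"
      by (simp add: heat_weight_def heat_shift_def)
  qed
  also have "\<dots> = resolvent g x"
    unfolding avg_def by (rule lborel_integral_prod[symmetric]) (rule heat.bounded_integrable[OF bs])
  finally show "avg heat_weight (\<lambda>p. - heat_shift p) g x = resolvent g x" .
qed

lemma resolvent_iter_adjoint:
  assumes "\<phi> \<in> DL1" "c0 g"
  shows "c0 ((resolvent ^^ m) g)"
    and "(LINT x|lborel. (resolvent ^^ m) \<phi> x * g x) = (LINT x|lborel. \<phi> x * (resolvent ^^ m) g x)"
proof -
  show "c0 ((resolvent ^^ m) g)" by (induction m) (auto simp: assms heat.avg_c0)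
  show "(LINT x|lborel. (resolvent ^^ m) \<phi> x * g x) = (LINT x|lborel. \<phi> x * (resolvent ^^ m) g x)"
    using assms(2)
  proof (induction m arbitrary: g)
    case (Suc m)
    have "(LINT x|lborel. (resolvent ^^ Suc m) \<phi> x * g x) = (LINT x|lborel. (resolvent ^^ m) \<phi> x * resolvent g x)"
      using heat.avg_adjoint[OF DL1_integrable0[OF resolvent_iter_DL1(1)[OF assms(1)]] Suc.prems, of m]
      by (simp add: heat_shift_reflect[OF Suc.prems])
    also have "\<dots> = (LINT x|lborel. \<phi> x * (resolvent ^^ m) (resolvent g) x)"
      by (rule Suc.IH[OF heat.avg_c0[OF Suc.prems]])
    finally show ?case by (simp add: funpow_swap1)
  qed simp
qed

section \<open>The sup norm as a dual norm of L1\<close>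

lemma C0_iff: "F \<in> C0 \<longleftrightarrow> c0 (apply_bcontfun F)"
  using apply_bcontfun[of F] by (auto simp: C0_def c0_def bcontfun_def)

lemma c0_obtain:
  assumes "c0 f" obtains F where "F \<in> C0" "apply_bcontfun F = f"
proof -
  have "f \<in> bcontfun" using assms c0_bounded[OF assms] by (auto simp: bcontfun_def c0_def)
  then have "apply_bcontfun (Bcontfun f) = f" by (rule Bcontfun_inverse)
  with assms that[of "Bcontfun f"] show ?thesis by (simp add: C0_iff)
qed

lemma pairing:
  fixes F :: "(real^'n::finite) \<Rightarrow>\<^sub>C complex"
  assumes \<phi>: "integrable lborel \<phi>"
  shows "integrable lborel (\<lambda>x. apply_bcontfun F x * \<phi> x)"
    and "cmod (LINT x|lborel. apply_bcontfun F x * \<phi> x) \<le> norm F * L1_norm \<phi>"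
proof -
  have "continuous_on UNIV (apply_bcontfun F)" using apply_bcontfun[of F] by (simp add: bcontfun_def)
  then have [measurable]: "apply_bcontfun F \<in> borel_measurable borel" by (rule borel_measurable_continuous_onI)
  have [measurable]: "\<phi> \<in> borel_measurable borel" using \<phi> by auto
  have le: "cmod (apply_bcontfun F x * \<phi> x) \<le> norm F * cmod (\<phi> x)" for x
    unfolding norm_mult by (intro mult_right_mono norm_bounded) auto
  have I: "integrable lborel (\<lambda>x. norm F * cmod (\<phi> x))" using \<phi> by simp
  show "integrable lborel (\<lambda>x. apply_bcontfun F x * \<phi> x)"
    by (rule Bochner_Integration.integrable_bound[OF I]) (use le in auto)
  have "cmod (LINT x|lborel. apply_bcontfun F x * \<phi> x) \<le> (LINT x|lborel. cmod (apply_bcontfun F x * \<phi> x))"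
    by (rule integral_norm_bound)
  also have "\<dots> \<le> (LINT x|lborel. norm F * cmod (\<phi> x))"
    by (rule integral_mono_AE'[OF I]) (use le in auto)
  finally show "cmod (LINT x|lborel. apply_bcontfun F x * \<phi> x) \<le> norm F * L1_norm \<phi>" by (simp add: L1_norm_def)
qed

lemma pairing_diff:
  fixes F G :: "(real^'n::finite) \<Rightarrow>\<^sub>C complex"
  assumes \<phi>: "integrable lborel \<phi>"
  shows "(LINT x|lborel. apply_bcontfun (F - G) x * \<phi> x) = (LINT x|lborel. apply_bcontfun F x * \<phi> x) - (LINT x|lborel. apply_bcontfun G x * \<phi> x)"
proof -
  have "(LINT x|lborel. apply_bcontfun (F - G) x * \<phi> x) = (LINT x|lborel. apply_bcontfun F x * \<phi> x - apply_bcontfun G x * \<phi> x)"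
    by (simp add: left_diff_distrib)
  also have "\<dots> = (LINT x|lborel. apply_bcontfun F x * \<phi> x) - (LINT x|lborel. apply_bcontfun G x * \<phi> x)"
    by (rule Bochner_Integration.integral_diff) (rule pairing(1)[OF \<phi>])+
  finally show ?thesis .
qed

text \<open>The test functions are bumps of L^1 norm 1 around a point where \<open>F\<close> varies
  by less than \<open>d\<close>: the pairing then reproduces the value of \<open>F\<close> there up
  to \<open>d\<close>. This is what turns estimates of functionals into uniform estimates of
  functions.\<close>

lemma norm_le_of_pairing:
  fixes F :: "(real^'n::finite) \<Rightarrow>\<^sub>C complex"
  assumes le: "\<And>\<phi>. \<phi> \<in> DL1 \<Longrightarrow> cmod (LINT x|lborel. apply_bcontfun F x * \<phi> x) \<le> e * L1_norm \<phi>"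
  shows "norm F \<le> e"
proof (rule norm_bound)
  fix x :: "real^'n"
  show "norm (apply_bcontfun F x) \<le> e"
  proof (rule field_le_epsilon)
    fix d :: real assume d: "d > 0"
    have "continuous_on UNIV (apply_bcontfun F)" using apply_bcontfun[of F] by (simp add: bcontfun_def)
    then obtain r where r: "r > 0" "\<And>y. dist y x < r \<Longrightarrow> dist (apply_bcontfun F y) (apply_bcontfun F x) < d"
      using d by (metis UNIV_I continuous_on_iff)
    define \<phi> :: "real^'n \<Rightarrow> complex" where "\<phi> = (\<lambda>y. bump r (y - x))"
    have \<phi>: "\<phi> \<in> DL1" unfolding \<phi>_def by (rule bump_shift_DL1)
    note int = DL1_integrable0[OF \<phi>]
    have \<phi>1: "L1_norm \<phi> = 1"
      using L1_norm_shift[of "bump r" "- x"] bump_integral(2)[OF r(1), where 'n='n] by (simp add: \<phi>_def)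
    have \<phi>2: "(LINT y|lborel. \<phi> y) = 1"
      using lborel_translation(1)[of "bump r" "- x"] bump_integral(1)[OF r(1), where 'n='n] by (simp add: \<phi>_def)
    have "(LINT y|lborel. (apply_bcontfun F y - apply_bcontfun F x) * \<phi> y) = (LINT y|lborel. apply_bcontfun F y * \<phi> y) - apply_bcontfun F x"
    proof -
      have "(LINT y|lborel. (apply_bcontfun F y - apply_bcontfun F x) * \<phi> y) = (LINT y|lborel. apply_bcontfun F y * \<phi> y - apply_bcontfun F x * \<phi> y)"
        by (simp only: left_diff_distrib)
      also have "\<dots> = (LINT y|lborel. apply_bcontfun F y * \<phi> y) - (LINT y|lborel. apply_bcontfun F x * \<phi> y)"
        by (rule Bochner_Integration.integral_diff) (use pairing(1)[OF int] int in auto)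
      finally show ?thesis by (simp add: \<phi>2)
    qed
    moreover have "cmod (LINT y|lborel. (apply_bcontfun F y - apply_bcontfun F x) * \<phi> y) \<le> d"
    proof -
      have "cmod (LINT y|lborel. (apply_bcontfun F y - apply_bcontfun F x) * \<phi> y) \<le> (LINT y|lborel. cmod ((apply_bcontfun F y - apply_bcontfun F x) * \<phi> y))"
        by (rule integral_norm_bound)
      also have "\<dots> \<le> (LINT y|lborel. d * cmod (\<phi> y))"
      proof (rule integral_mono_AE')
        have "cmod ((apply_bcontfun F y - apply_bcontfun F x) * \<phi> y) \<le> d * cmod (\<phi> y)" for y
        proof (cases "dist y x < r")
          case True
          then show ?thesis using r(2)[OF True] by (simp add: norm_mult dist_norm mult_right_mono less_imp_le)
        next
          case False
          then have "\<phi> y = 0" unfolding \<phi>_def by (intro bump_support r(1)) (simp add: dist_norm)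
          then show ?thesis by simp
        qed
        then show "AE y in lborel. cmod ((apply_bcontfun F y - apply_bcontfun F x) * \<phi> y) \<le> d * cmod (\<phi> y)" by simp
      qed (use int d in auto)
      also have "\<dots> = d" using \<phi>1 by (simp add: L1_norm_def)
      finally show ?thesis .
    qed
    ultimately have "cmod ((LINT y|lborel. apply_bcontfun F y * \<phi> y) - apply_bcontfun F x) \<le> d" by simp
    then show "norm (apply_bcontfun F x) \<le> e + d"
      using le[OF \<phi>] norm_triangle_ineq3[of "LINT y|lborel. apply_bcontfun F y * \<phi> y" "apply_bcontfun F x"] by (simp add: \<phi>1)
  qed
qed

lemma C0_eqI:
  fixes F G :: "(real^'n::finite) \<Rightarrow>\<^sub>C complex"
  assumes "\<And>\<phi>. \<phi> \<in> DL1 \<Longrightarrow> (LINT x|lborel. apply_bcontfun F x * \<phi> x) = (LINT x|lborel. apply_bcontfun G x * \<phi> x)"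
  shows "F = G"
proof -
  have "norm (F - G) \<le> 0"
    by (rule norm_le_of_pairing) (simp only: pairing_diff[OF DL1_integrable0] assms, simp)
  then show ?thesis by simp
qed

lemma C0_limit:
  assumes G: "\<And>j. G j \<in> C0" "G \<longlonglongrightarrow> F"
  shows "F \<in> C0"
  unfolding C0_def Lim_at_infinity mem_Collect_eq
proof (intro allI impI)
  fix e :: real assume e: "e > 0"
  then have "\<forall>\<^sub>F j in sequentially. dist (G j) F < e / 2" using G(2) by (intro tendstoD) auto
  then obtain j where j: "dist (G j) F < e / 2" by (auto simp: eventually_sequentially)
  obtain b where b: "\<And>x. b \<le> norm x \<Longrightarrow> dist (apply_bcontfun (G j) x) 0 < e / 2"
    using G(1)[of j] e unfolding C0_def Lim_at_infinity mem_Collect_eq by (metis half_gt_zero)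
  have "dist (apply_bcontfun F x) 0 < e" if "b \<le> norm x" for x
    using b[OF that] dist_bounded[of "G j" x F] j dist_triangle[of "apply_bcontfun F x" 0 "apply_bcontfun (G j) x"]
    by (simp add: dist_commute)
  then show "\<exists>b. \<forall>x. b \<le> norm x \<longrightarrow> dist (apply_bcontfun F x) 0 < e" by blast
qed

text \<open>Functions that represent the functional ever more closely in the dual norm of L^1 form a
  Cauchy sequence in sup norm by \<open>norm_le_of_pairing\<close>; completeness provides the limit,
  which still vanishes at infinity.\<close>

lemma C0_functionals_closed:
  fixes u :: "(real^'n::finite \<Rightarrow> complex) \<Rightarrow> complex"
  assumes "\<And>e. e > 0 \<Longrightarrow> \<exists>F\<in>C0. \<forall>\<phi>\<in>DL1. cmod (u \<phi> - (LINT x|lborel. apply_bcontfun F x * \<phi> x)) \<le> e * L1_norm \<phi>"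
  shows "\<exists>F\<in>C0. \<forall>\<phi>\<in>DL1. u \<phi> = (LINT x|lborel. apply_bcontfun F x * \<phi> x)"
proof -
  have "\<forall>j. \<exists>F\<in>C0. \<forall>\<phi>\<in>DL1. cmod (u \<phi> - (LINT x|lborel. apply_bcontfun F x * \<phi> x)) \<le> (1 / real (Suc j)) * L1_norm \<phi>"
    by (intro allI assms) simp
  then obtain G where G: "\<And>j. G j \<in> C0"
    "\<And>j \<phi>. \<phi> \<in> DL1 \<Longrightarrow> cmod (u \<phi> - (LINT x|lborel. apply_bcontfun (G j) x * \<phi> x)) \<le> (1 / real (Suc j)) * L1_norm \<phi>"
    by metis
  have GG: "norm (G i - G j) \<le> 1 / real (Suc i) + 1 / real (Suc j)" for i j
  proof (rule norm_le_of_pairing)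
    fix \<phi> :: "real^'n \<Rightarrow> complex" assume \<phi>: "\<phi> \<in> DL1"
    show "cmod (LINT x|lborel. apply_bcontfun (G i - G j) x * \<phi> x) \<le> (1 / real (Suc i) + 1 / real (Suc j)) * L1_norm \<phi>"
      unfolding pairing_diff[OF DL1_integrable0[OF \<phi>]]
      using G(2)[OF \<phi>, of i] G(2)[OF \<phi>, of j]
        norm_triangle_ineq4[of "u \<phi> - (LINT x|lborel. apply_bcontfun (G j) x * \<phi> x)" "u \<phi> - (LINT x|lborel. apply_bcontfun (G i) x * \<phi> x)"]
      by (simp add: distrib_right)
  qed
  have "Cauchy G"
  proof (rule metric_CauchyI)
    fix e :: real assume e: "e > 0"
    obtain N :: nat where N: "real N > 2 / e" using reals_Archimedean2 by blast
    have "1 / real (Suc i) < e / 2" if "i \<ge> N" for i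
    proof -
      have "2 / e < real (Suc i)" using N that by simp
      then show ?thesis using e by (simp add: field_simps)
    qed
    then have "dist (G i) (G j) < e" if "i \<ge> N" "j \<ge> N" for i j
      using GG[of i j] that by (smt (verit) dist_norm field_sum_of_halves)
    then show "\<exists>N. \<forall>i\<ge>N. \<forall>j\<ge>N. dist (G i) (G j) < e" by blast
  qed
  then have "convergent G" by (rule Cauchy_convergent)
  then obtain F where F: "G \<longlonglongrightarrow> F" unfolding convergent_def by (elim exE)
  have "u \<phi> = (LINT x|lborel. apply_bcontfun F x * \<phi> x)" if \<phi>: "\<phi> \<in> DL1" for \<phi>
  proof -
    let ?I = "\<lambda>F. LINT x|lborel. apply_bcontfun F x * \<phi> x"
    have inv0: "(\<lambda>j. (1 / real (Suc j)) * L1_norm \<phi>) \<longlonglongrightarrow> 0"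
      by (intro tendsto_mult_left_zero LIMSEQ_Suc[OF lim_1_over_n])
    have "(\<lambda>j. ?I (G j) - u \<phi>) \<longlonglongrightarrow> 0"
      by (rule Lim_null_comparison[OF _ inv0]) (use G(2)[OF \<phi>] in \<open>simp add: norm_minus_commute\<close>)
    then have 1: "(\<lambda>j. ?I (G j)) \<longlonglongrightarrow> u \<phi>" by (rule LIM_zero_cancel)
    have nF: "(\<lambda>j. norm (G j - F) * L1_norm \<phi>) \<longlonglongrightarrow> 0"
      using F by (intro tendsto_mult_left_zero tendsto_norm_zero) (simp add: LIM_zero)
    have "norm (?I (G j) - ?I F) \<le> norm (G j - F) * L1_norm \<phi>" for j
      using pairing(2)[OF DL1_integrable0[OF \<phi>], of "G j - F"] by (simp only: pairing_diff[OF DL1_integrable0[OF \<phi>]])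
    then have "(\<lambda>j. ?I (G j) - ?I F) \<longlonglongrightarrow> 0"
      by (intro Lim_null_comparison[OF _ nF] always_eventually allI)
    then have 2: "(\<lambda>j. ?I (G j)) \<longlonglongrightarrow> ?I F" by (rule LIM_zero_cancel)
    show ?thesis using 1 2 by (rule LIMSEQ_unique)
  qed
  then show ?thesis using C0_limit[OF G(1) F] by blast
qed

section \<open>From compactness in the strong dual to compactness in C0\<close>

lemma dist_conv_bessel:
  "dist_conv (bessel_kernel (2 * real m)) S = (\<lambda>\<phi>. if \<phi> \<in> DL1 then S ((resolvent ^^ m) \<phi>) else 0)"
  unfolding dist_conv_def by (auto simp: bessel_kernel_eq_resolvent fun_eq_iff)

lemma dist_conv_eq_iff:
  "dist_conv (bessel_kernel (2 * real m)) S = dist_of_fun (apply_bcontfun F) \<longleftrightarrow>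
     (\<forall>\<phi>\<in>DL1. S ((resolvent ^^ m) \<phi>) = (LINT x|lborel. apply_bcontfun F x * \<phi> x))"
  unfolding dist_conv_bessel dist_of_fun_def by (auto simp: fun_eq_iff)

text \<open>The one bounded set tested for each accuracy. Its bounds are those of the bump and
  deteriorate as \<open>r\<close> shrinks, so \<open>r\<close> has to be fixed before the strong
  topology is used.\<close>

definition smoothed_ball :: "nat \<Rightarrow> real \<Rightarrow> (real^'n::finite \<Rightarrow> complex) set" where
  "smoothed_ball m r = (\<lambda>\<phi>. mollify r ((resolvent ^^ m) \<phi>)) ` {\<phi>\<in>DL1. L1_norm \<phi> \<le> 1}"

lemma smoothed_ball_bounded: "DL1_bounded (smoothed_ball m r)" and smoothed_ball_nonempty: "smoothed_ball m r \<noteq> {}"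
proof -
  have "DL1_norm k (mollify r ((resolvent ^^ m) \<phi>)) \<le> DL1_norm k (bump r :: real^'a \<Rightarrow> complex)"
    if \<phi>: "\<phi> \<in> DL1" "L1_norm \<phi> \<le> 1" for k and \<phi> :: "real^'a \<Rightarrow> complex"
  proof -
    have "DL1_norm k (mollify r ((resolvent ^^ m) \<phi>)) \<le> L1_norm ((resolvent ^^ m) \<phi>) * DL1_norm k (bump r :: real^'a \<Rightarrow> complex)"
      by (rule DL1_norm_mollify[OF DL1_integrable0[OF resolvent_iter_DL1(1)[OF \<phi>(1)]]])
    also have "\<dots> \<le> 1 * DL1_norm k (bump r :: real^'a \<Rightarrow> complex)"
      using order_trans[OF resolvent_iter_DL1(4)[OF \<phi>(1)] \<phi>(2)] by (rule mult_right_mono) simp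
    finally show ?thesis by simp
  qed
  then show "DL1_bounded (smoothed_ball m r :: (real^'a \<Rightarrow> complex) set)"
    unfolding DL1_bounded_def smoothed_ball_def
    by (auto intro!: mollify_DL1 DL1_integrable0 resolvent_iter_DL1)
  have "(\<lambda>x. 0) \<in> {\<phi>\<in>DL1. L1_norm \<phi> \<le> 1}" by (simp add: DL1_zero L1_norm_def)
  then show "smoothed_ball m r \<noteq> {}" unfolding smoothed_ball_def by blast
qed

lemma smoothed_ball_bound:
  assumes T: "T \<in> DL1_dual" and \<phi>: "\<phi> \<in> DL1"
  shows "cmod (T (mollify r ((resolvent ^^ m) \<phi>))) \<le> sup_on (smoothed_ball m r) T * L1_norm \<phi>"
proof -
  let ?B = "smoothed_ball m r :: (real^'a \<Rightarrow> complex) set" and ?P = "\<lambda>\<phi>. mollify r ((resolvent ^^ m) \<phi>)"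
  have pos: "sup_on ?B T \<ge> 0"
    using sup_on_upper[OF smoothed_ball_bounded T] smoothed_ball_nonempty norm_ge_zero order_trans by (metis ex_in_conv)
  \<comment> \<open>A bound \<open>N\<close> replaces the norm of \<phi>, which may be 0, so that
    division is possible; the slack disappears at the end.\<close>
  have scaled: "cmod (T (?P \<phi>)) \<le> sup_on ?B T * N" if N: "N > 0" "L1_norm \<phi> \<le> N" for N
  proof -
    define a where "a = complex_of_real (1 / N)"
    have na: "cmod a = 1 / N" using N(1) by (simp add: a_def norm_divide)
    have "L1_norm (\<lambda>x. a * \<phi> x) \<le> 1" using N by (simp add: L1_norm_scale na)
    then have mem: "?P (\<lambda>x. a * \<phi> x) \<in> ?B" using DL1_scale[OF \<phi>] by (auto simp: smoothed_ball_def)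
    have "(resolvent ^^ m) (\<lambda>x. a * \<phi> x) = (\<lambda>x. a * (resolvent ^^ m) \<phi> x)"
      using resolvent_iter_lincomb[OF \<phi> \<phi>, of m a 0] by simp
    then have "?P (\<lambda>x. a * \<phi> x) = (\<lambda>x. a * ?P \<phi> x)" by (simp add: mollify_def avg_def mult.assoc)
    then have "T (?P (\<lambda>x. a * \<phi> x)) = a * T (?P \<phi>)"
      using DL1_dual_scale[OF T mollify_DL1[OF DL1_integrable0[OF resolvent_iter_DL1(1)[OF \<phi>]]]] by simp
    then have "(1 / N) * cmod (T (?P \<phi>)) \<le> sup_on ?B T"
      using sup_on_upper[OF smoothed_ball_bounded T mem] by (simp add: norm_mult na)
    then show ?thesis using N(1) by (simp add: field_simps)
  qed
  show ?thesis
  proof (rule field_le_epsilon)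
    fix e :: real assume e: "e > 0"
    let ?s = "sup_on ?B T"
    have "cmod (T (?P \<phi>)) \<le> ?s * (L1_norm \<phi> + e / (?s + 1))"
      using e pos by (intro scaled) (auto intro!: add_nonneg_pos)
    also have "\<dots> \<le> ?s * L1_norm \<phi> + e" using e pos by (simp add: distrib_left field_simps)
    finally show "cmod (T (?P \<phi>)) \<le> ?s * L1_norm \<phi> + e" .
  qed
qed

text \<open>Applying \<open>S\<close> to translated bumps gives a continuous function that vanishes
  once the bump leaves the support. Symmetry of the resolvent moves its iterate from \<phi> onto
  this function, where decay at infinity is preserved.\<close>

lemma compactly_supported_smoothed:
  assumes S: "S \<in> compactly_supported" and r: "r > 0"
  obtains F where "F \<in> C0" "\<And>\<phi>. \<phi> \<in> DL1 \<Longrightarrow> S (mollify r ((resolvent ^^ m) \<phi>)) = (LINT x|lborel. apply_bcontfun F x * \<phi> x)"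
proof -
  have SD: "S \<in> DL1_dual" and K: "compact (dist_support S)" using S by (auto simp: compactly_supported_def)
  obtain b where "\<forall>x\<in>dist_support S. norm x \<le> b"
    using compact_imp_bounded[OF K] unfolding bounded_iff by (elim exE)
  then have b: "norm x \<le> b" if "x \<in> dist_support S" for x using that by (rule bspec)
  define g where "g y = S (\<lambda>x. bump r (x - y))" for y
  have "continuous_on UNIV (\<lambda>y. (\<lambda>v. S (\<lambda>x. bump r (x + v))) (- y))"
    by (rule continuous_on_compose2[OF dual_translate_continuous(1)[OF SD bump_DL1]]) (auto intro: continuous_intros)
  then have gc: "continuous_on UNIV g" by (simp add: g_def[abs_def])
  have "g y = 0" if y: "norm y > b + r" for y
    unfolding g_def
  proof (rule dual_vanishes_off_support[OF SD bump_shift_test_function[OF r]])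
    have "x \<notin> cball y r" if "x \<in> dist_support S" for x
      using b[OF that] y norm_triangle_ineq[of "y - x" x] by (auto simp: dist_norm)
    then show "closure {x. bump r (x - y) \<noteq> 0} \<inter> dist_support S = {}"
      using bump_shift_support[OF r, of y] by blast
  qed
  then have g: "c0 g" by (rule c0_compact_support[OF gc])
  obtain F where F: "F \<in> C0" "apply_bcontfun F = (resolvent ^^ m) g"
    using c0_obtain[OF resolvent_iter_adjoint(1)[OF DL1_zero g]] by metis
  show ?thesis
  proof (rule that[OF F(1)])
    fix \<phi> :: "real^'a \<Rightarrow> complex" assume \<phi>: "\<phi> \<in> DL1"
    have "S (mollify r ((resolvent ^^ m) \<phi>)) = (LINT y|lborel. (resolvent ^^ m) \<phi> y * g y)"
      unfolding g_def by (rule dual_mollify[OF SD DL1_integrable0[OF resolvent_iter_DL1(1)[OF \<phi>]]])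
    also have "\<dots> = (LINT x|lborel. \<phi> x * (resolvent ^^ m) g x)" by (rule resolvent_iter_adjoint(2)[OF \<phi> g])
    finally show "S (mollify r ((resolvent ^^ m) \<phi>)) = (LINT x|lborel. apply_bcontfun F x * \<phi> x)"
      by (simp add: F(2) mult.commute)
  qed
qed

lemma compactin_imp_compact_C0:
  fixes C :: "((real^'n::finite \<Rightarrow> complex) \<Rightarrow> complex) set"
  assumes CB: "C \<subseteq> B_dot_dual" and comp: "compactin strong_dual_topology C"
  shows "\<exists>m::nat.
       dist_conv (bessel_kernel (2 * real m)) ` C \<subseteq> (\<lambda>f. dist_of_fun (apply_bcontfun f)) ` C0 \<and>
       compact {f\<in>C0. dist_of_fun (apply_bcontfun f) \<in> dist_conv (bessel_kernel (2 * real m)) ` C}"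
proof -
  have CD: "C \<subseteq> DL1_dual" using compactin_subset_topspace[OF comp] by simp
  obtain c k where c: "c > 0" "\<And>S \<phi>. S \<in> C \<Longrightarrow> \<phi> \<in> DL1 \<Longrightarrow> cmod (S \<phi>) \<le> c * DL1_norm k \<phi>"
    by (rule equicontinuous_of_bounded[OF CD]) (use compactin_strong_bounded[OF comp] in metis)+
  \<comment> \<open>One resolvent for each derivative in the common order \<open>k\<close>, and one
    more for the derivative spent on the mollification rate.\<close>
  let ?m = "Suc k"
  let ?R = "resolvent ^^ ?m :: (real^'n \<Rightarrow> complex) \<Rightarrow> _"
  obtain c1 where c1: "c1 > 0" "\<And>\<phi>::real^'n \<Rightarrow> complex. \<phi> \<in> DL1 \<Longrightarrow> DL1_norm ?m (?R \<phi>) \<le> c1 * L1_norm \<phi>"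
    using resolvent_smoothing[where m = ?m and 'n = 'n] by metis
  define K where "K = c * real CARD('n) * c1"
  have K: "K > 0" using c(1) c1(1) by (simp add: K_def)
  have RD: "?R \<phi> \<in> DL1" if "\<phi> \<in> DL1" for \<phi> by (rule resolvent_iter_DL1(1)[OF that])
  have MD: "mollify r (?R \<phi>) \<in> DL1" if "\<phi> \<in> DL1" for r \<phi> by (rule mollify_DL1[OF DL1_integrable0[OF RD[OF that]]])
  \<comment> \<open>The only use of equicontinuity: the constant \<open>K\<close> is the same for
    all functionals in \<open>C\<close>.\<close>
  have moll: "cmod (S (mollify r (?R \<phi>)) - S (?R \<phi>)) \<le> K * r * L1_norm \<phi>" if S: "S \<in> C" and \<phi>: "\<phi> \<in> DL1" and r: "r > 0" for S \<phi> r
  proof -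
    have SD: "S \<in> DL1_dual" using S CD by auto
    have "cmod (S (mollify r (?R \<phi>)) - S (?R \<phi>)) \<le> c * DL1_norm k (\<lambda>x. mollify r (?R \<phi>) x - ?R \<phi> x)"
      using c(2)[OF S DL1_diff[OF MD[OF \<phi>] RD[OF \<phi>]]] by (simp only: DL1_dual_diff[OF SD MD[OF \<phi>] RD[OF \<phi>]])
    also have "\<dots> \<le> c * (real CARD('n) * r * DL1_norm ?m (?R \<phi>))"
      using c(1) by (intro mult_left_mono mollify_approx[OF RD[OF \<phi>] r]) auto
    also have "\<dots> \<le> c * (real CARD('n) * r * (c1 * L1_norm \<phi>))"
      using c(1) r by (intro mult_left_mono c1(2)[OF \<phi>]) auto
    finally show ?thesis by (simp only: K_def mult_ac)
  qed
  have small: "\<exists>r>0. K * r \<le> e" if "e > 0" for e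
    using that K by (intro exI[of _ "e / K"]) simp
  \<comment> \<open>Two errors of \<open>e / 2\<close>: mollifying inside \<open>S\<close>, then
    replacing \<open>S\<close> by a compactly supported \<open>T\<close> on the smoothed ball. The
    approximant need not obey the common bound of \<open>C\<close>, so its value is taken at the
    mollified function only.\<close>
  have rep: "\<exists>F\<in>C0. \<forall>\<phi>\<in>DL1. S (?R \<phi>) = (LINT x|lborel. apply_bcontfun F x * \<phi> x)" if S: "S \<in> C" for S
  proof (rule C0_functionals_closed[of "\<lambda>\<phi>. S (?R \<phi>)"])
    fix e :: real assume e: "e > 0"
    obtain r where r: "r > 0" "K * r \<le> e / 2" using small[of "e / 2"] e by auto
    have SD: "S \<in> DL1_dual" using S CD by auto
    have "S \<in> strong_dual_topology closure_of compactly_supported" using S CB by (auto simp: B_dot_dual_def)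
    then obtain T where T: "T \<in> compactly_supported" "T \<in> DL1_dual" "sup_on (smoothed_ball ?m r) (\<lambda>\<phi>. T \<phi> - S \<phi>) < e / 2"
      using strong_closure_approx[OF _ smoothed_ball_bounded smoothed_ball_nonempty, of S compactly_supported "e / 2"] e by (metis half_gt_zero)
    obtain F where F: "F \<in> C0" "\<And>\<phi>. \<phi> \<in> DL1 \<Longrightarrow> T (mollify r (?R \<phi>)) = (LINT x|lborel. apply_bcontfun F x * \<phi> x)"
      by (rule compactly_supported_smoothed[OF T(1) r(1), of ?m]) blast
    have "cmod (S (?R \<phi>) - (LINT x|lborel. apply_bcontfun F x * \<phi> x)) \<le> e * L1_norm \<phi>" if \<phi>: "\<phi> \<in> DL1" for \<phi>
    proof -
      have "cmod (T (mollify r (?R \<phi>)) - S (mollify r (?R \<phi>))) \<le> sup_on (smoothed_ball ?m r) (\<lambda>\<phi>. T \<phi> - S \<phi>) * L1_norm \<phi>"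
        by (rule smoothed_ball_bound[OF DL1_dual_minus[OF T(2) SD] \<phi>])
      also have "\<dots> \<le> e / 2 * L1_norm \<phi>" using T(3) by (intro mult_right_mono) auto
      finally have 1: "cmod (T (mollify r (?R \<phi>)) - S (mollify r (?R \<phi>))) \<le> e / 2 * L1_norm \<phi>" .
      have "cmod (S (mollify r (?R \<phi>)) - S (?R \<phi>)) \<le> K * r * L1_norm \<phi>" by (rule moll[OF S \<phi> r(1)])
      also have "\<dots> \<le> e / 2 * L1_norm \<phi>" using r(2) by (intro mult_right_mono) auto
      finally have 2: "cmod (S (mollify r (?R \<phi>)) - S (?R \<phi>)) \<le> e / 2 * L1_norm \<phi>" .
      have "cmod (S (?R \<phi>) - T (mollify r (?R \<phi>))) \<le> e / 2 * L1_norm \<phi> + e / 2 * L1_norm \<phi>"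
        using norm_triangle_mono[OF 1 2] by (simp add: norm_minus_commute)
      then show ?thesis by (simp only: F(2)[OF \<phi>])
    qed
    then show "\<exists>F\<in>C0. \<forall>\<phi>\<in>DL1. cmod (S (?R \<phi>) - (LINT x|lborel. apply_bcontfun F x * \<phi> x)) \<le> e * L1_norm \<phi>"
      using F(1) by blast
  qed
  then obtain f where f: "\<And>S. S \<in> C \<Longrightarrow> f S \<in> C0"
    "\<And>S \<phi>. S \<in> C \<Longrightarrow> \<phi> \<in> DL1 \<Longrightarrow> S (?R \<phi>) = (LINT x|lborel. apply_bcontfun (f S) x * \<phi> x)" by metis
  \<comment> \<open>Both functionals are mollified, which costs \<open>K * r\<close> each, and then
    compared on the smoothed ball of that \<open>r\<close>.\<close>
  have dist_f: "dist (f S) (f T) \<le> 2 * K * r + sup_on (smoothed_ball ?m r) (\<lambda>\<phi>. S \<phi> - T \<phi>)"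
    if S: "S \<in> C" and T: "T \<in> C" and r: "r > 0" for S T r
    unfolding dist_norm
  proof (rule norm_le_of_pairing)
    fix \<phi> :: "real^'n \<Rightarrow> complex" assume \<phi>: "\<phi> \<in> DL1"
    have "S \<in> DL1_dual" "T \<in> DL1_dual" using S T CD by auto
    from smoothed_ball_bound[OF DL1_dual_minus[OF this] \<phi>, of r ?m]
    have 1: "cmod (S (mollify r (?R \<phi>)) - T (mollify r (?R \<phi>))) \<le> sup_on (smoothed_ball ?m r) (\<lambda>\<phi>. S \<phi> - T \<phi>) * L1_norm \<phi>" .
    have "(LINT x|lborel. apply_bcontfun (f S - f T) x * \<phi> x) = S (?R \<phi>) - T (?R \<phi>)"
      by (simp only: pairing_diff[OF DL1_integrable0[OF \<phi>]] f(2)[OF S \<phi>] f(2)[OF T \<phi>])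
    also have "\<dots> = (S (mollify r (?R \<phi>)) - T (mollify r (?R \<phi>))) - (S (mollify r (?R \<phi>)) - S (?R \<phi>)) + (T (mollify r (?R \<phi>)) - T (?R \<phi>))"
      by simp
    finally have "cmod (LINT x|lborel. apply_bcontfun (f S - f T) x * \<phi> x) \<le>
        (sup_on (smoothed_ball ?m r) (\<lambda>\<phi>. S \<phi> - T \<phi>) * L1_norm \<phi> + K * r * L1_norm \<phi>) + K * r * L1_norm \<phi>"
      using norm_triangle_mono[OF norm_triangle_le_diff[OF add_mono[OF 1 moll[OF S \<phi> r]]] moll[OF T \<phi> r]] by (simp only:)
    then show "cmod (LINT x|lborel. apply_bcontfun (f S - f T) x * \<phi> x) \<le> (2 * K * r + sup_on (smoothed_ball ?m r) (\<lambda>\<phi>. S \<phi> - T \<phi>)) * L1_norm \<phi>"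
      by (simp add: algebra_simps)
  qed
  have ts: "topspace (subtopology strong_dual_topology C) = C" using CD by auto
  have cont: "continuous_map (subtopology strong_dual_topology C) euclidean f"
    unfolding continuous_map_def
  proof (intro conjI allI impI)
    fix V :: "((real^'n) \<Rightarrow>\<^sub>C complex) set" assume V: "openin euclidean V"
    have "\<exists>U. openin strong_dual_topology U \<and> T \<in> U \<and> (\<forall>S\<in>U \<inter> C. f S \<in> V)" if T: "T \<in> C" "f T \<in> V" for T
    proof -
      obtain e where e: "e > 0" "ball (f T) e \<subseteq> V" using V T(2) open_contains_ball by (metis open_openin)
      \<comment> \<open>With \<open>e / 4\<close> the two mollification errors amount to at most
        \<open>e / 2\<close>; the strong neighbourhood \<open>?U\<close> supplies the other
        half.\<close>
      obtain r where r: "r > 0" "K * r \<le> e / 4" using small[of "e / 4"] e by auto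
      let ?U = "{S \<in> DL1_dual. sup_on (smoothed_ball ?m r) (\<lambda>\<phi>. S \<phi> - T \<phi>) < e / 2}"
      have TD: "T \<in> DL1_dual" using T CD by auto
      have "f S \<in> V" if S: "S \<in> ?U \<inter> C" for S
      proof -
        have "dist (f S) (f T) < e" using dist_f[of S T r] S T(1) r by auto
        then show ?thesis using e(2) by (auto simp: dist_commute)
      qed
      moreover have "openin strong_dual_topology ?U"
        by (rule openin_strong_ball[OF smoothed_ball_bounded smoothed_ball_nonempty TD])
      moreover have "T \<in> ?U" using TD e(1) by (simp add: sup_on_zero smoothed_ball_nonempty)
      ultimately show ?thesis by blast
    qed
    then obtain U where U: "\<And>T. T \<in> C \<Longrightarrow> f T \<in> V \<Longrightarrow> openin strong_dual_topology (U T) \<and> T \<in> U T \<and> (\<forall>S\<in>U T \<inter> C. f S \<in> V)"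
      by metis
    define W where "W = \<Union>(U ` {T\<in>C. f T \<in> V})"
    have "openin strong_dual_topology W" unfolding W_def using U by (intro openin_Union) auto
    moreover have "{S \<in> topspace (subtopology strong_dual_topology C). f S \<in> V} = W \<inter> C"
      unfolding ts
    proof (intro equalityI subsetI)
      fix S assume "S \<in> {S \<in> C. f S \<in> V}"
      then show "S \<in> W \<inter> C" using U[of S] by (auto simp: W_def)
    next
      fix S assume "S \<in> W \<inter> C"
      then obtain T where "T \<in> C" "f T \<in> V" "S \<in> U T" "S \<in> C" by (auto simp: W_def)
      then show "S \<in> {S \<in> C. f S \<in> V}" using U[of T] by auto
    qed
    ultimately show "openin (subtopology strong_dual_topology C) {S \<in> topspace (subtopology strong_dual_topology C). f S \<in> V}"
      unfolding openin_subtopology by blast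
  qed simp
  have "compactin euclidean (f ` C)"
    by (rule image_compactin[OF _ cont]) (use comp in \<open>simp add: compactin_subtopology\<close>)
  then have compf: "compact (f ` C)" by simp
  have conv: "dist_conv (bessel_kernel (2 * real ?m)) S = dist_of_fun (apply_bcontfun (f S))" if "S \<in> C" for S
    unfolding dist_conv_eq_iff using f(2)[OF that] by blast
  \<comment> \<open>The function representing a given functional is unique by \<open>C0_eqI\<close>,
    so the preimage in the statement is exactly the continuous image of \<open>C\<close>.\<close>
  have eq: "{g\<in>C0. dist_of_fun (apply_bcontfun g) \<in> dist_conv (bessel_kernel (2 * real ?m)) ` C} = f ` C"
  proof (intro equalityI subsetI)
    fix g assume "g \<in> {g\<in>C0. dist_of_fun (apply_bcontfun g) \<in> dist_conv (bessel_kernel (2 * real ?m)) ` C}"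
    then obtain S where S: "S \<in> C" "dist_conv (bessel_kernel (2 * real ?m)) S = dist_of_fun (apply_bcontfun g)" by auto
    have "g = f S"
      by (rule C0_eqI) (use S(2)[unfolded dist_conv_eq_iff] f(2)[OF S(1)] in metis)
    then show "g \<in> f ` C" using S(1) by blast
  next
    fix g assume "g \<in> f ` C"
    then obtain S where "S \<in> C" "g = f S" by blast
    then show "g \<in> {g\<in>C0. dist_of_fun (apply_bcontfun g) \<in> dist_conv (bessel_kernel (2 * real ?m)) ` C}"
      using f(1) conv[symmetric] by blast
  qed
  have sub: "dist_conv (bessel_kernel (2 * real ?m)) ` C \<subseteq> (\<lambda>f. dist_of_fun (apply_bcontfun f)) ` C0"
    using f(1) conv by blast
  show ?thesis
    by (rule exI[of _ ?m], rule conjI[OF sub], unfold eq, rule compf)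
qed

section \<open>From compactness in C0 to compactness in the strong dual\<close>

lemma bessel_op_iter_lincomb:
  assumes "\<phi> \<in> DL1" "\<psi> \<in> DL1"
  shows "(bessel_op ^^ m) (\<lambda>x. a * \<phi> x + b * \<psi> x) = (\<lambda>x. a * (bessel_op ^^ m) \<phi> x + b * (bessel_op ^^ m) \<psi> x)"
proof (rule DL1_eqI_fourier)
  fix \<xi>
  show "inverse_fourier ((bessel_op ^^ m) (\<lambda>x. a * \<phi> x + b * \<psi> x)) \<xi> =
    inverse_fourier (\<lambda>x. a * (bessel_op ^^ m) \<phi> x + b * (bessel_op ^^ m) \<psi> x) \<xi>"
    by (simp only: bessel_op_iter[OF DL1_lincomb[OF assms]] inverse_fourier_lincomb[OF DL1_integrable0[OF assms(1)] DL1_integrable0[OF assms(2)]]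
        inverse_fourier_lincomb[OF DL1_integrable0[OF bessel_op_iter(1)[OF assms(1)]] DL1_integrable0[OF bessel_op_iter(1)[OF assms(2)]]]
        bessel_op_iter(2)[OF assms(1)] bessel_op_iter(2)[OF assms(2)] distrib_left mult.left_commute)
qed (intro bessel_op_iter DL1_lincomb assms)+

lemma DL1_norm_bessel_op_iter:
  fixes \<phi> :: "real^'n::finite \<Rightarrow> complex"
  assumes "\<phi> \<in> DL1"
  shows "DL1_norm k ((bessel_op ^^ m) \<phi>) \<le> (1 + real CARD('n)) ^ m * DL1_norm (k + 2 * m) \<phi>"
proof (induction m arbitrary: k)
  case (Suc m)
  have "DL1_norm k ((bessel_op ^^ Suc m) \<phi>) \<le> (1 + real CARD('n)) * DL1_norm (k + 2) ((bessel_op ^^ m) \<phi>)"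
    using DL1_norm_bessel_op[OF bessel_op_iter(1)[OF assms]] by simp
  also have "\<dots> \<le> (1 + real CARD('n)) * ((1 + real CARD('n)) ^ m * DL1_norm (k + 2 + 2 * m) \<phi>)"
    by (intro mult_left_mono Suc.IH) auto
  finally show ?case by (simp add: mult.assoc)
qed simp

text \<open>The distribution (1 - \<Delta>)^m F, with the differential operator moved onto the test
  function; it is of even order, so no sign appears.\<close>

definition bessel_dist :: "nat \<Rightarrow> (real^'n::finite) \<Rightarrow>\<^sub>C complex \<Rightarrow> (real^'n \<Rightarrow> complex) \<Rightarrow> complex" where
  "bessel_dist m F = (\<lambda>\<psi>. if \<psi> \<in> DL1 then LINT x|lborel. apply_bcontfun F x * (bessel_op ^^ m) \<psi> x else 0)"

lemma bessel_dist_bound: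
  fixes F :: "(real^'n::finite) \<Rightarrow>\<^sub>C complex"
  assumes "\<psi> \<in> DL1"
  shows "cmod (bessel_dist m F \<psi>) \<le> norm F * (1 + real CARD('n)) ^ m * DL1_norm (2 * m) \<psi>"
proof -
  have "cmod (bessel_dist m F \<psi>) \<le> norm F * L1_norm ((bessel_op ^^ m) \<psi>)"
    using pairing(2)[OF DL1_integrable0[OF bessel_op_iter(1)[OF assms]]] assms by (simp add: bessel_dist_def)
  also have "\<dots> \<le> norm F * ((1 + real CARD('n)) ^ m * DL1_norm (2 * m) \<psi>)"
    using DL1_norm_bessel_op_iter[OF assms, of 0 m] by (intro mult_left_mono) (auto simp: DL1_norm_0)
  finally show ?thesis by (simp add: mult.assoc)
qed

lemma bessel_dist_dual: "bessel_dist m F \<in> DL1_dual"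
proof (rule DL1_dualI[OF _ _ bessel_dist_bound])
  fix \<phi> \<psi> :: "real^'a \<Rightarrow> complex" and a b assume \<phi>: "\<phi> \<in> DL1" and \<psi>: "\<psi> \<in> DL1"
  let ?I = "\<lambda>\<psi>. LINT x|lborel. apply_bcontfun F x * (bessel_op ^^ m) \<psi> x"
  have int: "integrable lborel (\<lambda>x. apply_bcontfun F x * (bessel_op ^^ m) \<phi> x)" "integrable lborel (\<lambda>x. apply_bcontfun F x * (bessel_op ^^ m) \<psi> x)"
    by (intro pairing(1) DL1_integrable0 bessel_op_iter \<phi> \<psi>)+
  have "?I (\<lambda>x. a * \<phi> x + b * \<psi> x) = (LINT x|lborel. a * (apply_bcontfun F x * (bessel_op ^^ m) \<phi> x) + b * (apply_bcontfun F x * (bessel_op ^^ m) \<psi> x))"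
    by (simp only: bessel_op_iter_lincomb[OF \<phi> \<psi>] distrib_left mult.left_commute)
  also have "\<dots> = a * ?I \<phi> + b * ?I \<psi>"
    using int by (subst Bochner_Integration.integral_add) auto
  finally show "bessel_dist m F (\<lambda>x. a * \<phi> x + b * \<psi> x) = a * bessel_dist m F \<phi> + b * bessel_dist m F \<psi>"
    using \<phi> \<psi> DL1_lincomb[OF \<phi> \<psi>] by (simp add: bessel_dist_def)
qed (simp add: bessel_dist_def)

lemma bessel_dist_diff: "bessel_dist m (F - G) = (\<lambda>\<psi>. bessel_dist m F \<psi> - bessel_dist m G \<psi>)"
proof
  fix \<psi>
  show "bessel_dist m (F - G) \<psi> = bessel_dist m F \<psi> - bessel_dist m G \<psi>"
  proof (cases "\<psi> \<in> DL1")
    case True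
    then show ?thesis
      unfolding bessel_dist_def by (simp only: if_True pairing_diff[OF DL1_integrable0[OF bessel_op_iter(1)[OF True]]])
  qed (simp add: bessel_dist_def)
qed

text \<open>The convolution identity is evaluated at (1 - \<Delta>)^m \<psi>, on which the m-fold
  resolvent returns \<psi>.\<close>

lemma bessel_dist_eqI:
  assumes S: "S \<in> DL1_dual" and eq: "dist_conv (bessel_kernel (2 * real m)) S = dist_of_fun (apply_bcontfun F)"
  shows "S = bessel_dist m F"
proof
  fix \<psi>
  show "S \<psi> = bessel_dist m F \<psi>"
  proof (cases "\<psi> \<in> DL1")
    case True
    have "S ((resolvent ^^ m) ((bessel_op ^^ m) \<psi>)) = (LINT x|lborel. apply_bcontfun F x * (bessel_op ^^ m) \<psi> x)"
      using eq bessel_op_iter(1)[OF True] unfolding dist_conv_eq_iff by blast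
    then show ?thesis using True by (simp add: bessel_dist_def resolvent_iter_bessel_op)
  next
    case False
    then show ?thesis using S by (simp add: bessel_dist_def DL1_dual_def)
  qed
qed

text \<open>For each bounded set the seminorm of the difference is at most a constant times the sup
  norm of \<open>G - F\<close>, the constant coming from the bound of the norm of index
  \<open>2 * m\<close> on that set. A basic neighbourhood involves finitely many such
  seminorms.\<close>

lemma bessel_dist_continuous: "continuous_map (top_of_set K) strong_dual_topology (bessel_dist m)"
  unfolding continuous_map_def
proof (intro conjI allI impI)
  show "bessel_dist m \<in> topspace (top_of_set K) \<rightarrow> topspace strong_dual_topology"
    by (simp add: bessel_dist_dual)
  fix U :: "((real^'a \<Rightarrow> complex) \<Rightarrow> complex) set" assume U: "openin strong_dual_topology U"
  have "open {F. bessel_dist m F \<in> U}"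
    unfolding open_contains_ball
  proof (intro ballI)
    fix F assume "F \<in> {F. bessel_dist m F \<in> U}"
    then have "\<exists>P\<subseteq>{sup_on B |B. DL1_bounded B \<and> B \<noteq> {}}. finite P \<and>
        (\<exists>\<epsilon>>0. {y \<in> DL1_dual. \<forall>p\<in>P. p (\<lambda>a. y a - bessel_dist m F a) < \<epsilon>} \<subseteq> U)"
      using U unfolding strong_seminorms openin_seminorm_topology mem_Collect_eq by (elim conjE) (erule (1) bspec)
    then obtain P e where P: "P \<subseteq> {sup_on B |B. DL1_bounded B \<and> B \<noteq> {}}" "finite P" "e > 0"
      "{y \<in> DL1_dual. \<forall>p\<in>P. p (\<lambda>a. y a - bessel_dist m F a) < e} \<subseteq> U" by (elim exE conjE)
    have "\<exists>b\<ge>0. \<forall>G. p (\<lambda>a. bessel_dist m G a - bessel_dist m F a) \<le> b * norm (G - F)" if p: "p \<in> P" for p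
    proof -
      obtain B where B: "p = sup_on B" "DL1_bounded B" "B \<noteq> {}" using subsetD[OF P(1) p] by blast
      obtain d where d: "\<And>\<psi>. \<psi> \<in> B \<Longrightarrow> DL1_norm (2 * m) \<psi> \<le> d" using B(2) unfolding DL1_bounded_def by metis
      let ?b = "(1 + real CARD('a)) ^ m * \<bar>d\<bar>"
      have "sup_on B (bessel_dist m (G - F)) \<le> ?b * norm (G - F)" for G
      proof (rule sup_on_least[OF B(3)])
        fix \<psi> assume \<psi>: "\<psi> \<in> B"
        then have "\<psi> \<in> DL1" using B(2) by (auto simp: DL1_bounded_def)
        then have "cmod (bessel_dist m (G - F) \<psi>) \<le> norm (G - F) * (1 + real CARD('a)) ^ m * DL1_norm (2 * m) \<psi>"
          by (rule bessel_dist_bound)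
        also have "\<dots> \<le> norm (G - F) * (1 + real CARD('a)) ^ m * \<bar>d\<bar>"
          using d[OF \<psi>] by (intro mult_left_mono) auto
        finally show "cmod (bessel_dist m (G - F) \<psi>) \<le> ?b * norm (G - F)" by (simp add: mult_ac)
      qed
      then show ?thesis unfolding B(1) bessel_dist_diff by (intro exI[of _ ?b]) auto
    qed
    then obtain b where b: "\<And>p. p \<in> P \<Longrightarrow> b p \<ge> 0"
      "\<And>p G. p \<in> P \<Longrightarrow> p (\<lambda>a. bessel_dist m G a - bessel_dist m F a) \<le> b p * norm (G - F)" by metis
    \<comment> \<open>One constant for all seminorms in \<open>P\<close>, positive even if
      \<open>P\<close> is empty, so that \<open>e / s\<close> is a valid radius.\<close>
    define s where "s = (\<Sum>p\<in>P. b p) + 1"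
    have s: "s > 0" using b(1) by (simp add: s_def add_nonneg_pos sum_nonneg)
    have bs: "b p \<le> s" if "p \<in> P" for p
      using member_le_sum[OF that, of b] b(1) P(2) by (simp add: s_def)
    have "bessel_dist m G \<in> U" if G: "G \<in> ball F (e / s)" for G
    proof -
      have "p (\<lambda>a. bessel_dist m G a - bessel_dist m F a) < e" if p: "p \<in> P" for p
      proof -
        have "p (\<lambda>a. bessel_dist m G a - bessel_dist m F a) \<le> b p * norm (G - F)" by (rule b(2)[OF p])
        also have "\<dots> \<le> s * norm (G - F)" using bs[OF p] by (rule mult_right_mono) simp
        also have "\<dots> < e" using G s by (simp add: dist_norm norm_minus_commute field_simps)
        finally show ?thesis .
      qed
      then show ?thesis using P(4) bessel_dist_dual by blast
    qed
    then show "\<exists>e>0. ball F e \<subseteq> {F. bessel_dist m F \<in> U}" using P(3) s by (intro exI[of _ "e / s"]) auto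
  qed
  from openin_open_Int[OF this, of K]
  show "openin (top_of_set K) {F \<in> topspace (top_of_set K). bessel_dist m F \<in> U}"
    by (simp add: Int_def)
qed

text \<open>The set \<open>C\<close> is recovered as the image of the compact set of functions under
  (1 - \<Delta>)^m. The inclusion \<open>sub\<close> provides a preimage for every element of
  \<open>C\<close>.\<close>

lemma compact_C0_imp_compactin:
  assumes CD: "C \<subseteq> DL1_dual"
    and sub: "dist_conv (bessel_kernel (2 * real m)) ` C \<subseteq> (\<lambda>f. dist_of_fun (apply_bcontfun f)) ` C0"
    and comp: "compact {f\<in>C0. dist_of_fun (apply_bcontfun f) \<in> dist_conv (bessel_kernel (2 * real m)) ` C}"
  shows "compactin strong_dual_topology C"
proof -
  let ?K = "{f\<in>C0. dist_of_fun (apply_bcontfun f) \<in> dist_conv (bessel_kernel (2 * real m)) ` C}"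
  have "C = bessel_dist m ` ?K"
  proof (intro equalityI subsetI)
    fix S assume S: "S \<in> C"
    then obtain F where F: "F \<in> C0" "dist_conv (bessel_kernel (2 * real m)) S = dist_of_fun (apply_bcontfun F)" using sub by blast
    then have "S = bessel_dist m F" using S CD by (intro bessel_dist_eqI) auto
    moreover have "dist_of_fun (apply_bcontfun F) \<in> dist_conv (bessel_kernel (2 * real m)) ` C"
      unfolding F(2)[symmetric] by (rule imageI[OF S])
    then have "F \<in> ?K" using F(1) by simp
    ultimately show "S \<in> bessel_dist m ` ?K" by blast
  next
    fix T assume "T \<in> bessel_dist m ` ?K"
    then obtain F S where FS: "T = bessel_dist m F" "S \<in> C" "dist_conv (bessel_kernel (2 * real m)) S = dist_of_fun (apply_bcontfun F)" by auto
    then have "S = bessel_dist m F" using CD by (intro bessel_dist_eqI) auto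
    then show "T \<in> C" using FS by simp
  qed
  moreover have "compactin strong_dual_topology (bessel_dist m ` ?K)"
    by (rule image_compactin[OF _ bessel_dist_continuous[of ?K]]) (use comp in \<open>simp add: compactin_subtopology\<close>)
  ultimately show ?thesis by simp
qed

text \<open>The elements of L_{2m} * C are functionals, so compactness is expressed for the set of
  functions in \<open>C0\<close> that induce them; the inclusion in the first conjunct guarantees
  that these functions account for all of L_{2m} * C.\<close>

theorem proposition7:
  fixes C :: "((real^'n::finite \<Rightarrow> complex) \<Rightarrow> complex) set"
  assumes "C \<subseteq> B_dot_dual"
  shows "compactin B_dot_dual_topology C \<longleftrightarrow>
    (\<exists>m::nat.
       dist_conv (bessel_kernel (2 * real m)) ` C \<subseteq> (\<lambda>f. dist_of_fun (apply_bcontfun f)) ` C0 \<and>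
       compact {f\<in>C0. dist_of_fun (apply_bcontfun f) \<in> dist_conv (bessel_kernel (2 * real m)) ` C})"
proof -
  have "B_dot_dual \<subseteq> DL1_dual"
    using closure_of_subset_topspace[of strong_dual_topology compactly_supported] by (simp add: B_dot_dual_def)
  with assms have CD: "C \<subseteq> DL1_dual" by (rule subset_trans)
  \<comment> \<open>Compactness in a subspace is compactness in the ambient space for subsets of the
    subspace.\<close>
  have eq: "compactin B_dot_dual_topology C \<longleftrightarrow> compactin strong_dual_topology C"
    using assms by (simp add: B_dot_dual_topology_def compactin_subtopology)
  show ?thesis
    unfolding eq
  proof (rule iffI)
    assume "compactin strong_dual_topology C"
    then show "\<exists>m::nat.
       dist_conv (bessel_kernel (2 * real m)) ` C \<subseteq> (\<lambda>f. dist_of_fun (apply_bcontfun f)) ` C0 \<and>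
       compact {f\<in>C0. dist_of_fun (apply_bcontfun f) \<in> dist_conv (bessel_kernel (2 * real m)) ` C}"
      by (rule compactin_imp_compact_C0[OF assms])
  next
    assume "\<exists>m::nat.
       dist_conv (bessel_kernel (2 * real m)) ` C \<subseteq> (\<lambda>f. dist_of_fun (apply_bcontfun f)) ` C0 \<and>
       compact {f\<in>C0. dist_of_fun (apply_bcontfun f) \<in> dist_conv (bessel_kernel (2 * real m)) ` C}"
    then show "compactin strong_dual_topology C"
      by (elim exE conjE) (rule compact_C0_imp_compactin[OF CD])
  qed
qed

end
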